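(* Let $d\in\mathbb N$, $r>1/2$ and $1<q\le 2\le p<\infty$. Then $$\varrho_n\big(\boldsymbol H^r_p(\mathbb T^d),L_q(\mathbb T^d)\big)\asymp\left(\frac{(\log n)^{d-1}}{n}\right)^{r}(\log n)^{(d-1)/2},\qquad n\in\mathbb N,\ n\ge 2 .$$
   Context: $\mathbb T^d=[0,1]^d$ with opposite faces identified; functions on $\mathbb T^d$ are functions on $\mathbb R^d$ that are $1$-periodic in each variable, and $\|\cdot\|_p$ is the norm of $L_p(\mathbb T^d)$. Hölder–Nikol'skii space of mixed smoothness: fix an integer $\ell>r$. For univariate $f$ put $\Delta_h^\ell(f,x)=\sum_{j=0}^\ell(-1)^{\ell-j}\binom{\ell}{j}f(x+jh)$. For $u\subset[d]=\{1,\dots,d\}$ let $\Delta^{\ell,u}_{\boldsymbol h}=\prod_{i\in u}\Delta^\ell_{h_i}$, where $\Delta^\ell_{h_i}$ acts in the variable $x_i$ with the others fixed, and $\Delta^{\ell,\varnothing}_{\boldsymbol h}$ is the identity. Put $\omega^u_\ell(f,\boldsymbol t)_p=\sup_{|h_i|<t_i,\ i\in u}\|\Delta^{\ell,u}_{\boldsymbol h}(f)\|_p$ for $\boldsymbol t\in[0,1]^d$ (so $\omega_\ell^\varnothing(f,\boldsymbol t)_p=\|f\|_p$). Then $H^r_p(\mathbb T^d)$ is the space of $f\in L_p(\mathbb T^d)$ for which $$\|f\|_{H^r_p(\mathbb T^d)}=\sum_{u\subset[d]}\ \sup_{\boldsymbol t\in(0,1]^d}\ \prod_{i\in u}t_i^{-r}\,\omega_\ell^u(f,\boldsymbol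 t)_p<\infty ,$$ and $\boldsymbol H^r_p(\mathbb T^d)$ is its unit ball. For $r>1/p$ its elements are identified with their continuous representatives. For a set $\boldsymbol W$ of functions on a domain $\Omega$ contained in a normed space $X$ of functions on $\Omega$, the linear sampling $n$-width is $$\varrho_n(\boldsymbol W,X)=\inf_{k\le n,\ \boldsymbol x_1,\dots,\boldsymbol x_k\in\Omega,\ \varphi_1,\dots,\varphi_k\in X}\ \sup_{f\in \boldsymbol W}\Big\|f-\sum_{i=1}^kf(\boldsymbol x_i)\varphi_i\Big\|_X .$$ $A_n\asymp B_n$ means $cB_n\le A_n\le CB_n$ with constants $c,C>0$ independent of $n$. *)

theory Defs
  imports "HOL-Analysis.Analysis"
begin

text \<open>The dimension is \<open>d = CARD('n)\<close>. Functions take values in a type that is both a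
  \<open>real_normed_field\<close> and a \<open>euclidean_space\<close>; the instances are \<open>real\<close> and \<open>complex\<close>.\<close>

definition periodic :: "(real ^ 'n \<Rightarrow> 'a) \<Rightarrow> bool" where
  "periodic f \<longleftrightarrow> (\<forall>x i. f (x + axis i 1) = f x)"

definition Lp_norm :: "real \<Rightarrow> (real ^ 'n \<Rightarrow> 'a::{real_normed_field, euclidean_space}) \<Rightarrow> ennreal" where
  "Lp_norm p f =
     (let I = (\<integral>\<^sup>+ x. ennreal (norm (f x) powr p) \<partial>lebesgue_on (cbox 0 1))
      in if I = \<infinity> then \<infinity> else ennreal (enn2real I powr (1 / p)))"

text \<open>Elements of \<open>Lp_space\<close> are functions, not classes modulo null sets; \<open>Lp_norm\<close> is a
  seminorm on it.\<close>

definition Lp_space :: "real \<Rightarrow> (real ^ 'n \<Rightarrow> 'a::{real_normed_field, euclidean_space}) set" where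
  "Lp_space p = {f. periodic f \<and> f \<in> borel_measurable lebesgue \<and> Lp_norm p f < \<infinity>}"

definition partial_difference ::
    "nat \<Rightarrow> 'n \<Rightarrow> real \<Rightarrow> (real ^ 'n \<Rightarrow> 'a::{real_normed_field, euclidean_space}) \<Rightarrow> real ^ 'n \<Rightarrow> 'a" where
  "partial_difference l i s f =
     (\<lambda>x. \<Sum>j\<le>l. (-1) ^ (l - j) * of_nat (l choose j) * f (x + axis i (real j * s)))"

text \<open>Composition of the operators \<open>partial_difference l i (h $ i)\<close> over \<open>i \<in> u\<close>; they commute,
  so the fold does not depend on the order (see \<open>mixed_difference_insert\<close>).\<close>

definition mixed_difference ::
    "nat \<Rightarrow> 'n set \<Rightarrow> real ^ 'n \<Rightarrow> (real ^ 'n \<Rightarrow> 'a::{real_normed_field, euclidean_space}) \<Rightarrow> real ^ 'n \<Rightarrow> 'a" where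
  "mixed_difference l u h f = Finite_Set.fold (\<lambda>i. partial_difference l i (h $ i)) f u"

lemma partial_difference_commute:
  "partial_difference l i s (partial_difference l k t f) =
   partial_difference l k t (partial_difference l i s f)"
proof
  fix x
  let ?c = "\<lambda>j. (-1) ^ (l - j) * of_nat (l choose j) :: 'b"
  have "partial_difference l i s (partial_difference l k t f) x =
      (\<Sum>a\<le>l. \<Sum>b\<le>l. ?c a * (?c b * f (x + axis i (real a * s) + axis k (real b * t))))"
    by (simp add: partial_difference_def sum_distrib_left)
  also have "\<dots> = (\<Sum>b\<le>l. \<Sum>a\<le>l. ?c a * (?c b * f (x + axis i (real a * s) + axis k (real b * t))))"
    by (rule sum.swap)
  also have "\<dots> = (\<Sum>b\<le>l. \<Sum>a\<le>l. ?c b * (?c a * f (x + axis k (real b * t) + axis i (real a * s))))"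
    by (simp only: mult.left_commute ac_simps)
  also have "\<dots> = partial_difference l k t (partial_difference l i s f) x"
    by (simp add: partial_difference_def sum_distrib_left)
  finally show "partial_difference l i s (partial_difference l k t f) x =
      partial_difference l k t (partial_difference l i s f) x" .
qed

lemma mixed_difference_empty: "mixed_difference l {} h f = f"
  by (simp add: mixed_difference_def)

lemma mixed_difference_insert:
  assumes "i \<notin> u"
  shows "mixed_difference l (insert i u) h f =
    partial_difference l i (h $ i) (mixed_difference l u h f)"
proof -
  interpret comp_fun_commute "\<lambda>i. partial_difference l i (h $ i)"
    by unfold_locales (auto simp: partial_difference_commute)
  show ?thesis
    using assms by (simp add: mixed_difference_def)
qed

definition mixed_modulus ::
    "nat \<Rightarrow> 'n set \<Rightarrow> real \<Rightarrow> (real ^ 'n \<Rightarrow> 'a::{real_normed_field, euclidean_space}) \<Rightarrow> real ^ 'n \<Rightarrow> ennreal" where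
  "mixed_modulus l u p f t =
     (SUP h\<in>{h. \<forall>i\<in>u. \<bar>h $ i\<bar> < t $ i}. Lp_norm p (mixed_difference l u h f))"

definition HN_norm ::
    "nat \<Rightarrow> real \<Rightarrow> real \<Rightarrow> (real ^ 'n \<Rightarrow> 'a::{real_normed_field, euclidean_space}) \<Rightarrow> ennreal" where
  "HN_norm l r p f =
     (\<Sum>u\<in>Pow UNIV. SUP t\<in>{t. \<forall>i. 0 < t $ i \<and> t $ i \<le> 1}.
        ennreal (\<Prod>i\<in>u. t $ i powr (- r)) * mixed_modulus l u p f t)"

definition HN_space ::
    "nat \<Rightarrow> real \<Rightarrow> real \<Rightarrow> (real ^ 'n \<Rightarrow> 'a::{real_normed_field, euclidean_space}) set" where
  "HN_space l r p = {f \<in> Lp_space p. HN_norm l r p f < \<infinity>}"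

text \<open>For \<open>r > 1/p\<close> every class in the space has exactly one continuous representative; the
  unit ball consists of these, so that point values make sense.\<close>

definition HN_ball ::
    "nat \<Rightarrow> real \<Rightarrow> real \<Rightarrow> (real ^ 'n \<Rightarrow> 'a::{real_normed_field, euclidean_space}) set" where
  "HN_ball l r p = {f \<in> HN_space l r p. continuous_on UNIV f \<and> HN_norm l r p f \<le> 1}"

text \<open>\<open>X\<close> is a space of functions on the domain \<open>\<Omega>\<close>, with norm \<open>N\<close>.\<close>

definition linear_sampling_width ::
    "nat \<Rightarrow> ('x \<Rightarrow> 'a::real_normed_field) set \<Rightarrow> 'x set \<Rightarrow> ('x \<Rightarrow> 'a) set \<Rightarrow>
     (('x \<Rightarrow> 'a) \<Rightarrow> ennreal) \<Rightarrow> ennreal" where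
  "linear_sampling_width n W \<Omega> X N =
     (INF k\<in>{..n}. INF x\<in>{1..k} \<rightarrow> \<Omega>. INF \<phi>\<in>{1..k} \<rightarrow> X.
        SUP f\<in>W. N (\<lambda>y. f y - (\<Sum>i=1..k. f (x i) * \<phi> i y)))"

end

theory Submission
  imports Defs
begin

text \<open>
  Upper bound: monotonicity reduces to \<open>p = q = 2\<close>. On dyadic blocks of frequencies of total level \<open>j\<close> the
  Fourier coefficients have norm at most \<open>2\<^bsup>-rj\<^esup>\<close>, so after suitable weighting of the blocks the
  functions lie in the ball of a Hilbert space with reproducing kernel. Sampling points for this space are chosen
  greedily by a one-sided version of the barrier argument of Batson, Spielman and Srivastava: starting
  from the diagonal weight matrix \<open>D\<close> instead of \<open>0\<close>, only a lower barrier for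
  \<open>D + s \<Sum> v v\<^sup>T\<close> is needed, and it shows that \<open>O(N)\<close> samples achieve the squared error
  \<open>1/N\<close> times the sum of the inverse weights beyond the first \<open>N\<close>. Smolyak's algorithm would lose logarithms here.

  Lower bound: only the rank of the approximation matters. The test functions are random sign
  combinations of bumps on all dyadic boxes of volume \<open>2\<^bsup>-m\<^esup>\<close>. They are biorthogonal to Haar functions, and the error is
  tested against the combination of Haar functions whose coefficients are the signs projected onto the orthogonal
  complement of the range of the approximation.
\<close>

section \<open>A barrier argument for positive definite matrices\<close>

text \<open>The constants balance as follows. Let M be \<open>level_count\<close> at level m, of
  order m^(d-1), and N of order 2^m m^(d-1), the size of the hyperbolic cross of level m. The
  inverse weights above level m sum to at most \<tau> of order 2^((1-2r)m) m^(d-1), so \<tau>/N is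
  of order 2^(-2rm); the weighted energy of the class is at most of order m^(d-1). The product is
  the squared error, and its root is the rate for n of order N. The barrier works with finitely many
  frequencies and real matrices. Hence each function is replaced, uniformly up to order 2^(-rm), by
  a polynomial in the real Hartley basis, and the remainder enters as noise in the samples. The
  assumption r > 1/2 makes both this remainder and the inverse weights summable. In the lower bound
  there are M 2^m boxes, but at most M Haar functions are nonzero at a point. A flat witness thus
  has size sqrt M against a pairing of order 2^(-rm) M, which leaves the error 2^(-rm) sqrt M. Equal
  volume gives biorthogonality: for different shapes the bump is finer than the Haar function in
  some coordinate and integrates to 0 there.\<close>

definition inner_on :: "'i set \<Rightarrow> ('i \<Rightarrow> real) \<Rightarrow> ('i \<Rightarrow> real) \<Rightarrow> real" where
  "inner_on I a b = (\<Sum>i\<in>I. a i * b i)"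

definition mat_vec :: "'i set \<Rightarrow> ('i \<Rightarrow> 'i \<Rightarrow> real) \<Rightarrow> ('i \<Rightarrow> real) \<Rightarrow> 'i \<Rightarrow> real" where
  "mat_vec I C b = (\<lambda>i. \<Sum>j\<in>I. C i j * b j)"

definition mat_mult :: "'i set \<Rightarrow> ('i \<Rightarrow> 'i \<Rightarrow> real) \<Rightarrow> ('i \<Rightarrow> 'i \<Rightarrow> real) \<Rightarrow> 'i \<Rightarrow> 'i \<Rightarrow> real" where
  "mat_mult I A B = (\<lambda>i j. \<Sum>k\<in>I. A i k * B k j)"

definition trace_on :: "'i set \<Rightarrow> ('i \<Rightarrow> 'i \<Rightarrow> real) \<Rightarrow> real" where
  "trace_on I C = (\<Sum>i\<in>I. C i i)"

text \<open>Symmetry is demanded on the whole index type, so that matrices can be transposed without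
  membership conditions; the quadratic form sees only the entries on \<open>I\<close>.\<close>

definition psd :: "'i set \<Rightarrow> ('i \<Rightarrow> 'i \<Rightarrow> real) \<Rightarrow> bool" where
  "psd I C \<longleftrightarrow> (\<forall>i j. C i j = C j i) \<and> (\<forall>x. 0 \<le> inner_on I x (mat_vec I C x))"

section \<open>Bilinear algebra and positive semidefinite forms on a finite index set\<close>

lemma inner_on_commute: "inner_on I a b = inner_on I b a"
  by (simp add: inner_on_def mult.commute)

lemma inner_on_add_left: "inner_on I (\<lambda>i. a i + b i) c = inner_on I a c + inner_on I b c"
  by (simp add: inner_on_def distrib_right sum.distrib)

lemma inner_on_add_right: "inner_on I c (\<lambda>i. a i + b i) = inner_on I c a + inner_on I c b"
  by (simp add: inner_on_def distrib_left sum.distrib)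

lemma inner_on_diff_left: "inner_on I (\<lambda>i. a i - b i) c = inner_on I a c - inner_on I b c"
  by (simp add: inner_on_def left_diff_distrib sum_subtractf)

lemma inner_on_diff_right: "inner_on I c (\<lambda>i. a i - b i) = inner_on I c a - inner_on I c b"
  by (simp add: inner_on_def right_diff_distrib sum_subtractf)

lemma inner_on_scale_left: "inner_on I (\<lambda>i. r * a i) c = r * inner_on I a c"
  by (simp add: inner_on_def sum_distrib_left mult_ac)

lemma inner_on_scale_right: "inner_on I c (\<lambda>i. r * a i) = r * inner_on I c a"
  by (simp add: inner_on_def sum_distrib_left mult_ac)

lemmas inner_on_linear = inner_on_add_left inner_on_add_right inner_on_diff_left inner_on_diff_right inner_on_scale_left inner_on_scale_right

lemma inner_on_self_nonneg: "0 \<le> inner_on I a a"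
  by (simp add: inner_on_def sum_nonneg)

lemma mat_vec_add: "mat_vec I C (\<lambda>i. a i + b i) = (\<lambda>i. mat_vec I C a i + mat_vec I C b i)"
  by (simp add: mat_vec_def distrib_left sum.distrib)

lemma mat_vec_diff: "mat_vec I C (\<lambda>i. a i - b i) = (\<lambda>i. mat_vec I C a i - mat_vec I C b i)"
  by (simp add: mat_vec_def right_diff_distrib sum_subtractf)

lemma mat_vec_scale: "mat_vec I C (\<lambda>i. r * a i) = (\<lambda>i. r * mat_vec I C a i)"
  by (simp add: mat_vec_def sum_distrib_left mult_ac)

lemmas mat_vec_linear = mat_vec_add mat_vec_diff mat_vec_scale

lemma mat_vec_sym:
  assumes "\<And>i j. C i j = C j i"
  shows "inner_on I a (mat_vec I C b) = inner_on I b (mat_vec I C a)"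
proof -
  have "inner_on I a (mat_vec I C b) = (\<Sum>i\<in>I. \<Sum>j\<in>I. a i * (C i j * b j))"
    by (simp add: inner_on_def mat_vec_def sum_distrib_left)
  also have "\<dots> = (\<Sum>j\<in>I. \<Sum>i\<in>I. a i * (C i j * b j))" by (rule sum.swap)
  also have "\<dots> = (\<Sum>j\<in>I. \<Sum>i\<in>I. b j * (C j i * a i))"
    by (intro sum.cong refl, subst assms) simp
  also have "\<dots> = inner_on I b (mat_vec I C a)"
    by (simp add: inner_on_def mat_vec_def sum_distrib_left)
  finally show ?thesis .
qed

lemma mat_vec_mat_mult: "mat_vec I (mat_mult I A B) x = mat_vec I A (mat_vec I B x)"
proof
  fix i
  have "mat_vec I (mat_mult I A B) x i = (\<Sum>j\<in>I. \<Sum>k\<in>I. A i k * B k j * x j)"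
    by (simp add: mat_vec_def mat_mult_def sum_distrib_right)
  also have "\<dots> = (\<Sum>k\<in>I. \<Sum>j\<in>I. A i k * B k j * x j)" by (rule sum.swap)
  also have "\<dots> = mat_vec I A (mat_vec I B x) i"
    by (simp add: mat_vec_def sum_distrib_left mult_ac)
  finally show "mat_vec I (mat_mult I A B) x i = mat_vec I A (mat_vec I B x) i" .
qed

lemma psd_sym: "psd I C \<Longrightarrow> C i j = C j i"
  by (simp add: psd_def)

lemma psd_nonneg: "psd I C \<Longrightarrow> 0 \<le> inner_on I x (mat_vec I C x)"
  by (simp add: psd_def)

lemma psd_cauchy_schwarz:
  assumes C: "psd I C"
  shows "(inner_on I x (mat_vec I C y))\<^sup>2 \<le> inner_on I x (mat_vec I C x) * inner_on I y (mat_vec I C y)"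
proof -
  let ?a = "inner_on I x (mat_vec I C x)" and ?b = "inner_on I x (mat_vec I C y)" and ?c = "inner_on I y (mat_vec I C y)"
  have sym: "inner_on I y (mat_vec I C x) = ?b"
    by (rule mat_vec_sym) (rule psd_sym[OF C])
  have q: "0 \<le> ?a - 2 * t * ?b + t\<^sup>2 * ?c" for t
    using psd_nonneg[OF C, of "\<lambda>i. x i - t * y i"]
    by (simp add: mat_vec_linear inner_on_linear sym power2_eq_square algebra_simps)
  have c: "0 \<le> ?c" by (rule psd_nonneg[OF C])
  show ?thesis
  proof (cases "?c = 0")
    case True
    have "?b = 0"
    proof (rule ccontr)
      assume "?b \<noteq> 0"
      \<comment> \<open>For \<open>?c = 0\<close> the polynomial in \<open>q\<close> is affine in t;
        this t gives it the value -1.\<close>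
      with q[of "(?a + 1) / (2 * ?b)"] True show False by simp
    qed
    with True show ?thesis by simp
  next
    case False
    have "0 \<le> (?a - 2 * (?b / ?c) * ?b + (?b / ?c)\<^sup>2 * ?c) * ?c"
      using q[of "?b / ?c"] c by simp
    also have "\<dots> = ?a * ?c - ?b\<^sup>2"
      using False by (simp add: field_simps power2_eq_square)
    finally show ?thesis by simp
  qed
qed

lemma inner_on_unit: "finite I \<Longrightarrow> i \<in> I \<Longrightarrow> inner_on I (\<lambda>k. if k = i then 1 else 0) b = b i"
  by (simp add: inner_on_def of_bool_def[symmetric])

lemma mat_vec_unit: "finite I \<Longrightarrow> j \<in> I \<Longrightarrow> mat_vec I C (\<lambda>k. if k = j then 1 else 0) i = C i j"
  by (simp add: mat_vec_def of_bool_def[symmetric])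

lemma psd_minor:
  assumes "finite I" "psd I C" "i \<in> I" "j \<in> I"
  shows "(C i j)\<^sup>2 \<le> C i i * C j j" "0 \<le> C i i"
  using psd_cauchy_schwarz[OF assms(2), of "\<lambda>k. if k = i then 1 else 0" "\<lambda>k. if k = j then 1 else 0"]
    psd_nonneg[OF assms(2), of "\<lambda>k. if k = i then 1 else 0"] assms
  by (simp_all add: inner_on_unit mat_vec_unit)

lemma psd_trace_on_nonneg: "finite I \<Longrightarrow> psd I C \<Longrightarrow> 0 \<le> trace_on I C"
  unfolding trace_on_def by (intro sum_nonneg psd_minor(2))

lemma trace_on_mat_mult_self:
  assumes "\<And>i j. C i j = C j i"
  shows "trace_on I (mat_mult I C C) = (\<Sum>i\<in>I. \<Sum>j\<in>I. (C i j)\<^sup>2)"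
  unfolding trace_on_def mat_mult_def power2_eq_square
proof (intro sum.cong refl)
  fix i j
  show "C i j * C j i = C i j * C i j" using assms[of i j] by simp
qed

text \<open>Squared entries of \<open>C\<close> are bounded by products of diagonal entries (2 by 2
  minors), which replaces an argument with eigenvalues.\<close>

lemma psd_trace_on_mat_mult_le:
  assumes "finite I" "psd I C"
  shows "trace_on I (mat_mult I C C) \<le> (trace_on I C)\<^sup>2"
proof -
  have "trace_on I (mat_mult I C C) \<le> (\<Sum>i\<in>I. \<Sum>j\<in>I. C i i * C j j)"
    unfolding trace_on_mat_mult_self[of C, OF psd_sym[OF assms(2)]]
    by (intro sum_mono psd_minor(1)) (use assms in auto)
  also have "\<dots> = (trace_on I C)\<^sup>2"
    by (simp add: trace_on_def power2_eq_square sum_product)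
  finally show ?thesis .
qed

text \<open>Stands in for the bound of the largest eigenvalue by the trace. The entries are again
  controlled by 2 by 2 minors, and Cauchy-Schwarz separates the diagonal from
  \<open>x\<close>.\<close>

lemma psd_le_trace_on:
  assumes "finite I" "psd I C"
  shows "inner_on I x (mat_vec I C x) \<le> trace_on I C * inner_on I x x"
proof -
  have ge: "0 \<le> C i i" if "i \<in> I" for i using psd_minor(2)[OF assms that that] .
  have "inner_on I x (mat_vec I C x) = (\<Sum>i\<in>I. \<Sum>j\<in>I. x i * x j * C i j)"
    by (simp add: inner_on_def mat_vec_def sum_distrib_left mult_ac)
  also have "\<dots> \<le> (\<Sum>i\<in>I. \<Sum>j\<in>I. (\<bar>x i\<bar> * sqrt (C i i)) * (\<bar>x j\<bar> * sqrt (C j j)))"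
  proof (intro sum_mono)
    fix i j assume ij: "i \<in> I" "j \<in> I"
    have "\<bar>C i j\<bar> \<le> sqrt (C i i) * sqrt (C j j)"
      using real_sqrt_le_mono[OF psd_minor(1)[OF assms ij]] by (simp add: real_sqrt_mult)
    then have "\<bar>x i * x j * C i j\<bar> \<le> \<bar>x i\<bar> * \<bar>x j\<bar> * (sqrt (C i i) * sqrt (C j j))"
      by (simp add: abs_mult mult_left_mono)
    then show "x i * x j * C i j \<le> (\<bar>x i\<bar> * sqrt (C i i)) * (\<bar>x j\<bar> * sqrt (C j j))"
      by (simp add: mult_ac)
  qed
  also have "\<dots> = (\<Sum>i\<in>I. sqrt (C i i) * \<bar>x i\<bar>)\<^sup>2"
    by (simp add: power2_eq_square sum_product mult_ac)
  also have "\<dots> \<le> (\<Sum>i\<in>I. (sqrt (C i i))\<^sup>2) * (\<Sum>i\<in>I. \<bar>x i\<bar>\<^sup>2)"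
    by (rule Cauchy_Schwarz_ineq_sum)
  also have "\<dots> = trace_on I C * inner_on I x x"
    using ge by (simp add: trace_on_def inner_on_def power2_eq_square)
  finally show ?thesis .
qed

section \<open>Raising the barrier\<close>

definition shifted :: "'i set \<Rightarrow> real \<Rightarrow> ('i \<Rightarrow> 'i \<Rightarrow> real) \<Rightarrow> 'i \<Rightarrow> 'i \<Rightarrow> real" where
  "shifted I \<delta> C = (\<lambda>i j. C i j + 2 * \<delta> * mat_mult I C C i j)"

lemma mat_vec_shifted: "mat_vec I (shifted I \<delta> C) x = (\<lambda>i. mat_vec I C x i + 2 * \<delta> * mat_vec I C (mat_vec I C x) i)"
proof
  fix i
  have "mat_vec I (shifted I \<delta> C) x i = mat_vec I C x i + 2 * \<delta> * mat_vec I (mat_mult I C C) x i"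
    unfolding shifted_def mat_vec_def distrib_right sum.distrib sum_distrib_left by (simp only: mult.assoc)
  then show "mat_vec I (shifted I \<delta> C) x i = mat_vec I C x i + 2 * \<delta> * mat_vec I C (mat_vec I C x) i"
    by (simp add: mat_vec_mat_mult)
qed

lemma psd_shifted:
  assumes C: "psd I C" and \<delta>: "0 \<le> \<delta>"
  shows "psd I (shifted I \<delta> C)"
  unfolding psd_def
proof (intro conjI allI)
  fix i j
  show "shifted I \<delta> C i j = shifted I \<delta> C j i"
    using psd_sym[OF C] by (simp add: shifted_def mat_mult_def mult.commute)
next
  fix x
  have "inner_on I x (mat_vec I C (mat_vec I C x)) = inner_on I (mat_vec I C x) (mat_vec I C x)"
    by (rule mat_vec_sym) (rule psd_sym[OF C])
  then show "0 \<le> inner_on I x (mat_vec I (shifted I \<delta> C) x)"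
    using psd_nonneg[OF C, of x] inner_on_self_nonneg[of I "mat_vec I C x"] \<delta>
    by (simp add: mat_vec_shifted inner_on_linear)
qed

lemma trace_on_shifted: "trace_on I (shifted I \<delta> C) = trace_on I C + 2 * \<delta> * trace_on I (mat_mult I C C)"
  by (simp add: trace_on_def shifted_def sum.distrib sum_distrib_left)

text \<open>Raising the barrier costs 2 \<delta> tr(C^2), while a new point gains a multiple of the
  trace of the squared shifted matrix; this compares the two. The cross term is 4 \<delta> tr(C^3),
  and tr(C^3) is the quadratic form of \<open>C\<close> summed over its own rows.\<close>

lemma trace_on_mat_mult_shifted:
  assumes fin: "finite I" and C: "psd I C" and \<delta>: "0 \<le> \<delta>"
  shows "trace_on I (mat_mult I C C) \<le> trace_on I (mat_mult I (shifted I \<delta> C) (shifted I \<delta> C))"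
proof -
  note sym = psd_sym[OF C]
  have cubic: "0 \<le> (\<Sum>i\<in>I. \<Sum>j\<in>I. C i j * mat_mult I C C i j)"
  proof (rule sum_nonneg)
    fix i assume "i \<in> I"
    have "mat_mult I C C i j = mat_vec I C (C i) j" for j
      unfolding mat_mult_def mat_vec_def
    proof (rule sum.cong)
      fix k
      show "C i k * C k j = C j k * C i k" using sym[of k j] by simp
    qed simp
    then have "(\<Sum>j\<in>I. C i j * mat_mult I C C i j) = inner_on I (C i) (mat_vec I C (C i))"
      by (simp add: inner_on_def)
    then show "0 \<le> (\<Sum>j\<in>I. C i j * mat_mult I C C i j)" using psd_nonneg[OF C] by simp
  qed
  have "trace_on I (mat_mult I (shifted I \<delta> C) (shifted I \<delta> C)) = (\<Sum>i\<in>I. \<Sum>j\<in>I. (shifted I \<delta> C i j)\<^sup>2)"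
    by (rule trace_on_mat_mult_self) (rule psd_sym[OF psd_shifted[OF C \<delta>]])
  also have "\<dots> = (\<Sum>i\<in>I. \<Sum>j\<in>I. (C i j)\<^sup>2 + 4 * \<delta> * (C i j * mat_mult I C C i j) + 4 * \<delta>\<^sup>2 * (mat_mult I C C i j)\<^sup>2)"
    unfolding shifted_def by (intro sum.cong refl) (simp add: power2_eq_square algebra_simps)
  also have "\<dots> = trace_on I (mat_mult I C C) + 4 * \<delta> * (\<Sum>i\<in>I. \<Sum>j\<in>I. C i j * mat_mult I C C i j)
      + 4 * \<delta>\<^sup>2 * (\<Sum>i\<in>I. \<Sum>j\<in>I. (mat_mult I C C i j)\<^sup>2)"
    by (simp add: sum.distrib sum_distrib_left trace_on_mat_mult_self[of C, OF sym])
  finally show ?thesis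
    using cubic \<delta> by (simp add: sum_nonneg)
qed

text \<open>The hypothesis on all \<open>b\<close> says \<open>l + C\<^bsup>-1\<^esup> \<le> R\<close> as quadratic forms without mentioning the
  inverse. Since \<open>(C\<^bsup>-1\<^esup> - \<delta>)\<^bsup>-1\<^esup> \<le> C + 2\<delta>C\<^sup>2\<close> for \<open>2\<delta>C \<le> 1\<close>, raising \<open>l\<close> by \<open>\<delta>\<close>
  costs at most the step from \<open>C\<close> to \<open>shifted I \<delta> C\<close>.\<close>

lemma shifted_dominates:
  assumes fin: "finite I" and C: "psd I C" and \<delta>: "0 \<le> \<delta>" and small: "2 * \<delta> * trace_on I C \<le> 1"
    and inv: "\<And>b. l * inner_on I a a + 2 * inner_on I a b - inner_on I b (mat_vec I C b) \<le> R"
  shows "(l + \<delta>) * inner_on I a a + 2 * inner_on I a b - inner_on I b (mat_vec I (shifted I \<delta> C) b) \<le> R"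
proof -
  define c where "c = mat_vec I C b"
  define w where "w = (\<lambda>i. a i - c i)"
  have sym: "inner_on I x (mat_vec I C y) = inner_on I y (mat_vec I C x)" for x y
    by (rule mat_vec_sym) (rule psd_sym[OF C])
  have ww: "inner_on I w (mat_vec I C w) \<le> trace_on I C * inner_on I w w" by (rule psd_le_trace_on[OF fin C])
  have *: "2 * \<delta> * inner_on I w (mat_vec I C w) \<le> inner_on I w w"
  proof -
    have "2 * \<delta> * inner_on I w (mat_vec I C w) \<le> 2 * \<delta> * (trace_on I C * inner_on I w w)"
      using ww \<delta> by (intro mult_left_mono) auto
    also have "\<dots> = (2 * \<delta> * trace_on I C) * inner_on I w w" by simp
    also have "\<dots> \<le> 1 * inner_on I w w" using small inner_on_self_nonneg by (rule mult_right_mono)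
    finally show ?thesis by simp
  qed
  have wc: "inner_on I w (mat_vec I C b) = inner_on I w c" by (simp add: c_def)
  have "l * inner_on I a a + 2 * inner_on I a b - inner_on I b (mat_vec I C b)
      + 4 * \<delta> * (inner_on I a w - inner_on I w c) - 4 * \<delta>\<^sup>2 * inner_on I w (mat_vec I C w) \<le> R"
  proof -
    \<comment> \<open>The hypothesis is used at b + 2 \<delta> w. Since 2 w is the gradient in b of
      2 <a,b> - <b,Cb>, this is a gradient step of length \<delta>.\<close>
    define k where "k = 2 * \<delta>"
    have "l * inner_on I a a + 2 * (inner_on I a b + k * inner_on I a w)
        - (inner_on I b (mat_vec I C b) + k * inner_on I w c + (k * inner_on I w c + k * (k * inner_on I w (mat_vec I C w)))) \<le> R"
      using inv[of "\<lambda>i. b i + k * w i"]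
      by (simp add: mat_vec_linear inner_on_linear sym[of b w] wc add.assoc distrib_left)
    then show ?thesis by (simp add: k_def power2_eq_square algebra_simps)
  qed
  moreover have "inner_on I a w - inner_on I w c = inner_on I w w"
    by (simp add: w_def inner_on_linear inner_on_commute[of I c a])
  moreover have "4 * \<delta>\<^sup>2 * inner_on I w (mat_vec I C w) \<le> 2 * \<delta> * inner_on I w w"
    using mult_left_mono[OF *, of "2 * \<delta>"] \<delta> by (simp add: power2_eq_square algebra_simps)
  moreover have "inner_on I a a \<le> 2 * inner_on I w w + 2 * inner_on I c c"
  proof -
    have "0 \<le> inner_on I (\<lambda>i. w i - c i) (\<lambda>i. w i - c i)" by (rule inner_on_self_nonneg)
    moreover have "inner_on I a a = inner_on I (\<lambda>i. w i + c i) (\<lambda>i. w i + c i)" by (simp add: w_def)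
    ultimately show ?thesis by (simp add: inner_on_linear inner_on_commute[of I c w])
  qed
  then have "\<delta> * inner_on I a a \<le> \<delta> * (2 * inner_on I w w + 2 * inner_on I c c)" using \<delta> by (rule mult_left_mono)
  moreover have "inner_on I b (mat_vec I (shifted I \<delta> C) b) = inner_on I b (mat_vec I C b) + 2 * \<delta> * inner_on I c c"
    by (simp add: mat_vec_shifted inner_on_linear sym[of b "mat_vec I C b"] c_def)
  ultimately show ?thesis by (simp add: distrib_right distrib_left right_diff_distrib) 
qed

section \<open>Adding a sample point: the rank-one update\<close>

definition downdated :: "'i set \<Rightarrow> real \<Rightarrow> ('i \<Rightarrow> real) \<Rightarrow> ('i \<Rightarrow> 'i \<Rightarrow> real) \<Rightarrow> 'i \<Rightarrow> 'i \<Rightarrow> real" where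
  "downdated I s v C = (\<lambda>i j. C i j - s / (1 + s * inner_on I v (mat_vec I C v)) * mat_vec I C v i * mat_vec I C v j)"

lemma inner_on_downdated:
  "inner_on I b (mat_vec I (downdated I s v C) b) =
    inner_on I b (mat_vec I C b) - s / (1 + s * inner_on I v (mat_vec I C v)) * (inner_on I b (mat_vec I C v))\<^sup>2"
proof -
  define w where "w = mat_vec I C v"
  define k where "k = s / (1 + s * inner_on I v w)"
  have "downdated I s v C = (\<lambda>i j. C i j - k * w i * w j)"
    by (simp only: downdated_def k_def w_def)
  then have "mat_vec I (downdated I s v C) b = (\<lambda>i. mat_vec I C b i - (k * inner_on I b w) * w i)"
    by (simp add: mat_vec_def left_diff_distrib right_diff_distrib sum_subtractf inner_on_def sum_distrib_left sum_distrib_right mult_ac)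
  then show ?thesis unfolding w_def[symmetric] k_def[symmetric] by (simp add: inner_on_linear power2_eq_square)
qed

text \<open>The left side is the maximum over \<kappa> of the right side, attained at the given
  \<kappa>. In both applications a hypothesis on \<open>C\<close> is tested at a vector minus
  \<kappa> v, and the term \<open>\<kappa>\<^sup>2 / s\<close> is dropped or absorbed by the new
  sample.\<close>

lemma complete_square:
  assumes s: "0 < s" and \<beta>: "0 \<le> (\<beta>::real)" and \<kappa>: "\<kappa> = s * \<gamma> / (1 + s * \<beta>)"
  shows "s / (1 + s * \<beta>) * \<gamma>\<^sup>2 = 2 * \<kappa> * \<gamma> - \<kappa>\<^sup>2 * \<beta> - \<kappa>\<^sup>2 / s"
proof -
  have p: "1 + s * \<beta> > 0" using s \<beta> by (simp add: add_pos_nonneg)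
  have \<kappa>p: "\<kappa> * (1 + s * \<beta>) = s * \<gamma>" using \<kappa> p by simp
  have "2 * \<kappa> * \<gamma> - \<kappa>\<^sup>2 * \<beta> - \<kappa>\<^sup>2 / s = 2 * \<kappa> * \<gamma> - \<kappa> * (\<kappa> * (1 + s * \<beta>)) / s"
    using s by (simp add: field_simps power2_eq_square)
  also have "\<dots> = \<kappa> * \<gamma>" unfolding \<kappa>p using s by simp
  also have "\<dots> = s / (1 + s * \<beta>) * \<gamma>\<^sup>2" by (simp add: \<kappa> power2_eq_square)
  finally show ?thesis by simp
qed

lemma psd_downdated:
  assumes C: "psd I C" and s: "0 < s"
  shows "psd I (downdated I s v C)"
  unfolding psd_def
proof (intro conjI allI)
  fix i j
  show "downdated I s v C i j = downdated I s v C j i"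
    using psd_sym[OF C] by (simp add: downdated_def)
next
  fix x
  define \<beta> \<gamma> where "\<beta> = inner_on I v (mat_vec I C v)" and "\<gamma> = inner_on I x (mat_vec I C v)"
  define \<kappa> where "\<kappa> = s * \<gamma> / (1 + s * \<beta>)"
  have \<beta>: "0 \<le> \<beta>" unfolding \<beta>_def by (rule psd_nonneg[OF C])
  have sym: "inner_on I v (mat_vec I C x) = \<gamma>"
    unfolding \<gamma>_def by (rule mat_vec_sym) (rule psd_sym[OF C])
  have "0 \<le> inner_on I x (mat_vec I C x) - 2 * \<kappa> * \<gamma> + \<kappa>\<^sup>2 * \<beta>"
    using psd_nonneg[OF C, of "\<lambda>i. x i - \<kappa> * v i"]
    by (simp add: mat_vec_linear inner_on_linear sym \<gamma>_def[symmetric] \<beta>_def[symmetric] power2_eq_square algebra_simps)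
  moreover have "0 \<le> \<kappa>\<^sup>2 / s" using s by simp
  ultimately show "0 \<le> inner_on I x (mat_vec I (downdated I s v C) x)"
    unfolding inner_on_downdated \<beta>_def[symmetric] \<gamma>_def[symmetric] complete_square[OF s \<beta> \<kappa>_def]
    by linarith
qed

text \<open>The Sherman-Morrison formula for the inverse of \<open>C\<^bsup>-1\<^esup> + s v v\<^sup>T\<close>, again without inverses.\<close>

lemma downdated_dominates:
  assumes C: "psd I C" and s: "0 < s"
    and inv: "\<And>b. l * inner_on I a a + 2 * inner_on I a b - inner_on I b (mat_vec I C b) \<le> R"
  shows "l * inner_on I a a + 2 * inner_on I a b - inner_on I b (mat_vec I (downdated I s v C) b) \<le> R + s * (inner_on I a v)\<^sup>2"
proof -
  define \<alpha> \<beta> \<gamma> where "\<alpha> = inner_on I a v" and "\<beta> = inner_on I v (mat_vec I C v)" and "\<gamma> = inner_on I b (mat_vec I C v)"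
  define \<kappa> where "\<kappa> = s * \<gamma> / (1 + s * \<beta>)"
  have \<beta>: "0 \<le> \<beta>" unfolding \<beta>_def by (rule psd_nonneg[OF C])
  have sym: "inner_on I v (mat_vec I C b) = \<gamma>"
    unfolding \<gamma>_def by (rule mat_vec_sym) (rule psd_sym[OF C])
  have "l * inner_on I a a + 2 * (inner_on I a b - \<kappa> * \<alpha>) - (inner_on I b (mat_vec I C b) - 2 * \<kappa> * \<gamma> + \<kappa>\<^sup>2 * \<beta>) \<le> R"
    using inv[of "\<lambda>i. b i - \<kappa> * v i"]
    by (simp add: mat_vec_linear inner_on_linear sym \<gamma>_def[symmetric] \<beta>_def[symmetric] \<alpha>_def[symmetric]
        power2_eq_square algebra_simps)
  moreover have "2 * \<kappa> * \<alpha> \<le> s * \<alpha>\<^sup>2 + \<kappa>\<^sup>2 / s"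
  proof -
    have "0 \<le> (s * \<alpha> - \<kappa>)\<^sup>2 / s" using s by simp
    also have "\<dots> = s * \<alpha>\<^sup>2 + \<kappa>\<^sup>2 / s - 2 * \<kappa> * \<alpha>"
      using s by (simp add: field_simps power2_eq_square)
    finally show ?thesis by simp
  qed
  ultimately show ?thesis
    unfolding inner_on_downdated \<beta>_def[symmetric] \<gamma>_def[symmetric] \<alpha>_def[symmetric] complete_square[OF s \<beta> \<kappa>_def]
    by (simp add: algebra_simps)
qed

lemma trace_on_downdated:
  "trace_on I (downdated I s v C) = trace_on I C - s / (1 + s * inner_on I v (mat_vec I C v)) * inner_on I (mat_vec I C v) (mat_vec I C v)"
proof -
  define w where "w = mat_vec I C v"
  define k where "k = s / (1 + s * inner_on I v w)"
  have "downdated I s v C = (\<lambda>i j. C i j - k * w i * w j)"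
    by (simp only: downdated_def k_def w_def)
  then show ?thesis
    unfolding w_def[symmetric] k_def[symmetric]
    by (simp add: trace_on_def sum_subtractf inner_on_def sum_distrib_left mult.assoc)
qed

text \<open>The desired inequality between two ratios becomes linear in v v^T once the denominators
  are cleared. So a single matrix \<open>A\<close>, chosen to have trace tr(C^2), turns the sampling
  hypothesis into exactly that inequality.\<close>

lemma exists_good_point:
  assumes fin: "finite I" and C: "psd I C" and s: "0 < s"
    and sampling: "\<And>A. \<exists>x\<in>X. trace_on I A \<le> inner_on I (v x) (mat_vec I A (v x))"
  shows "\<exists>x\<in>X. s * trace_on I (mat_mult I C C) / (1 + s * trace_on I C)
    \<le> s / (1 + s * inner_on I (v x) (mat_vec I C (v x))) * inner_on I (mat_vec I C (v x)) (mat_vec I C (v x))"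
proof -
  define t t2 where "t = trace_on I C" and "t2 = trace_on I (mat_mult I C C)"
  define A where "A = (\<lambda>i j. (1 + s * t) * mat_mult I C C i j - s * t2 * C i j)"
  have "trace_on I A = (1 + s * t) * t2 - s * t2 * t"
    by (simp add: trace_on_def A_def sum_subtractf sum_distrib_left[symmetric] t_def t2_def)
  then have trA: "trace_on I A = t2" by (simp add: algebra_simps)
  obtain x where x: "x \<in> X" "trace_on I A \<le> inner_on I (v x) (mat_vec I A (v x))" using sampling by blast
  have "mat_vec I A y = (\<lambda>i. (1 + s * t) * mat_vec I C (mat_vec I C y) i - s * t2 * mat_vec I C y i)" for y
    unfolding mat_vec_mat_mult[symmetric] A_def
    by (simp add: mat_vec_def left_diff_distrib sum_subtractf sum_distrib_left mult.assoc)
  moreover have "inner_on I (v x) (mat_vec I C (mat_vec I C (v x))) = inner_on I (mat_vec I C (v x)) (mat_vec I C (v x))"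
    by (rule mat_vec_sym) (rule psd_sym[OF C])
  ultimately have le: "t2 * (1 + s * inner_on I (v x) (mat_vec I C (v x)))
      \<le> (1 + s * t) * inner_on I (mat_vec I C (v x)) (mat_vec I C (v x))"
    using x(2) by (simp add: trA inner_on_linear algebra_simps)
  have pos: "1 + s * t > 0" "1 + s * inner_on I (v x) (mat_vec I C (v x)) > 0"
    using psd_trace_on_nonneg[OF fin C] psd_nonneg[OF C, of "v x"] s
    by (simp_all add: t_def add_pos_nonneg)
  have "s * t2 / (1 + s * t) \<le> s / (1 + s * inner_on I (v x) (mat_vec I C (v x))) * inner_on I (mat_vec I C (v x)) (mat_vec I C (v x))"
    using mult_left_mono[OF le, of s] s pos by (simp add: field_simps)
  with x(1) show ?thesis unfolding t_def t2_def by blast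
qed

text \<open>With s = 1/(4 \<tau>) and trace at most 4 \<tau> after the shift, the denominator 1 + s
  tr(C1) is at most 2, so a good point lowers the trace by at least s/2 tr(C^2). The choice \<delta>
  = s/4 makes the cost 2 \<delta> tr(C^2) of the shift equal to this gain, and the trace stays at
  most 2 \<tau>.\<close>

lemma barrier_step:
  assumes fin: "finite I" and C: "psd I C" and \<tau>: "0 < \<tau>" and trC: "trace_on I C \<le> 2 * \<tau>"
    and sampling: "\<And>A. \<exists>x\<in>X. trace_on I A \<le> inner_on I (v x) (mat_vec I A (v x))"
    and inv: "\<And>a b. l * inner_on I a a + 2 * inner_on I a b - inner_on I b (mat_vec I C b) \<le> R a"
  shows "\<exists>x\<in>X. \<exists>C'. psd I C' \<and> trace_on I C' \<le> 2 * \<tau> \<and>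
    (\<forall>a b. (l + 1 / (16 * \<tau>)) * inner_on I a a + 2 * inner_on I a b - inner_on I b (mat_vec I C' b)
      \<le> R a + 1 / (4 * \<tau>) * (inner_on I a (v x))\<^sup>2)"
proof -
  define \<delta> s where "\<delta> = 1 / (16 * \<tau>)" and "s = 1 / (4 * \<tau>)"
  have \<delta>: "0 \<le> \<delta>" and s: "0 < s" using \<tau> by (auto simp: \<delta>_def s_def)
  define C1 where "C1 = shifted I \<delta> C"
  have C1: "psd I C1" unfolding C1_def by (rule psd_shifted[OF C \<delta>])
  have small: "2 * \<delta> * trace_on I C \<le> 1" using trC \<tau> by (simp add: \<delta>_def field_simps)
  have t0: "0 \<le> trace_on I C" by (rule psd_trace_on_nonneg[OF fin C])
  have "2 * \<delta> * trace_on I (mat_mult I C C) \<le> 2 * \<delta> * (trace_on I C)\<^sup>2"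
    using psd_trace_on_mat_mult_le[OF fin C] \<delta> by (intro mult_left_mono) auto
  also have "\<dots> = (2 * \<delta> * trace_on I C) * trace_on I C" by (simp add: power2_eq_square)
  also have "\<dots> \<le> 1 * trace_on I C" using small t0 by (rule mult_right_mono)
  finally have trC1: "trace_on I C1 \<le> 4 * \<tau>" using trC by (simp add: C1_def trace_on_shifted)
  have t2: "0 \<le> trace_on I (mat_mult I C C)"
    using trace_on_mat_mult_self[of C, OF psd_sym[OF C]] by (simp add: sum_nonneg)
  obtain x where x: "x \<in> X" and gain: "s * trace_on I (mat_mult I C1 C1) / (1 + s * trace_on I C1)
    \<le> s / (1 + s * inner_on I (v x) (mat_vec I C1 (v x))) * inner_on I (mat_vec I C1 (v x)) (mat_vec I C1 (v x))"
    using exists_good_point[OF fin C1 s sampling] by blast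
  have st: "s * trace_on I C1 \<le> 1" using trC1 \<tau> by (simp add: s_def field_simps)
  have st0: "0 \<le> s * trace_on I C1" using s psd_trace_on_nonneg[OF fin C1] by simp
  have "2 * \<delta> * trace_on I (mat_mult I C C) = s / 2 * trace_on I (mat_mult I C C)" by (simp add: \<delta>_def s_def)
  also have "\<dots> \<le> s / 2 * trace_on I (mat_mult I C1 C1)"
    using trace_on_mat_mult_shifted[OF fin C \<delta>] s by (intro mult_left_mono) (auto simp: C1_def)
  also have "\<dots> \<le> s * trace_on I (mat_mult I C1 C1) / (1 + s * trace_on I C1)"
  proof -
    have "s * trace_on I (mat_mult I C1 C1) \<ge> 0"
      using s t2 trace_on_mat_mult_shifted[OF fin C \<delta>] by (simp add: C1_def)
    then have "s * trace_on I (mat_mult I C1 C1) / 2 \<le> s * trace_on I (mat_mult I C1 C1) / (1 + s * trace_on I C1)"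
      using st st0 by (intro divide_left_mono) auto
    then show ?thesis by simp
  qed
  finally have "trace_on I (downdated I s (v x) C1) \<le> 2 * \<tau>"
    using gain trC by (simp add: trace_on_downdated C1_def trace_on_shifted)
  moreover have "psd I (downdated I s (v x) C1)" by (rule psd_downdated[OF C1 s])
  moreover have "(l + \<delta>) * inner_on I a a + 2 * inner_on I a b - inner_on I b (mat_vec I (downdated I s (v x) C1) b)
      \<le> R a + s * (inner_on I a (v x))\<^sup>2" for a b
    unfolding C1_def
    by (intro downdated_dominates[OF C1[unfolded C1_def] s] shifted_dominates[OF fin C \<delta> small] inv)
  ultimately show ?thesis using x unfolding \<delta>_def s_def by blast
qed

lemma barrier_iterate:
  assumes fin: "finite I" and C: "psd I C" and \<tau>: "0 < \<tau>" and trC: "trace_on I C \<le> 2 * \<tau>"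
    and sampling: "\<And>A. \<exists>x\<in>X. trace_on I A \<le> inner_on I (v x) (mat_vec I A (v x))"
    and inv: "\<And>a b. l * inner_on I a a + 2 * inner_on I a b - inner_on I b (mat_vec I C b) \<le> R a"
  shows "\<exists>xs C'. length xs = n \<and> set xs \<subseteq> X \<and> psd I C' \<and> trace_on I C' \<le> 2 * \<tau> \<and>
    (\<forall>a b. (l + n / (16 * \<tau>)) * inner_on I a a + 2 * inner_on I a b - inner_on I b (mat_vec I C' b)
      \<le> R a + 1 / (4 * \<tau>) * (\<Sum>x\<leftarrow>xs. (inner_on I a (v x))\<^sup>2))"
proof (induction n)
  case 0
  show ?case using C trC inv by (intro exI[of _ "[]"] exI[of _ C]) simp
next
  case (Suc n)
  then obtain xs C' where *: "length xs = n" "set xs \<subseteq> X" "psd I C'" "trace_on I C' \<le> 2 * \<tau>"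
    and inv': "\<And>a b. (l + n / (16 * \<tau>)) * inner_on I a a + 2 * inner_on I a b - inner_on I b (mat_vec I C' b)
      \<le> R a + 1 / (4 * \<tau>) * (\<Sum>x\<leftarrow>xs. (inner_on I a (v x))\<^sup>2)" by blast
  obtain x C'' where x: "x \<in> X" "psd I C''" "trace_on I C'' \<le> 2 * \<tau>"
    "\<And>a b. (l + n / (16 * \<tau>) + 1 / (16 * \<tau>)) * inner_on I a a + 2 * inner_on I a b - inner_on I b (mat_vec I C'' b)
      \<le> R a + 1 / (4 * \<tau>) * (\<Sum>x\<leftarrow>xs. (inner_on I a (v x))\<^sup>2) + 1 / (4 * \<tau>) * (inner_on I a (v x))\<^sup>2"
    using barrier_step[OF fin *(3) \<tau> *(4) sampling inv'] by blast
  have "(l + Suc n / (16 * \<tau>)) * inner_on I a a + 2 * inner_on I a b - inner_on I b (mat_vec I C'' b)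
      \<le> R a + 1 / (4 * \<tau>) * (\<Sum>x\<leftarrow>x # xs. (inner_on I a (v x))\<^sup>2)" for a b
    using x(4)[of a b] by (simp add: add_divide_distrib algebra_simps)
  then show ?case using x * by (intro exI[of _ "x # xs"] exI[of _ C'']) auto
qed

text \<open>The initial barrier \<open>-N/\<tau>\<close> makes each of the first \<open>N\<close> directions contribute only \<open>\<tau>/N\<close> to the
  initial potential.\<close>

theorem barrier_points:
  assumes fin: "finite I" and d: "\<And>i. i \<in> I \<Longrightarrow> 0 < d i" and \<tau>: "0 < \<tau>" and N: "0 < N"
    and J: "J \<subseteq> I" "card J \<le> N" and tail: "(\<Sum>i\<in>I - J. 1 / d i) \<le> \<tau>"
    and sampling: "\<And>A. \<exists>x\<in>X. trace_on I A \<le> inner_on I (v x) (mat_vec I A (v x))"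
  shows "\<exists>xs. length xs = 32 * N \<and> set xs \<subseteq> X \<and>
    (\<forall>a. N / \<tau> * inner_on I a a \<le> (\<Sum>i\<in>I. d i * (a i)\<^sup>2) + 1 / (4 * \<tau>) * (\<Sum>x\<leftarrow>xs. (inner_on I a (v x))\<^sup>2))"
proof -
  define l where "l = - (N / \<tau>)"
  have l: "l < 0" using N \<tau> by (simp add: l_def)
  \<comment> \<open>The inverse of the diagonal matrix with entries \<open>d i - l\<close>, from
    which the barrier starts.\<close>
  define C where "C = (\<lambda>i j. if i = j \<and> i \<in> I then 1 / (d i - l) else 0)"
  have mvC: "mat_vec I C x i = x i / (d i - l)" if "i \<in> I" for x i
  proof -
    have "mat_vec I C x i = (\<Sum>j\<in>I. if i = j then x i / (d i - l) else 0)"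
      unfolding mat_vec_def by (rule sum.cong) (auto simp: C_def that)
    then show ?thesis using fin that by simp
  qed
  have pos: "d i - l > 0" if "i \<in> I" for i using d[OF that] l by simp
  have C: "psd I C"
    unfolding psd_def
  proof (intro conjI allI)
    fix x
    have "inner_on I x (mat_vec I C x) = (\<Sum>i\<in>I. x i * x i / (d i - l))"
      unfolding inner_on_def by (rule sum.cong) (auto simp: mvC)
    also have "\<dots> \<ge> 0" using pos by (intro sum_nonneg) (simp add: less_imp_le)
    finally show "0 \<le> inner_on I x (mat_vec I C x)" .
  qed (auto simp: C_def)
  have trC: "trace_on I C \<le> 2 * \<tau>"
  proof -
    have "trace_on I C = (\<Sum>i\<in>I. 1 / (d i - l))" unfolding trace_on_def by (rule sum.cong) (auto simp: C_def)
    also have "\<dots> = (\<Sum>i\<in>J. 1 / (d i - l)) + (\<Sum>i\<in>I - J. 1 / (d i - l))"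
      using sum.subset_diff[OF J(1) fin] by (simp add: add.commute)
    also have "(\<Sum>i\<in>J. 1 / (d i - l)) \<le> (\<Sum>i\<in>J. 1 / (- l))"
    proof (rule sum_mono)
      fix i assume "i \<in> J"
      then have "0 < d i" using J d by auto
      then show "1 / (d i - l) \<le> 1 / (- l)" using l by (intro divide_left_mono mult_pos_pos) auto
    qed
    also have "\<dots> = card J * (\<tau> / N)" by (simp add: l_def)
    also have "\<dots> \<le> N * (\<tau> / N)" using J \<tau> by (intro mult_right_mono) auto
    also have "\<dots> = \<tau>" using N by simp
    also have "(\<Sum>i\<in>I - J. 1 / (d i - l)) \<le> (\<Sum>i\<in>I - J. 1 / d i)"
    proof (rule sum_mono)
      fix i assume "i \<in> I - J"
      then have "0 < d i" using d by auto
      then show "1 / (d i - l) \<le> 1 / d i" using l by (intro divide_left_mono mult_pos_pos) auto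
    qed
    also have "\<dots> \<le> \<tau>" by (rule tail)
    finally show ?thesis by simp
  qed
  have inv: "l * inner_on I a a + 2 * inner_on I a b - inner_on I b (mat_vec I C b) \<le> (\<Sum>i\<in>I. d i * (a i)\<^sup>2)" for a b
  proof -
    have "l * inner_on I a a + 2 * inner_on I a b - inner_on I b (mat_vec I C b) =
        (\<Sum>i\<in>I. l * (a i * a i) + 2 * (a i * b i) - b i * (b i / (d i - l)))"
      by (simp add: inner_on_def sum.distrib sum_subtractf sum_distrib_left mvC)
    also have "\<dots> \<le> (\<Sum>i\<in>I. d i * (a i)\<^sup>2)"
    proof (rule sum_mono)
      fix i assume i: "i \<in> I"
      let ?e = "d i - l"
      have e: "?e > 0" by (rule pos[OF i])
      have "0 \<le> (?e * a i - b i)\<^sup>2 / ?e" using e by simp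
      also have "\<dots> = ?e * (a i)\<^sup>2 - 2 * (a i * b i) + b i * (b i / ?e)"
        using e by (simp add: field_simps power2_eq_square)
      finally show "l * (a i * a i) + 2 * (a i * b i) - b i * (b i / (d i - l)) \<le> d i * (a i)\<^sup>2"
        by (simp add: algebra_simps power2_eq_square)
    qed
    finally show ?thesis .
  qed
  obtain xs C' where xs: "length xs = 32 * N" "set xs \<subseteq> X"
    and inv': "\<And>a b. (l + (32 * N) / (16 * \<tau>)) * inner_on I a a + 2 * inner_on I a b - inner_on I b (mat_vec I C' b)
      \<le> (\<Sum>i\<in>I. d i * (a i)\<^sup>2) + 1 / (4 * \<tau>) * (\<Sum>x\<leftarrow>xs. (inner_on I a (v x))\<^sup>2)"
    using barrier_iterate[OF fin C \<tau> trC sampling inv, of "32 * N"] by (auto simp: of_nat_mult)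
  \<comment> \<open>Each of the 32 N steps raises the barrier by 1/(16 \<tau>), in total from
    -N/\<tau> to N/\<tau>; at b = 0 the matrix \<open>C'\<close> disappears from the
    estimate.\<close>
  have "l + (32 * N) / (16 * \<tau>) = N / \<tau>" using \<tau> by (simp add: l_def field_simps)
  with inv'[of _ "\<lambda>_. 0"] have "N / \<tau> * inner_on I a a
      \<le> (\<Sum>i\<in>I. d i * (a i)\<^sup>2) + 1 / (4 * \<tau>) * (\<Sum>x\<leftarrow>xs. (inner_on I a (v x))\<^sup>2)" for a
    by (simp add: inner_on_def)
  with xs show ?thesis by blast
qed

section \<open>Weighted ridge regression\<close>

lemma ridge_solvable:
  assumes fin: "finite I" and d: "\<And>i. i \<in> I \<Longrightarrow> 0 < d i" and s: "0 < s"
  shows "\<exists>z. \<forall>i\<in>I. d i * z i + s * (\<Sum>v\<leftarrow>vs. inner_on I z v * v i) = b i"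
proof (induction vs arbitrary: b)
  case Nil
  show ?case using d by (intro exI[of _ "\<lambda>i. b i / d i"]) (auto simp: less_imp_neq[symmetric])
next
  case (Cons v vs)
  \<comment> \<open>The system operator for the samples \<open>vs\<close>. A further sample changes
    it by a rank-one term, so the solutions for the right-hand sides \<open>b\<close> and
    \<open>v\<close> combine to the new solution.\<close>
  define M where "M = (\<lambda>z i. d i * z i + s * (\<Sum>v\<leftarrow>vs. inner_on I z v * v i))"
  obtain z0 where z0: "\<And>i. i \<in> I \<Longrightarrow> M z0 i = b i" unfolding M_def using Cons[of b] by blast
  obtain z1 where z1: "\<And>i. i \<in> I \<Longrightarrow> M z1 i = v i" unfolding M_def using Cons[of v] by blast
  have ipsum: "inner_on I z1 (\<lambda>i. \<Sum>v\<leftarrow>ws. inner_on I z1 v * v i) = (\<Sum>v\<leftarrow>ws. (inner_on I z1 v)\<^sup>2)" for ws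
    by (induction ws) (simp_all add: inner_on_linear power2_eq_square, simp add: inner_on_def)
  \<comment> \<open>This inner product is the energy of \<open>z1\<close>, hence nonnegative, and
    the denominator of \<open>c\<close> is positive.\<close>
  have "inner_on I z1 v = inner_on I z1 (M z1)" unfolding inner_on_def using z1 by (intro sum.cong) auto
  also have "\<dots> = inner_on I z1 (\<lambda>i. d i * z1 i) + s * (\<Sum>v\<leftarrow>vs. (inner_on I z1 v)\<^sup>2)"
    by (simp add: M_def inner_on_linear ipsum)
  also have "\<dots> \<ge> 0"
  proof -
    have "0 \<le> inner_on I z1 (\<lambda>i. d i * z1 i)"
      unfolding inner_on_def
    proof (rule sum_nonneg)
      fix i assume "i \<in> I"
      then have "0 \<le> d i * (z1 i)\<^sup>2" using d[of i] by simp
      then show "0 \<le> z1 i * (d i * z1 i)" by (simp add: power2_eq_square mult_ac)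
    qed
    moreover have "0 \<le> (\<Sum>v\<leftarrow>vs. (inner_on I z1 v)\<^sup>2)" by (intro sum_list_nonneg) auto
    ultimately show ?thesis using s by simp
  qed
  finally have p: "1 + s * inner_on I z1 v > 0" using s by (simp add: add_pos_nonneg)
  define c where "c = s * inner_on I z0 v / (1 + s * inner_on I z1 v)"
  define z where "z = (\<lambda>i. z0 i - c * z1 i)"
  have lin: "(\<Sum>v\<leftarrow>ws. inner_on I z v * v i) = (\<Sum>v\<leftarrow>ws. inner_on I z0 v * v i) - c * (\<Sum>v\<leftarrow>ws. inner_on I z1 v * v i)" for ws i
    by (induction ws) (simp_all add: z_def inner_on_linear algebra_simps)
  have "d i * z i + s * (\<Sum>v\<leftarrow>v # vs. inner_on I z v * v i) = b i" if i: "i \<in> I" for i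
  proof -
    have "d i * z i + s * (\<Sum>v\<leftarrow>v # vs. inner_on I z v * v i) = M z0 i - c * M z1 i + s * (inner_on I z v * v i)"
      by (simp add: lin) (simp add: M_def z_def algebra_simps)
    also have "\<dots> = b i + (s * inner_on I z0 v - c * (1 + s * inner_on I z1 v)) * v i"
      by (simp add: z0[OF i] z1[OF i] z_def inner_on_linear algebra_simps)
    also have "s * inner_on I z0 v - c * (1 + s * inner_on I z1 v) = 0" using p by (simp add: c_def)
    finally show ?thesis by simp
  qed
  then show ?case by blast
qed

text \<open>The reconstruction is weighted ridge regression; its error \<open>e\<close> solves the normal equation
  with right-hand side given by the noise \<open>\<eta>\<close> and the penalty of \<open>a\<close>, whence the energy estimate.\<close>

theorem stable_recovery:
  assumes fin: "finite I" and d: "\<And>i. i \<in> I \<Longrightarrow> 0 < d i" and s: "0 < s" and L: "0 < L"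
    and ineq: "\<And>a. L * inner_on I a a \<le> (\<Sum>i\<in>I. d i * (a i)\<^sup>2) + s * (\<Sum>j<n. (inner_on I a (v j))\<^sup>2)"
  shows "\<exists>\<phi> :: nat \<Rightarrow> 'i \<Rightarrow> real. \<forall>a y. 
    L * (\<Sum>i\<in>I. (a i - (\<Sum>j<n. y j * \<phi> j i))\<^sup>2)
      \<le> (\<Sum>i\<in>I. d i * (a i)\<^sup>2) + s * (\<Sum>j<n. (y j - inner_on I a (v j))\<^sup>2)"
proof -
  \<comment> \<open>\<open>\<phi> j\<close> solves the normal equations for the j-th unit data
    vector, which makes the reconstruction linear in the data \<open>y\<close>.\<close>
  have "\<forall>j. \<exists>z. \<forall>i\<in>I. d i * z i + s * (\<Sum>k<n. inner_on I z (v k) * v k i) = s * v j i"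
  proof
    fix j
    have "(\<Sum>u\<leftarrow>map v [0..<n]. inner_on I z u * u i) = (\<Sum>k<n. inner_on I z (v k) * v k i)" for z i
      by (simp add: interv_sum_list_conv_sum_set_nat comp_def atLeast0LessThan)
    with ridge_solvable[OF fin d s, where vs = "map v [0..<n]" and b = "\<lambda>i. s * v j i"]
    show "\<exists>z. \<forall>i\<in>I. d i * z i + s * (\<Sum>k<n. inner_on I z (v k) * v k i) = s * v j i" by simp
  qed
  then obtain \<phi> where \<phi>: "\<And>j i. i \<in> I \<Longrightarrow> d i * \<phi> j i + s * (\<Sum>k<n. inner_on I (\<phi> j) (v k) * v k i) = s * v j i"
    by metis
  have "L * (\<Sum>i\<in>I. (a i - (\<Sum>j<n. y j * \<phi> j i))\<^sup>2)
      \<le> (\<Sum>i\<in>I. d i * (a i)\<^sup>2) + s * (\<Sum>j<n. (y j - inner_on I a (v j))\<^sup>2)" for a y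
  proof -
    define z where "z = (\<lambda>i. \<Sum>j<n. y j * \<phi> j i)"
    define e where "e = (\<lambda>i. z i - a i)"
    define \<eta> where "\<eta> = (\<lambda>j. y j - inner_on I a (v j))"
    have ipz: "inner_on I z w = (\<Sum>j<n. y j * inner_on I (\<phi> j) w)" for w
      unfolding inner_on_def z_def sum_distrib_left sum_distrib_right
      by (subst sum.swap) (simp add: mult_ac)
    have normal: "d i * z i + s * (\<Sum>k<n. inner_on I z (v k) * v k i) = s * (\<Sum>j<n. y j * v j i)" if i: "i \<in> I" for i
    proof -
      have "(\<Sum>k<n. inner_on I z (v k) * v k i) = (\<Sum>j<n. y j * (\<Sum>k<n. inner_on I (\<phi> j) (v k) * v k i))"
        unfolding ipz sum_distrib_left sum_distrib_right by (subst sum.swap) (simp add: mult_ac)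
      then have "d i * z i + s * (\<Sum>k<n. inner_on I z (v k) * v k i) =
          (\<Sum>j<n. y j * (d i * \<phi> j i + s * (\<Sum>k<n. inner_on I (\<phi> j) (v k) * v k i)))"
        by (simp add: z_def sum_distrib_left sum.distrib algebra_simps)
      also have "\<dots> = s * (\<Sum>j<n. y j * v j i)" using \<phi>[OF i] by (simp add: sum_distrib_left mult_ac)
      finally show ?thesis .
    qed
    have zv: "inner_on I z w = inner_on I e w + inner_on I a w" for w
      by (simp add: e_def inner_on_linear)
    have err: "d i * e i + s * (\<Sum>k<n. inner_on I e (v k) * v k i) = s * (\<Sum>j<n. \<eta> j * v j i) - d i * a i"
      if i: "i \<in> I" for i
      using normal[OF i]
      by (simp add: zv e_def \<eta>_def sum.distrib algebra_simps sum_subtractf sum_distrib_left)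
    have swap: "(\<Sum>i\<in>I. e i * (\<Sum>k<n. g k * v k i)) = (\<Sum>k<n. g k * inner_on I e (v k))" for g
      unfolding inner_on_def sum_distrib_left by (subst sum.swap) (simp add: mult_ac)
    have "(\<Sum>i\<in>I. e i * (d i * e i + s * (\<Sum>k<n. inner_on I e (v k) * v k i))) =
        (\<Sum>i\<in>I. e i * (s * (\<Sum>j<n. \<eta> j * v j i) - d i * a i))"
      by (intro sum.cong refl) (simp add: err)
    then have "(\<Sum>i\<in>I. d i * (e i)\<^sup>2) + s * (\<Sum>i\<in>I. e i * (\<Sum>k<n. inner_on I e (v k) * v k i)) =
        s * (\<Sum>i\<in>I. e i * (\<Sum>j<n. \<eta> j * v j i)) - (\<Sum>i\<in>I. d i * (e i * a i))"
      by (simp add: distrib_left right_diff_distrib sum.distrib sum_subtractf sum_distrib_left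
          power2_eq_square mult_ac)
    then have energy: "(\<Sum>i\<in>I. d i * (e i)\<^sup>2) + s * (\<Sum>k<n. (inner_on I e (v k))\<^sup>2) =
        s * (\<Sum>j<n. \<eta> j * inner_on I e (v j)) - (\<Sum>i\<in>I. d i * (e i * a i))"
      unfolding swap by (simp add: power2_eq_square)
    have "(\<Sum>j<n. \<eta> j * inner_on I e (v j)) \<le> (\<Sum>j<n. (\<eta> j)\<^sup>2 / 2 + (inner_on I e (v j))\<^sup>2 / 2)"
    proof (rule sum_mono)
      fix j
      show "\<eta> j * inner_on I e (v j) \<le> (\<eta> j)\<^sup>2 / 2 + (inner_on I e (v j))\<^sup>2 / 2"
        using sum_squares_bound[of "\<eta> j" "inner_on I e (v j)"] by simp
    qed
    also have "\<dots> = (\<Sum>j<n. (\<eta> j)\<^sup>2) / 2 + (\<Sum>j<n. (inner_on I e (v j))\<^sup>2) / 2"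
      by (simp add: sum.distrib sum_divide_distrib)
    finally have "s * (\<Sum>j<n. \<eta> j * inner_on I e (v j)) \<le> s * ((\<Sum>j<n. (\<eta> j)\<^sup>2) / 2 + (\<Sum>j<n. (inner_on I e (v j))\<^sup>2) / 2)"
      using s by (intro mult_left_mono) auto
    then have b1: "s * (\<Sum>j<n. \<eta> j * inner_on I e (v j)) \<le> s * (\<Sum>j<n. (\<eta> j)\<^sup>2) / 2 + s * (\<Sum>j<n. (inner_on I e (v j))\<^sup>2) / 2"
      by (simp add: distrib_left)
    have "(\<Sum>i\<in>I. - (d i * (e i * a i))) \<le> (\<Sum>i\<in>I. d i * (e i)\<^sup>2 / 2 + d i * (a i)\<^sup>2 / 2)"
    proof (rule sum_mono)
      fix i assume "i \<in> I"
      then have "0 \<le> d i * (e i + a i)\<^sup>2" using d[of i] by simp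
      then show "- (d i * (e i * a i)) \<le> d i * (e i)\<^sup>2 / 2 + d i * (a i)\<^sup>2 / 2"
        by (simp add: power2_eq_square algebra_simps)
    qed
    then have b2: "- (\<Sum>i\<in>I. d i * (e i * a i)) \<le> (\<Sum>i\<in>I. d i * (e i)\<^sup>2) / 2 + (\<Sum>i\<in>I. d i * (a i)\<^sup>2) / 2"
      by (simp add: sum_negf sum.distrib sum_divide_distrib)
    have "L * inner_on I e e \<le> (\<Sum>i\<in>I. d i * (e i)\<^sup>2) + s * (\<Sum>k<n. (inner_on I e (v k))\<^sup>2)" by (rule ineq)
    also have "\<dots> \<le> (\<Sum>i\<in>I. d i * (a i)\<^sup>2) + s * (\<Sum>j<n. (\<eta> j)\<^sup>2)"
      using energy b1 b2 by linarith
    finally show ?thesis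
      by (simp add: inner_on_def e_def z_def \<eta>_def power2_eq_square algebra_simps)
  qed
  then show ?thesis by blast
qed

section \<open>Random signs and duality\<close>

text \<open>Deflation: a vector w is handled by subtracting from \<open>Q\<close> the orthogonal
  projection onto the line of Q w, which lowers the trace by 1; if Q w vanishes on \<open>I\<close>,
  the old \<open>Q\<close> serves. Idempotence is expressed by inner products because only entries
  on \<open>I\<close> count.\<close>

lemma exists_projection_orthogonal_to:
  assumes fin: "finite I"
  shows "\<exists>Q. (\<forall>i j. Q i j = Q j i) \<and> (\<forall>a b. inner_on I (mat_vec I Q a) (mat_vec I Q b) = inner_on I a (mat_vec I Q b)) \<and>
    (\<forall>w\<in>set ws. \<forall>a. inner_on I w (mat_vec I Q a) = 0) \<and> real (card I) - length ws \<le> trace_on I Q"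
proof (induction ws)
  case Nil
  have "mat_vec I (\<lambda>i j. of_bool (i = j)) a i = a i" if "i \<in> I" for a i
  proof -
    have "mat_vec I (\<lambda>i j. of_bool (i = j)) a i = (\<Sum>j\<in>I. if i = j then a j else 0)"
      unfolding mat_vec_def by (rule sum.cong) auto
    then show ?thesis using fin that by simp
  qed
  then have "inner_on I x (mat_vec I (\<lambda>i j. of_bool (i = j)) b) = inner_on I x b" 
    "inner_on I (mat_vec I (\<lambda>i j. of_bool (i = j)) a) x = inner_on I a x" for a b x
    unfolding inner_on_def by (auto intro: sum.cong)
  then show ?case
    by (intro exI[of _ "\<lambda>i j. of_bool (i = j)"]) (auto simp: trace_on_def)
next
  case (Cons w ws)
  then obtain Q where sym: "\<And>i j. Q i j = Q j i"
    and idem: "\<And>a b. inner_on I (mat_vec I Q a) (mat_vec I Q b) = inner_on I a (mat_vec I Q b)"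
    and orth: "\<And>w a. w \<in> set ws \<Longrightarrow> inner_on I w (mat_vec I Q a) = 0"
    and trQ: "real (card I) - length ws \<le> trace_on I Q" by blast
  define u where "u = mat_vec I Q w"
  define \<kappa> where "\<kappa> = inner_on I u u"
  have msym: "inner_on I a (mat_vec I Q b) = inner_on I b (mat_vec I Q a)" for a b by (rule mat_vec_sym) (rule sym)
  have wu: "inner_on I w u = \<kappa>" unfolding \<kappa>_def u_def by (simp add: idem)
  have wQ: "inner_on I w (mat_vec I Q a) = inner_on I a u" for a unfolding u_def by (rule msym)
  have Qu: "inner_on I (mat_vec I Q a) u = inner_on I a u" for a unfolding u_def by (rule idem)
  show ?case
  proof (cases "\<kappa> = 0")
    case True
    then have "u i = 0" if "i \<in> I" for i
      using fin that by (simp add: \<kappa>_def inner_on_def sum_nonneg_eq_0_iff)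
    then have "inner_on I a u = 0" for a by (simp add: inner_on_def)
    then show ?thesis using sym idem orth trQ wQ by (intro exI[of _ Q]) auto
  next
    case False
    define P where "P = (\<lambda>i j. Q i j - u i * u j / \<kappa>)"
    have mvP: "mat_vec I P a = (\<lambda>i. mat_vec I Q a i - (inner_on I a u / \<kappa>) * u i)" for a
      by (simp add: mat_vec_def P_def left_diff_distrib right_diff_distrib sum_subtractf inner_on_def sum_distrib_left sum_divide_distrib mult_ac)
    have "inner_on I (mat_vec I P a) (mat_vec I P b) = inner_on I a (mat_vec I P b)" for a b
      unfolding mvP inner_on_linear idem Qu inner_on_commute[of I u "mat_vec I Q _"] \<kappa>_def[symmetric]
      using False by simp
    moreover have "inner_on I x (mat_vec I P a) = 0" if "x \<in> set ws" for x a
      unfolding mvP inner_on_linear using orth[OF that, of a] orth[OF that, of w] by (simp add: u_def[symmetric])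
    moreover have "inner_on I w (mat_vec I P a) = 0" for a
      unfolding mvP inner_on_linear using False by (simp add: wQ wu)
    moreover have "trace_on I P = trace_on I Q - 1"
      using False by (simp add: trace_on_def P_def sum_subtractf sum_divide_distrib[symmetric] \<kappa>_def inner_on_def)
    moreover have "P i j = P j i" for i j by (simp add: P_def sym[of i j] mult.commute)
    ultimately show ?thesis using trQ by (intro exI[of _ P]) auto
  qed
qed

lemma projection_contracts:
  assumes fin: "finite I"
    and idem: "\<And>a b. inner_on I (mat_vec I Q a) (mat_vec I Q b) = inner_on I a (mat_vec I Q b)"
  shows "inner_on I (mat_vec I Q a) (mat_vec I Q a) \<le> inner_on I a a"
proof -
  have "0 \<le> inner_on I (\<lambda>i. a i - mat_vec I Q a i) (\<lambda>i. a i - mat_vec I Q a i)" by (rule inner_on_self_nonneg)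
  then show ?thesis by (simp add: inner_on_linear idem inner_on_commute[of I "mat_vec I Q a" a])
qed

section \<open>Averages over signs, written as finite sums over all sign vectors\<close>

definition sign_vectors :: "'i set \<Rightarrow> ('i \<Rightarrow> real) set" where
  "sign_vectors I = PiE I (\<lambda>_. {-1, 1})"

lemma finite_sign_vectors: "finite I \<Longrightarrow> finite (sign_vectors I)"
  by (simp add: sign_vectors_def finite_PiE)

lemma card_sign_vectors: "finite I \<Longrightarrow> card (sign_vectors I) = 2 ^ card I"
  by (simp add: sign_vectors_def card_PiE numeral_2_eq_2)

lemma sum_sign_vectors_prod:
  assumes "finite I"
  shows "(\<Sum>\<epsilon>\<in>sign_vectors I. \<Prod>i\<in>I. f i (\<epsilon> i)) = (\<Prod>i\<in>I. f i (-1) + f i (1::real) :: real)"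
proof -
  have "(\<Sum>\<epsilon>\<in>sign_vectors I. \<Prod>i\<in>I. f i (\<epsilon> i)) = (\<Prod>i\<in>I. \<Sum>y\<in>{-1, 1}. f i y)"
    unfolding sign_vectors_def using assms by (intro prod_sum_PiE[symmetric]) auto
  then show ?thesis by simp
qed

lemma sum_sign_vectors_mult:
  assumes fin: "finite I" and ij: "i \<in> I" "j \<in> I"
  shows "(\<Sum>\<epsilon>\<in>sign_vectors I. \<epsilon> i * \<epsilon> j) = (if i = j then 2 ^ card I else 0)"
proof -
  define f where "f = (\<lambda>k y. (if k = i then y else 1) * (if k = j then y else 1::real))"
  have "\<epsilon> i * \<epsilon> j = (\<Prod>k\<in>I. f k (\<epsilon> k))" for \<epsilon> :: "'a \<Rightarrow> real"
    using fin ij by (simp add: f_def prod.distrib)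
  then have "(\<Sum>\<epsilon>\<in>sign_vectors I. \<epsilon> i * \<epsilon> j) = (\<Prod>k\<in>I. f k (-1) + f k 1)"
    using sum_sign_vectors_prod[OF fin, of f] by simp
  also have "\<dots> = (if i = j then 2 ^ card I else 0)"
  proof (cases "i = j")
    case True
    then have "(\<Prod>k\<in>I. f k (-1) + f k 1) = (\<Prod>k\<in>I. 2)" by (intro prod.cong) (auto simp: f_def)
    then show ?thesis using True by simp
  next
    case False
    then have "f i (-1) + f i 1 = 0" by (simp add: f_def)
    then show ?thesis using False fin ij(1) by (auto simp: prod_zero_iff)
  qed
  finally show ?thesis .
qed

lemma sum_sign_vectors_quadratic:
  assumes fin: "finite I"
  shows "(\<Sum>\<epsilon>\<in>sign_vectors I. inner_on I \<epsilon> (mat_vec I Q \<epsilon>)) = 2 ^ card I * trace_on I Q"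
proof -
  have "(\<Sum>\<epsilon>\<in>sign_vectors I. inner_on I \<epsilon> (mat_vec I Q \<epsilon>)) = (\<Sum>\<epsilon>\<in>sign_vectors I. \<Sum>i\<in>I. \<Sum>j\<in>I. Q i j * (\<epsilon> i * \<epsilon> j))"
    by (simp add: inner_on_def mat_vec_def sum_distrib_left mult_ac)
  also have "\<dots> = (\<Sum>i\<in>I. \<Sum>j\<in>I. Q i j * (\<Sum>\<epsilon>\<in>sign_vectors I. \<epsilon> i * \<epsilon> j))"
    by (subst sum.swap, rule sum.cong[OF refl], subst sum.swap) (simp add: sum_distrib_left)
  also have "\<dots> = (\<Sum>i\<in>I. \<Sum>j\<in>I. if i = j then Q i j * 2 ^ card I else 0)"
    using fin by (intro sum.cong refl) (simp add: sum_sign_vectors_mult)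
  also have "\<dots> = 2 ^ card I * trace_on I Q" using fin by (simp add: trace_on_def sum_distrib_right mult.commute)
  finally show ?thesis .
qed

text \<open>Cruder than the bound of cosh x by exp(x^2/2), but elementary: quadratic estimates of
  both exponentials for |x| at most 1, and |x| \<le> x^2 beyond.\<close>

lemma exp_plus_exp_minus_le: "exp x + exp (- x) \<le> 2 * exp (x\<^sup>2)" for x :: real
proof -
  have *: "exp x + exp (- x) \<le> 2 * exp (x\<^sup>2)" if x: "0 \<le> x" for x :: real
  proof (cases "x \<le> 1")
    case True
    have "0 < 1 + x" using x by simp
    have "exp (- x) = 1 / exp x" by (simp add: exp_minus field_simps)
    also have "\<dots> \<le> 1 / (1 + x)" using x by (intro divide_left_mono) (auto simp: add_pos_nonneg)
    also have "\<dots> \<le> 1 - x + x\<^sup>2"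
    proof -
      have "1 \<le> 1 + x ^ 3" using x by simp
      also have "\<dots> = (1 - x + x\<^sup>2) * (1 + x)" by (simp add: algebra_simps power2_eq_square power3_eq_cube)
      finally show ?thesis using \<open>0 < 1 + x\<close> by (simp add: pos_divide_le_eq)
    qed
    finally have "exp x + exp (- x) \<le> 2 * (1 + x\<^sup>2)" using exp_bound[OF x True] by simp
    also have "\<dots> \<le> 2 * exp (x\<^sup>2)" by (intro mult_left_mono exp_ge_add_one_self) simp
    finally show ?thesis .
  next
    case False
    then have "x \<le> x\<^sup>2" by (simp add: power2_eq_square)
    then have "exp x \<le> exp (x\<^sup>2)" "exp (- x) \<le> exp x" using x by auto
    then show ?thesis by linarith
  qed
  show ?thesis using *[of x] *[of "- x"] by (cases "0 \<le> x") auto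
qed

lemma sum_sign_vectors_exp:
  assumes fin: "finite I"
  shows "(\<Sum>\<epsilon>\<in>sign_vectors I. exp (inner_on I \<epsilon> a)) \<le> 2 ^ card I * exp (inner_on I a a)"
proof -
  have "(\<Sum>\<epsilon>\<in>sign_vectors I. exp (inner_on I \<epsilon> a)) = (\<Sum>\<epsilon>\<in>sign_vectors I. \<Prod>i\<in>I. exp (\<epsilon> i * a i))"
    using fin by (simp add: inner_on_def exp_sum)
  also have "\<dots> = (\<Prod>i\<in>I. exp (a i) + exp (- a i))"
    using sum_sign_vectors_prod[OF fin, of "\<lambda>i y. exp (y * a i)"] by (simp add: add.commute)
  also have "\<dots> \<le> (\<Prod>i\<in>I. 2 * exp ((a i)\<^sup>2))"
    by (intro prod_mono conjI exp_plus_exp_minus_le) (simp add: add_nonneg_nonneg)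
  also have "\<dots> = 2 ^ card I * exp (inner_on I a a)"
    using fin by (simp add: prod.distrib inner_on_def exp_sum power2_eq_square)
  finally show ?thesis .
qed

lemma powr_le_exp:
  fixes y s :: real
  assumes "0 \<le> y" "0 < s"
  shows "y powr s \<le> s powr s * exp y"
proof -
  have "y / s \<le> exp (y / s)" using exp_ge_add_one_self[of "y / s"] by linarith
  then have "(y / s) powr s \<le> exp (y / s) powr s" using assms by (intro powr_mono2) auto
  also have "\<dots> = exp y" using assms by (simp add: powr_def)
  finally show ?thesis using assms by (simp add: powr_divide field_simps)
qed

text \<open>The upper half of Khinchin's inequality, uniform in the number of signs. Powers are
  dominated by exponentials, whose average factors; the constant 6 comes from the two signs of the
  exponent and from e \<le> 3.\<close>

lemma sum_sign_vectors_powr: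
  assumes fin: "finite I" and a: "inner_on I a a \<le> 1" and s: "0 < s"
  shows "(\<Sum>\<epsilon>\<in>sign_vectors I. \<bar>inner_on I \<epsilon> a\<bar> powr s) \<le> 2 ^ card I * (6 * s powr s)"
proof -
  have "\<bar>y\<bar> powr s \<le> s powr s * (exp y + exp (- y))" for y :: real
  proof -
    have "exp \<bar>y\<bar> \<le> exp y + exp (- y)" by (cases "0 \<le> y") auto
    then have "s powr s * exp \<bar>y\<bar> \<le> s powr s * (exp y + exp (- y))" by (intro mult_left_mono) auto
    then show ?thesis using powr_le_exp[of "\<bar>y\<bar>" s] s by linarith
  qed
  then have "(\<Sum>\<epsilon>\<in>sign_vectors I. \<bar>inner_on I \<epsilon> a\<bar> powr s)
      \<le> (\<Sum>\<epsilon>\<in>sign_vectors I. s powr s * (exp (inner_on I \<epsilon> a) + exp (inner_on I \<epsilon> (\<lambda>i. - a i))))"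
    by (intro sum_mono) (simp add: inner_on_def sum_negf)
  also have "\<dots> = s powr s * ((\<Sum>\<epsilon>\<in>sign_vectors I. exp (inner_on I \<epsilon> a))
      + (\<Sum>\<epsilon>\<in>sign_vectors I. exp (inner_on I \<epsilon> (\<lambda>i. - a i))))"
    by (simp add: sum.distrib sum_distrib_left distrib_left)
  also have "\<dots> \<le> s powr s * (2 ^ card I * 3 + 2 ^ card I * 3)"
  proof (intro mult_left_mono add_mono)
    have "exp (inner_on I a a) \<le> 3" using a exp_le order_trans exp_le_cancel_iff by blast
    then have e: "2 ^ card I * exp (inner_on I a a) \<le> 2 ^ card I * 3" by simp
    show "(\<Sum>\<epsilon>\<in>sign_vectors I. exp (inner_on I \<epsilon> a)) \<le> 2 ^ card I * 3"
      using sum_sign_vectors_exp[OF fin, of a] e by linarith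
    have "inner_on I (\<lambda>i. - a i) (\<lambda>i. - a i) = inner_on I a a" by (simp add: inner_on_def)
    then show "(\<Sum>\<epsilon>\<in>sign_vectors I. exp (inner_on I \<epsilon> (\<lambda>i. - a i))) \<le> 2 ^ card I * 3"
      using sum_sign_vectors_exp[OF fin, of "\<lambda>i. - a i"] e by (simp only:)
  qed simp
  finally show ?thesis by (simp add: mult_ac)
qed

text \<open>The dual witness \<open>g\<close> is the projection of the random signs onto the orthogonal complement
  of the range of the approximation; Khinchin's inequality makes it flat, so that
  Young's inequality bounds the pairing of \<open>g\<close> with the error.\<close>

lemma random_duality:
  fixes h :: "'i \<Rightarrow> 'x \<Rightarrow> real" and F :: "('i \<Rightarrow> real) \<Rightarrow> 'x \<Rightarrow> real"
  assumes N: "finite_measure N" "measure N (space N) = 1" and fin: "finite I" and sym: "\<And>i j. Q i j = Q j i"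
    and idem: "\<And>a b. inner_on I (mat_vec I Q a) (mat_vec I Q b) = inner_on I a (mat_vec I Q b)"
    and h: "\<And>i. i \<in> I \<Longrightarrow> h i \<in> borel_measurable N"
    and hM: "\<And>x. x \<in> space N \<Longrightarrow> (\<Sum>i\<in>I. (h i x)\<^sup>2) \<le> M" and M: "0 < M"
    and pq: "1 < q" "1 < s" "1 / q + 1 / s = 1" and E: "0 < E"
    and F: "\<And>\<epsilon>. \<epsilon> \<in> sign_vectors I \<Longrightarrow> integrable N (\<lambda>x. \<bar>F \<epsilon> x\<bar> powr q)"
      "\<And>\<epsilon>. \<epsilon> \<in> sign_vectors I \<Longrightarrow> (\<integral>x. \<bar>F \<epsilon> x\<bar> powr q \<partial>N) \<le> E powr q"
      "\<And>\<epsilon>. \<epsilon> \<in> sign_vectors I \<Longrightarrow> F \<epsilon> \<in> borel_measurable N"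
    and pairing: "\<And>\<epsilon>. \<epsilon> \<in> sign_vectors I \<Longrightarrow>
      c * inner_on I \<epsilon> (mat_vec I Q \<epsilon>) \<le> (\<integral>x. F \<epsilon> x * (\<Sum>i\<in>I. mat_vec I Q \<epsilon> i * h i x) \<partial>N)"
  shows "c * trace_on I Q \<le> E * sqrt M * (1 + 6 * s powr s)"
proof -
  interpret N: finite_measure N by (rule N)
  \<comment> \<open>As \<open>Q\<close> is symmetric, the projection moves from the signs to the
    vector of the values of h at x. Thus \<open>g\<close> is at each x a random sign sum whose
    coefficient vector has norm at most 1.\<close>
  define g where "g = (\<lambda>\<epsilon> x. inner_on I \<epsilon> (mat_vec I Q (\<lambda>i. h i x / sqrt M)))"
  have g_eq: "(\<Sum>i\<in>I. mat_vec I Q \<epsilon> i * h i x) = sqrt M * g \<epsilon> x" for \<epsilon> x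
  proof -
    have "g \<epsilon> x = inner_on I (\<lambda>i. h i x / sqrt M) (mat_vec I Q \<epsilon>)"
      unfolding g_def by (rule mat_vec_sym) (rule sym)
    then show ?thesis using M by (simp add: inner_on_def sum_distrib_left mult_ac)
  qed
  have g_meas: "g \<epsilon> \<in> borel_measurable N" for \<epsilon>
    unfolding g_def inner_on_def mat_vec_def using h by (intro borel_measurable_sum borel_measurable_times borel_measurable_divide) auto
  have g_sum: "(\<Sum>\<epsilon>\<in>sign_vectors I. \<bar>g \<epsilon> x\<bar> powr s) \<le> 2 ^ card I * (6 * s powr s)" if "x \<in> space N" for x
    unfolding g_def
  proof (rule sum_sign_vectors_powr[OF fin])
    have "inner_on I (\<lambda>i. h i x / sqrt M) (\<lambda>i. h i x / sqrt M) = (\<Sum>i\<in>I. (h i x)\<^sup>2) / M"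
      using M by (simp add: inner_on_def sum_divide_distrib power2_eq_square)
    also have "\<dots> \<le> 1" using hM[OF that] M by simp
    finally show "inner_on I (mat_vec I Q (\<lambda>i. h i x / sqrt M)) (mat_vec I Q (\<lambda>i. h i x / sqrt M)) \<le> 1"
      using projection_contracts[OF fin idem, of "\<lambda>i. h i x / sqrt M"] by linarith
    show "0 < s" using pq by simp
  qed
  have g_le: "\<bar>g \<epsilon> x\<bar> powr s \<le> 2 ^ card I * (6 * s powr s)" if "x \<in> space N" "\<epsilon> \<in> sign_vectors I" for x \<epsilon>
  proof -
    have "\<bar>g \<epsilon> x\<bar> powr s \<le> (\<Sum>\<epsilon>\<in>sign_vectors I. \<bar>g \<epsilon> x\<bar> powr s)"
      using that finite_sign_vectors[OF fin] by (intro member_le_sum) auto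
    with g_sum[OF that(1)] show ?thesis by linarith
  qed
  have g_int: "integrable N (\<lambda>x. \<bar>g \<epsilon> x\<bar> powr s)" if "\<epsilon> \<in> sign_vectors I" for \<epsilon>
    using g_le[OF _ that] g_meas[of \<epsilon>]
    by (intro N.integrable_const_bound[where B = "2 ^ card I * (6 * s powr s)"]) auto
  \<comment> \<open>The error is normalized by \<open>E\<close> and the witness by sqrt M. The
    integrals of both terms are then bounded on average over the signs, so Young's inequality loses
    only a constant.\<close>
  define G where "G = (\<lambda>\<epsilon> x. (E * sqrt M) * (\<bar>F \<epsilon> x\<bar> powr q / E powr q / q + \<bar>g \<epsilon> x\<bar> powr s / s))"
  have young: "\<bar>F \<epsilon> x * (sqrt M * g \<epsilon> x)\<bar> \<le> G \<epsilon> x" for \<epsilon> x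
  proof -
    have "\<bar>F \<epsilon> x\<bar> / E * \<bar>g \<epsilon> x\<bar> \<le> (\<bar>F \<epsilon> x\<bar> / E) powr q / q + \<bar>g \<epsilon> x\<bar> powr s / s"
      using pq E by (intro Youngs_inequality) auto
    then have "(E * sqrt M) * (\<bar>F \<epsilon> x\<bar> / E * \<bar>g \<epsilon> x\<bar>) \<le> G \<epsilon> x"
      unfolding G_def using E M by (intro mult_left_mono) (auto simp: powr_divide)
    then show ?thesis using E M by (simp add: abs_mult mult.left_commute)
  qed
  have G_int: "integrable N (G \<epsilon>)" if "\<epsilon> \<in> sign_vectors I" for \<epsilon>
    unfolding G_def using F(1)[OF that] g_int[OF that] by simp
  have "2 ^ card I * (c * trace_on I Q) = (\<Sum>\<epsilon>\<in>sign_vectors I. c * inner_on I \<epsilon> (mat_vec I Q \<epsilon>))"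
    by (simp add: sum_distrib_left[symmetric] sum_sign_vectors_quadratic[OF fin])
  also have "\<dots> \<le> (\<Sum>\<epsilon>\<in>sign_vectors I. \<integral>x. G \<epsilon> x \<partial>N)"
  proof (rule sum_mono)
    fix \<epsilon> assume \<epsilon>: "\<epsilon> \<in> sign_vectors I"
    have int: "integrable N (\<lambda>x. F \<epsilon> x * (sqrt M * g \<epsilon> x))"
      by (rule Bochner_Integration.integrable_bound[OF G_int[OF \<epsilon>]])
        (use F(3)[OF \<epsilon>] g_meas[of \<epsilon>] young[of \<epsilon>] in \<open>auto intro!: AE_I2 intro: order_trans[OF _ abs_ge_self]\<close>)
    have "c * inner_on I \<epsilon> (mat_vec I Q \<epsilon>) \<le> (\<integral>x. F \<epsilon> x * (sqrt M * g \<epsilon> x) \<partial>N)"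
      using pairing[OF \<epsilon>] by (simp add: g_eq)
    also have "\<dots> \<le> (\<integral>x. G \<epsilon> x \<partial>N)"
      using young[of \<epsilon>] by (intro integral_mono int G_int \<epsilon>) (auto simp: abs_le_iff)
    finally show "c * inner_on I \<epsilon> (mat_vec I Q \<epsilon>) \<le> (\<integral>x. G \<epsilon> x \<partial>N)" .
  qed
  also have "\<dots> = (E * sqrt M) * ((\<Sum>\<epsilon>\<in>sign_vectors I. (\<integral>x. \<bar>F \<epsilon> x\<bar> powr q \<partial>N) / E powr q / q)
      + (\<Sum>\<epsilon>\<in>sign_vectors I. \<integral>x. \<bar>g \<epsilon> x\<bar> powr s \<partial>N) / s)"
    unfolding G_def using F(1) g_int
    by (simp add: sum_distrib_left[symmetric] sum.distrib sum_divide_distrib[symmetric] integral_add)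
  also have "\<dots> \<le> (E * sqrt M) * (2 ^ card I + 2 ^ card I * (6 * s powr s))"
  proof (intro mult_left_mono add_mono)
    have "(\<Sum>\<epsilon>\<in>sign_vectors I. (\<integral>x. \<bar>F \<epsilon> x\<bar> powr q \<partial>N) / E powr q / q) \<le> (\<Sum>\<epsilon>\<in>sign_vectors I. 1)"
    proof (rule sum_mono)
      fix \<epsilon> assume \<epsilon>: "\<epsilon> \<in> sign_vectors I"
      have "(\<integral>x. \<bar>F \<epsilon> x\<bar> powr q \<partial>N) / E powr q \<le> 1" using F(2)[OF \<epsilon>] E by simp
      then have "(\<integral>x. \<bar>F \<epsilon> x\<bar> powr q \<partial>N) / E powr q / q \<le> 1 / q"
        using pq by (intro divide_right_mono) auto
      also have "\<dots> \<le> 1" using pq by simp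
      finally show "(\<integral>x. \<bar>F \<epsilon> x\<bar> powr q \<partial>N) / E powr q / q \<le> 1" .
    qed
    then show "(\<Sum>\<epsilon>\<in>sign_vectors I. (\<integral>x. \<bar>F \<epsilon> x\<bar> powr q \<partial>N) / E powr q / q) \<le> 2 ^ card I"
      by (simp add: card_sign_vectors[OF fin])
    have "(\<Sum>\<epsilon>\<in>sign_vectors I. \<integral>x. \<bar>g \<epsilon> x\<bar> powr s \<partial>N) = (\<integral>x. (\<Sum>\<epsilon>\<in>sign_vectors I. \<bar>g \<epsilon> x\<bar> powr s) \<partial>N)"
      using g_int by (intro Bochner_Integration.integral_sum[symmetric])
    also have "\<dots> \<le> 2 ^ card I * (6 * s powr s)"
    proof -
      have "(\<integral>x. (\<Sum>\<epsilon>\<in>sign_vectors I. \<bar>g \<epsilon> x\<bar> powr s) \<partial>N) \<le> (\<integral>x. 2 ^ card I * (6 * s powr s) \<partial>N)"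
        using g_int g_sum by (intro integral_mono Bochner_Integration.integrable_sum) auto
      then show ?thesis using N(2) by simp
    qed
    finally have *: "(\<Sum>\<epsilon>\<in>sign_vectors I. \<integral>x. \<bar>g \<epsilon> x\<bar> powr s \<partial>N) \<le> 2 ^ card I * (6 * s powr s)" .
    have "(\<Sum>\<epsilon>\<in>sign_vectors I. \<integral>x. \<bar>g \<epsilon> x\<bar> powr s \<partial>N) / s \<le> (\<Sum>\<epsilon>\<in>sign_vectors I. \<integral>x. \<bar>g \<epsilon> x\<bar> powr s \<partial>N) / 1"
      using pq by (intro divide_left_mono sum_nonneg) auto
    with * show "(\<Sum>\<epsilon>\<in>sign_vectors I. \<integral>x. \<bar>g \<epsilon> x\<bar> powr s \<partial>N) / s \<le> 2 ^ card I * (6 * s powr s)" by simp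
  qed (use E M in auto)
  finally have "2 ^ card I * (c * trace_on I Q) \<le> 2 ^ card I * (E * sqrt M * (1 + 6 * s powr s))"
    by (simp add: algebra_simps)
  then show ?thesis by simp
qed

section \<open>Fourier coefficients and mixed differences\<close>

abbreviation cube :: "(real ^ 'n) measure" where
  "cube \<equiv> lebesgue_on (cbox 0 1)"

lemma measure_cube: "measure (cube :: (real ^ 'n) measure) (cbox 0 1) = 1"
proof -
  have "measure (cube :: (real ^ 'n) measure) (cbox 0 1) = measure lborel (cbox (0 :: real ^ 'n) 1)"
    by (simp add: measure_restrict_space)
  also have "\<dots> = 1" by (subst content_cbox_cart) (auto simp: interval_eq_empty_cart)
  finally show ?thesis .
qed

lemma finite_measure_cube: "finite_measure (cube :: (real ^ 'n) measure)"
  by (rule finite_measureI) (simp add: emeasure_restrict_space emeasure_lborel_cbox_eq)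

lemma integrable_cube_continuous:
  fixes f :: "real ^ 'n \<Rightarrow> 'b::euclidean_space"
  assumes "continuous_on UNIV f"
  shows "integrable cube f"
  by (intro continuous_imp_integrable continuous_on_subset[OF assms]) auto

lemma integral_cube_const: "(\<integral>x. c \<partial>(cube :: (real ^ 'n) measure)) = (c :: 'b::euclidean_space)"
proof -
  interpret finite_measure "cube :: (real ^ 'n) measure" by (rule finite_measure_cube)
  show ?thesis using measure_cube[where 'n = 'n] by simp
qed

lemma cube_integral_eq:
  fixes f :: "real ^ 'n \<Rightarrow> 'b::euclidean_space"
  assumes "continuous_on UNIV f"
  shows "(\<integral>x. f x \<partial>cube) = integral (cbox 0 1) f"
  by (intro lebesgue_integral_eq_integral integrable_cube_continuous assms) auto

lemma axis_zero: "axis i 0 = (0 :: real ^ 'n)"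
  by (simp add: vec_eq_iff axis_def)

lemma axis_add: "axis i (s + t) = axis i s + (axis i t :: real ^ 'n)"
  by (simp add: vec_eq_iff axis_def)

lemma periodic_nat:
  assumes "periodic f"
  shows "f (x + axis i (real k)) = f x"
proof (induction k)
  case 0
  show ?case by (simp add: axis_zero)
next
  case (Suc k)
  have "f (x + axis i (real (Suc k))) = f (x + axis i (real k) + axis i 1)"
    by (rule arg_cong[of _ _ f]) (simp add: axis_add[symmetric] add.assoc add.commute)
  also have "\<dots> = f (x + axis i (real k))"
    using assms by (simp only: periodic_def)
  also have "\<dots> = f x" by (rule Suc)
  finally show ?case .
qed

lemma periodic_int:
  assumes "periodic f"
  shows "f (x + axis i (of_int m)) = f x"
proof (cases "0 \<le> m")
  case True
  then show ?thesis using periodic_nat[OF assms, of x i "nat m"] by simp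
next
  case False
  have "f x = f (x + axis i (of_int m) + axis i (real (nat (- m))))"
    using False by (intro arg_cong[of _ _ f]) (simp add: add.assoc axis_add[symmetric] axis_zero)
  also have "\<dots> = f (x + axis i (of_int m))" by (rule periodic_nat[OF assms])
  finally show ?thesis by (rule sym)
qed

lemma continuous_shift:
  fixes f :: "real ^ 'n \<Rightarrow> 'b::topological_space"
  shows "continuous_on UNIV f \<Longrightarrow> continuous_on UNIV (\<lambda>x. f (x + c))"
  by (rule continuous_on_compose2[of UNIV f]) (auto intro!: continuous_intros)

text \<open>Only the fractional part of t matters. The part of the shifted cube that sticks out
  beyond the face x_i = 1 is moved back by one period.\<close>

lemma integral_cube_shift:
  fixes f :: "real ^ 'n \<Rightarrow> 'b::euclidean_space"
  assumes cont: "continuous_on UNIV f" and per: "periodic f"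
  shows "(\<integral>x. f (x + axis i t) \<partial>cube) = (\<integral>x. f x \<partial>cube)"
proof -
  define s where "s = frac t"
  have s: "0 \<le> s" "s \<le> 1" using frac_lt_1[of t] by (auto simp: s_def less_imp_le)
  define c :: "real ^ 'n" where "c = axis i s"
  have split: "x \<in> cbox a b \<longleftrightarrow> (a $ i \<le> x $ i \<and> x $ i \<le> b $ i) \<and> (\<forall>j. j \<noteq> i \<longrightarrow> a $ j \<le> x $ j \<and> x $ j \<le> b $ j)"
    for x a b :: "real ^ 'n"
    unfolding mem_box_cart by metis
  have "f (x + axis i t) = f (x + c)" for x
  proof -
    have "f (x + axis i t) = f ((x + c) + axis i (of_int \<lfloor>t\<rfloor>))"
      by (intro arg_cong[of _ _ f]) (simp add: c_def s_def frac_def add.assoc axis_add[symmetric])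
    also have "\<dots> = f (x + c)" by (rule periodic_int[OF per])
    finally show ?thesis .
  qed
  then have "(\<integral>x. f (x + axis i t) \<partial>cube) = integral (cbox 0 1) (\<lambda>x. f (x + c))"
    by (simp add: cube_integral_eq continuous_shift[OF cont])
  also have "\<dots> = integral (cbox c (1 + c)) f"
    using integral_shift_cbox_plus[of 0 1 f c] by (simp add: comp_def add.commute)
  also have "\<dots> = integral (cbox c (1 + c) \<inter> {x. x \<bullet> axis i 1 \<le> 1}) f + integral (cbox c (1 + c) \<inter> {x. x \<bullet> axis i 1 \<ge> 1}) f"
    by (intro integral_split integrable_continuous continuous_on_subset[OF cont]) auto
  also have "cbox c (1 + c) \<inter> {x. x \<bullet> axis i 1 \<le> 1} = cbox c 1"
    by (rule set_eqI) (simp only: Int_iff mem_Collect_eq split inner_axis, use s in \<open>auto simp: c_def axis_def\<close>)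
  also have "cbox c (1 + c) \<inter> {x. x \<bullet> axis i 1 \<ge> 1} = cbox (axis i 1) (1 + c)"
    by (rule set_eqI) (simp only: Int_iff mem_Collect_eq split inner_axis, use s in \<open>auto simp: c_def axis_def\<close>)
  also have "integral (cbox (axis i 1) (1 + c)) f = integral (cbox 0 (1 + c - axis i 1)) f"
    using integral_shift_cbox_plus[of 0 "1 + c - axis i 1" f "axis i 1"] per
    by (simp add: comp_def add.commute periodic_def)
  also have "cbox 0 (1 + c - axis i 1) = cbox 0 1 \<inter> {x. x \<bullet> axis i 1 \<le> s}"
    by (rule set_eqI) (simp only: Int_iff mem_Collect_eq split inner_axis, use s in \<open>auto simp: c_def axis_def\<close>)
  also have "cbox c 1 = cbox 0 1 \<inter> {x. x \<bullet> axis i 1 \<ge> s}"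
    by (rule set_eqI) (simp only: Int_iff mem_Collect_eq split inner_axis, use s in \<open>auto simp: c_def axis_def\<close>)
  also have "integral (cbox 0 1 \<inter> {x. x \<bullet> axis i 1 \<ge> s}) f + integral (cbox 0 1 \<inter> {x. x \<bullet> axis i 1 \<le> s}) f = integral (cbox 0 1) f"
    by (subst integral_split[where k = "axis i 1" and c = s and a = 0 and b = 1])
      (auto intro!: integrable_continuous continuous_on_subset[OF cont])
  also have "\<dots> = (\<integral>x. f x \<partial>cube)" by (simp add: cube_integral_eq cont)
  finally show ?thesis .
qed

section \<open>Characters of the torus and Fourier coefficients\<close>

definition phase :: "('n::finite \<Rightarrow> int) \<Rightarrow> real ^ 'n \<Rightarrow> real" where
  "phase k x = 2 * pi * (\<Sum>i\<in>UNIV. of_int (k i) * x $ i)"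

definition expi :: "('n::finite \<Rightarrow> int) \<Rightarrow> real ^ 'n \<Rightarrow> complex" where
  "expi k x = cis (phase k x)"

lemma phase_add: "phase k (x + y) = phase k x + phase k y"
  by (simp add: phase_def distrib_left sum.distrib)

lemma phase_diff: "phase k (x - y) = phase k x - phase k y"
  by (simp add: phase_def right_diff_distrib sum_subtractf)

lemma phase_add_freq: "phase (\<lambda>i. k i + j i) x = phase k x + phase j x"
  by (simp add: phase_def distrib_right distrib_left sum.distrib)

lemma phase_uminus_freq: "phase (\<lambda>i. - k i) x = - phase k x"
  by (simp add: phase_def sum_negf)

lemma phase_axis: "phase k (axis i t) = 2 * pi * (of_int (k i) * t)"
proof -
  have "(\<Sum>j\<in>UNIV. of_int (k j) * (axis i t :: real ^ 'a) $ j) = (\<Sum>j\<in>UNIV. if j = i then of_int (k i) * t else 0)"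
    by (rule sum.cong) (auto simp: axis_def)
  then show ?thesis by (simp add: phase_def)
qed

lemma continuous_phase [continuous_intros]: "continuous_on S (phase k)"
  unfolding phase_def by (intro continuous_intros)

lemma continuous_expi [continuous_intros]: "continuous_on S (expi k)"
  unfolding expi_def cis_conv_exp by (intro continuous_intros)

lemma expi_add: "expi k (x + y) = expi k x * expi k y"
  by (simp add: expi_def phase_add cis_mult)

lemma expi_add_freq: "expi (\<lambda>i. k i + j i) x = expi k x * expi j x"
  by (simp add: expi_def phase_add_freq cis_mult)

lemma expi_uminus_freq: "expi (\<lambda>i. - k i) x = cnj (expi k x)"
  by (simp add: expi_def phase_uminus_freq cis_cnj)

lemma expi_zero_freq: "expi (\<lambda>_. 0) x = 1"
  by (simp add: expi_def phase_def)

lemma norm_expi [simp]: "norm (expi k x) = 1"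
  by (simp add: expi_def)

lemma periodic_expi: "periodic (expi k)"
proof -
  have "cis (2 * pi * (of_int m * 1)) = 1" for m :: int
    using cis_multiple_2pi[of "of_int m"] by (simp add: mult_ac)
  then show ?thesis by (simp add: periodic_def expi_add expi_def[of k "axis _ _"] phase_axis)
qed

lemma integral_expi: "(\<integral>x. expi k x \<partial>cube) = of_bool (k = (\<lambda>_. 0))"
proof (cases "k = (\<lambda>_. 0)")
  case True
  then show ?thesis using integral_cube_const[of "1::complex"] by (simp add: expi_zero_freq)
next
  case False
  then obtain i where i: "k i \<noteq> 0" by auto
  \<comment> \<open>Half a wavelength in direction i, over which the character changes sign; the
    integral then equals its own negative.\<close>
  define t :: real where "t = 1 / (2 * of_int (k i))"
  have "expi k (axis i t) = -1"
  proof -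
    have "phase k (axis i t) = pi" unfolding phase_axis using i by (simp add: t_def)
    then show ?thesis by (simp add: expi_def)
  qed
  then have "expi k (x + axis i t) = - expi k x" for x
    by (simp add: expi_add)
  moreover have "(\<integral>x. expi k (x + axis i t) \<partial>cube) = (\<integral>x. expi k x \<partial>cube)"
    by (intro integral_cube_shift continuous_intros periodic_expi)
  ultimately have "- (\<integral>x. expi k x \<partial>cube) = (\<integral>x. expi k x \<partial>cube)" by simp
  then show ?thesis using False by (simp add: eq_neg_iff_add_eq_0 flip: mult_2)
qed

definition fourier :: "(real ^ 'n \<Rightarrow> complex) \<Rightarrow> ('n::finite \<Rightarrow> int) \<Rightarrow> complex" where
  "fourier f k = (\<integral>x. f x * cnj (expi k x) \<partial>cube)"

lemma integral_expi_expi: "(\<integral>x. expi j x * cnj (expi k x) \<partial>cube) = of_bool (j = k)"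
proof -
  have "(\<integral>x. expi j x * cnj (expi k x) \<partial>cube) = (\<integral>x. expi (\<lambda>i. j i + - k i) x \<partial>cube)"
    by (simp only: expi_add_freq expi_uminus_freq)
  also have "\<dots> = of_bool (j = k)"
    unfolding integral_expi by (auto simp: fun_eq_iff)
  finally show ?thesis .
qed

lemma fourier_trig_poly:
  assumes "finite S"
  shows "fourier (\<lambda>x. \<Sum>j\<in>S. c j * expi j x) k = (if k \<in> S then c k else 0)"
proof -
  have "fourier (\<lambda>x. \<Sum>j\<in>S. c j * expi j x) k = (\<integral>x. (\<Sum>j\<in>S. c j * (expi j x * cnj (expi k x))) \<partial>cube)"
    by (simp only: fourier_def sum_distrib_right mult.assoc)
  also have "\<dots> = (\<Sum>j\<in>S. (\<integral>x. c j * (expi j x * cnj (expi k x)) \<partial>cube))"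
    by (intro Bochner_Integration.integral_sum integrable_cube_continuous continuous_intros)
  also have "\<dots> = (\<Sum>j\<in>S. c j * of_bool (j = k))"
    by (simp add: integral_expi_expi)
  also have "\<dots> = (\<Sum>j\<in>S. if j = k then c j else 0)" by (rule sum.cong) auto
  also have "\<dots> = (if k \<in> S then c k else 0)" using assms by simp
  finally show ?thesis .
qed

lemma bessel:
  assumes fin: "finite S" and cont: "continuous_on UNIV f"
  shows "(\<Sum>k\<in>S. (norm (fourier f k))\<^sup>2) \<le> (\<integral>x. (norm (f x))\<^sup>2 \<partial>cube)"
proof -
  define P where "P = (\<lambda>x. \<Sum>k\<in>S. fourier f k * expi k x)"
  have contP: "continuous_on UNIV P" unfolding P_def by (intro continuous_intros)
  note int = integrable_cube_continuous
  have cross: "(\<integral>x. g x * cnj (P x) \<partial>cube) = (\<Sum>k\<in>S. cnj (fourier f k) * fourier g k)"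
    if g: "continuous_on UNIV g" for g
  proof -
    have "(\<integral>x. g x * cnj (P x) \<partial>cube) = (\<integral>x. (\<Sum>k\<in>S. cnj (fourier f k) * (g x * cnj (expi k x))) \<partial>cube)"
      by (simp add: P_def sum_distrib_left mult_ac)
    also have "\<dots> = (\<Sum>k\<in>S. cnj (fourier f k) * fourier g k)"
      unfolding fourier_def by (subst Bochner_Integration.integral_sum) (auto intro!: int continuous_intros g)
    finally show ?thesis .
  qed
  have PP: "(\<integral>x. P x * cnj (P x) \<partial>cube) = (\<Sum>k\<in>S. cnj (fourier f k) * fourier f k)"
    unfolding cross[OF contP] unfolding P_def by (intro sum.cong refl) (simp add: fourier_trig_poly[OF fin])
  have "0 \<le> (\<integral>x. (norm (f x - P x))\<^sup>2 \<partial>cube)" by (intro integral_nonneg_AE) simp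
  also have "(\<lambda>x. (norm (f x - P x))\<^sup>2) = (\<lambda>x. (norm (f x))\<^sup>2 + (Re (P x * cnj (P x)) - 2 * Re (f x * cnj (P x))))"
    by (rule ext) (simp only: cmod_power2 minus_complex.sel times_complex.sel complex_cnj,
      simp add: power2_eq_square algebra_simps)
  also have "(\<integral>x. \<dots> x \<partial>cube) = (\<integral>x. (norm (f x))\<^sup>2 \<partial>cube)
      + ((\<integral>x. Re (P x * cnj (P x)) \<partial>cube) - 2 * (\<integral>x. Re (f x * cnj (P x)) \<partial>cube))"
    by (subst Bochner_Integration.integral_add Bochner_Integration.integral_diff,
        (intro int continuous_intros cont contP)+)+ (simp only: integral_mult_right_zero)
  also have "(\<integral>x. Re (P x * cnj (P x)) \<partial>cube) = Re (\<Sum>k\<in>S. cnj (fourier f k) * fourier f k)"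
    unfolding PP[symmetric] by (intro integral_Re int continuous_intros contP)
  also have "(\<integral>x. Re (f x * cnj (P x)) \<partial>cube) = Re (\<Sum>k\<in>S. cnj (fourier f k) * fourier f k)"
    unfolding cross[OF cont, symmetric] by (intro integral_Re int continuous_intros cont contP)
  also have "(\<Sum>k\<in>S. cnj (fourier f k) * fourier f k) = of_real (\<Sum>k\<in>S. (norm (fourier f k))\<^sup>2)"
    by (simp only: of_real_sum complex_norm_square mult.commute)
  finally show ?thesis by simp
qed

section \<open>Shifts and differences as Fourier multipliers\<close>

lemma fourier_shift:
  assumes cont: "continuous_on UNIV f" and per: "periodic f"
  shows "fourier (\<lambda>x. f (x + axis i t)) k = expi k (axis i t) * fourier f k"
proof -
  define g where "g = (\<lambda>x. f x * cnj (expi k x))"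
  have g: "continuous_on UNIV g" "periodic g"
    using per periodic_expi[of k] by (auto simp: g_def periodic_def intro!: continuous_intros cont)
  have "f (x + axis i t) * cnj (expi k x) = expi k (axis i t) * g (x + axis i t)" for x
  proof -
    have "expi k (axis i t) * cnj (expi k (axis i t)) = 1"
      by (simp add: complex_norm_square[symmetric])
    then show ?thesis by (simp add: g_def expi_add mult_ac)
  qed
  then have "fourier (\<lambda>x. f (x + axis i t)) k = (\<integral>x. expi k (axis i t) * g (x + axis i t) \<partial>cube)"
    by (simp add: fourier_def)
  also have "\<dots> = expi k (axis i t) * (\<integral>x. g (x + axis i t) \<partial>cube)" by simp
  also have "\<dots> = expi k (axis i t) * fourier f k"
    by (simp only: integral_cube_shift[OF g]) (simp add: fourier_def g_def)
  finally show ?thesis .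
qed

text \<open>The values lie in an abstract Euclidean field, so Fourier analysis is applied to one
  real coordinate at a time, regarded as complex.\<close>

definition coord :: "'a::euclidean_space \<Rightarrow> ('x \<Rightarrow> 'a) \<Rightarrow> 'x \<Rightarrow> complex" where
  "coord b f x = of_real (f x \<bullet> b)"

lemma continuous_partial_difference:
  fixes f :: "real ^ 'n \<Rightarrow> 'a::{real_normed_field, euclidean_space}"
  assumes "continuous_on UNIV f"
  shows "continuous_on UNIV (partial_difference l i s f)"
  unfolding partial_difference_def by (intro continuous_intros continuous_shift assms)

lemma periodic_partial_difference:
  assumes "periodic f"
  shows "periodic (partial_difference l i s f)"
proof -
  have "f (x + axis j 1 + y) = f (x + y)" for x y j
    using assms unfolding periodic_def by (metis add.commute add.left_commute)
  then show ?thesis by (simp add: periodic_def partial_difference_def)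
qed

lemma continuous_mixed_difference:
  fixes f :: "real ^ 'n \<Rightarrow> 'a::{real_normed_field, euclidean_space}"
  assumes "continuous_on UNIV f"
  shows "continuous_on UNIV (mixed_difference l u h f)"
  using finite[of u]
  by (induction u) (simp_all add: mixed_difference_empty mixed_difference_insert assms continuous_partial_difference)

lemma periodic_mixed_difference:
  fixes f :: "real ^ 'n \<Rightarrow> 'a::{real_normed_field, euclidean_space}"
  assumes "periodic f"
  shows "periodic (mixed_difference l u h f)"
  using finite[of u]
  by (induction u) (simp_all add: mixed_difference_empty mixed_difference_insert assms periodic_partial_difference)

lemma fourier_partial_difference:
  fixes f :: "real ^ 'n \<Rightarrow> 'a::{real_normed_field, euclidean_space}"
  assumes cont: "continuous_on UNIV f" and per: "periodic f"
  shows "fourier (coord b (partial_difference l i s f)) k = (expi k (axis i s) - 1) ^ l * fourier (coord b f) k"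
proof -
  have contb: "continuous_on UNIV (coord b f)" unfolding coord_def by (intro continuous_intros cont)
  have perb: "periodic (coord b f)" using per by (simp add: periodic_def coord_def)
  \<comment> \<open>The binomial coefficients are elements of the field \<open>'a\<close>, but they
    act as real scalars and so pass through the coordinate functional.\<close>
  have coef: "((-1) ^ m * of_nat n * y) \<bullet> b = (-1) ^ m * of_nat n * (y \<bullet> b)" for m n and y :: 'a
  proof -
    have "((-1) ^ m * of_nat n * y :: 'a) = ((-1) ^ m * of_nat n) *\<^sub>R y"
      by (simp add: scaleR_conv_of_real)
    then show ?thesis by simp
  qed
  have "coord b (partial_difference l i s f) =
      (\<lambda>x. \<Sum>j\<le>l. (-1) ^ (l - j) * of_nat (l choose j) * coord b f (x + axis i (real j * s)))"
    by (simp add: coord_def partial_difference_def inner_sum_left coef fun_eq_iff)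
  then have "fourier (coord b (partial_difference l i s f)) k =
      (\<integral>x. (\<Sum>j\<le>l. (-1) ^ (l - j) * of_nat (l choose j) * (coord b f (x + axis i (real j * s)) * cnj (expi k x))) \<partial>cube)"
    by (simp only: fourier_def sum_distrib_right mult.assoc)
  also have "\<dots> = (\<Sum>j\<le>l. (-1) ^ (l - j) * of_nat (l choose j) * fourier (\<lambda>x. coord b f (x + axis i (real j * s))) k)"
    unfolding fourier_def
    by (subst Bochner_Integration.integral_sum) (auto intro!: integrable_cube_continuous continuous_intros continuous_shift contb)
  also have "\<dots> = (\<Sum>j\<le>l. of_nat (l choose j) * expi k (axis i s) ^ j * (-1) ^ (l - j)) * fourier (coord b f) k"
    unfolding sum_distrib_right
  proof (intro sum.cong refl)
    fix j
    have "expi k (axis i (real j * s)) = expi k (axis i s) ^ j"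
      by (simp add: expi_def phase_axis Complex.DeMoivre mult_ac)
    then show "(-1) ^ (l - j) * of_nat (l choose j) * fourier (\<lambda>x. coord b f (x + axis i (real j * s))) k =
        of_nat (l choose j) * expi k (axis i s) ^ j * (-1) ^ (l - j) * fourier (coord b f) k"
      by (simp add: fourier_shift[OF contb perb])
  qed
  also have "(\<Sum>j\<le>l. of_nat (l choose j) * expi k (axis i s) ^ j * (-1) ^ (l - j)) = (expi k (axis i s) - 1) ^ l"
    using binomial_ring[of "expi k (axis i s)" "-1" l] by simp
  finally show ?thesis .
qed

lemma fourier_mixed_difference:
  fixes f :: "real ^ 'n \<Rightarrow> 'a::{real_normed_field, euclidean_space}"
  assumes cont: "continuous_on UNIV f" and per: "periodic f"
  shows "fourier (coord b (mixed_difference l u h f)) k =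
    (\<Prod>i\<in>u. (expi k (axis i (h $ i)) - 1) ^ l) * fourier (coord b f) k"
  using finite[of u]
proof (induction u)
  case empty
  then show ?case by (simp add: mixed_difference_empty)
next
  case (insert i u)
  then show ?case
    using fourier_partial_difference[OF continuous_mixed_difference[OF cont] periodic_mixed_difference[OF per]]
    by (simp add: mixed_difference_insert mult_ac)
qed

section \<open>Comparison of integral norms on the cube\<close>

lemma powr_young:
  fixes y a b :: real
  assumes "0 < a" "a \<le> b" "0 \<le> y"
  shows "y powr a \<le> a / b * y powr b + (1 - a / b)"
proof (cases "y = 0")
  case False
  then have "(y powr b) powr (a / b) * 1 powr (1 - a / b) \<le> a / b * y powr b + (1 - a / b) * 1"
    using assms by (intro Youngs_inequality_0) auto
  then show ?thesis using assms by (simp add: powr_powr)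
qed (use assms in auto)

text \<open>Trades extended real norms for inequalities between integrals of powers, the form in
  which the estimates are carried out.\<close>

lemma Lp_norm_le_iff:
  fixes f :: "real ^ 'n \<Rightarrow> 'a::{real_normed_field, euclidean_space}"
  assumes p: "0 < p" and K: "0 < K" and int: "integrable cube (\<lambda>x. norm (f x) powr p)"
  shows "Lp_norm p f \<le> ennreal K \<longleftrightarrow> (\<integral>x. norm (f x) powr p \<partial>cube) \<le> K powr p"
proof -
  define J where "J = (\<integral>x. norm (f x) powr p \<partial>cube)"
  have J: "(\<integral>\<^sup>+ x. ennreal (norm (f x) powr p) \<partial>cube) = ennreal J"
    unfolding J_def by (intro nn_integral_eq_integral int) auto
  have J0: "0 \<le> J" unfolding J_def by (intro integral_nonneg_AE) simp
  have "Lp_norm p f = ennreal (J powr (1 / p))"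
    using J0 by (simp add: Lp_norm_def J Let_def)
  then have "Lp_norm p f \<le> ennreal K \<longleftrightarrow> J powr (1 / p) \<le> K"
    using K by simp
  also have "\<dots> \<longleftrightarrow> J \<le> K powr p"
  proof
    assume "J powr (1 / p) \<le> K"
    then have "(J powr (1 / p)) powr p \<le> K powr p" using p by (intro powr_mono2) auto
    then show "J \<le> K powr p" using p J0 by (simp add: powr_powr)
  next
    assume "J \<le> K powr p"
    then have "J powr (1 / p) \<le> (K powr p) powr (1 / p)" using p J0 by (intro powr_mono2) auto
    then show "J powr (1 / p) \<le> K" using p K by (simp add: powr_powr)
  qed
  finally show ?thesis by (simp add: J_def)
qed

text \<open>Hoelder's inequality on a space of mass one, in normalized form:
  \<open>powr_young\<close> is applied pointwise to the norm of f divided by K and then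
  integrated.\<close>

lemma integral_powr_mono:
  fixes f :: "real ^ 'n \<Rightarrow> 'a::{real_normed_field, euclidean_space}"
  assumes a: "0 < a" and b: "a \<le> b" and K: "0 < K"
    and inta: "integrable cube (\<lambda>x. norm (f x) powr a)" and intb: "integrable cube (\<lambda>x. norm (f x) powr b)"
    and le: "(\<integral>x. norm (f x) powr b \<partial>cube) \<le> K powr b"
  shows "(\<integral>x. norm (f x) powr a \<partial>cube) \<le> K powr a"
proof -
  have *: "norm (f x) powr a \<le> K powr a * (a / b * (norm (f x) powr b / K powr b) + (1 - a / b))" for x
  proof -
    have "(norm (f x) / K) powr a \<le> a / b * (norm (f x) / K) powr b + (1 - a / b)"
      using a b K by (intro powr_young) auto
    then have "K powr a * (norm (f x) / K) powr a \<le> K powr a * (a / b * (norm (f x) / K) powr b + (1 - a / b))"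
      by (intro mult_left_mono) auto
    then show ?thesis using K by (simp add: powr_divide)
  qed
  have int1: "integrable cube (\<lambda>x. a / b * (norm (f x) powr b / K powr b))" using intb by simp
  have intc: "integrable cube (\<lambda>x. 1 - a / b)" by (intro integrable_cube_continuous continuous_intros)
  have "(\<integral>x. norm (f x) powr a \<partial>cube)
      \<le> (\<integral>x. K powr a * (a / b * (norm (f x) powr b / K powr b) + (1 - a / b)) \<partial>cube)"
    by (intro integral_mono inta * integrable_mult_right Bochner_Integration.integrable_add int1 intc)
  also have "\<dots> = K powr a * (a / b * ((\<integral>x. norm (f x) powr b \<partial>cube) / K powr b) + (1 - a / b))"
    by (simp only: integral_mult_right_zero Bochner_Integration.integral_add[OF int1 intc] integral_cube_const)
      simp
  also have "\<dots> \<le> K powr a * (a / b * 1 + (1 - a / b))"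
    using le K a b by (intro mult_left_mono add_right_mono) auto
  finally show ?thesis using a b by simp
qed

lemma integrable_norm_powr:
  fixes f :: "real ^ 'n \<Rightarrow> 'a::{real_normed_field, euclidean_space}"
  assumes "continuous_on UNIV f" "0 < p"
  shows "integrable cube (\<lambda>x. norm (f x) powr p)"
  by (intro integrable_cube_continuous continuous_on_powr' continuous_intros assms) (use assms in auto)

lemma Lp_norm_square:
  fixes f :: "real ^ 'n \<Rightarrow> 'a::{real_normed_field, euclidean_space}"
  assumes cont: "continuous_on UNIV f" and p: "2 \<le> p" and K: "0 < K" and le: "Lp_norm p f \<le> ennreal K"
  shows "(\<integral>x. (norm (f x))\<^sup>2 \<partial>cube) \<le> K\<^sup>2"
proof -
  have "(\<integral>x. norm (f x) powr p \<partial>cube) \<le> K powr p"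
    using Lp_norm_le_iff[of p K f] le p K integrable_norm_powr[OF cont] by simp
  then have "(\<integral>x. norm (f x) powr 2 \<partial>cube) \<le> K powr 2"
    using p K by (intro integral_powr_mono[of 2 p] integrable_norm_powr[OF cont]) auto
  then show ?thesis using K by (simp add: powr_numeral)
qed

section \<open>Dyadic blocks and the decay of Fourier coefficients\<close>

lemma HN_ball_difference_bound:
  fixes f :: "real ^ 'n \<Rightarrow> 'a::{real_normed_field, euclidean_space}"
  assumes f: "f \<in> HN_ball l r p" and t: "\<And>i. 0 < t $ i \<and> t $ i \<le> 1" and h: "\<And>i. i \<in> u \<Longrightarrow> \<bar>h $ i\<bar> < t $ i"
  shows "Lp_norm p (mixed_difference l u h f) \<le> ennreal (\<Prod>i\<in>u. t $ i powr r)"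
proof -
  define a where "a = (\<Prod>i\<in>u. t $ i powr (- r))"
  have a: "0 < a" unfolding a_def using t by (intro prod_pos) (metis less_numeral_extra(3) powr_gt_zero)
  have a_inv: "1 / a = (\<Prod>i\<in>u. t $ i powr r)"
    by (simp add: a_def powr_minus prod_inversef inverse_eq_divide prod_dividef)
  have "ennreal a * Lp_norm p (mixed_difference l u h f) \<le> ennreal a * mixed_modulus l u p f t"
    unfolding mixed_modulus_def using h by (intro mult_left_mono SUP_upper) auto
  also have "\<dots> \<le> (SUP t\<in>{t. \<forall>i. 0 < t $ i \<and> t $ i \<le> 1}.
        ennreal (\<Prod>i\<in>u. t $ i powr (- r)) * mixed_modulus l u p f t)"
    unfolding a_def using t by (intro SUP_upper) auto
  also have "\<dots> \<le> HN_norm l r p f"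
    unfolding HN_norm_def by (rule member_le_sum) auto
  also have "\<dots> \<le> 1" using f by (simp add: HN_ball_def)
  finally have le: "ennreal a * Lp_norm p (mixed_difference l u h f) \<le> 1" .
  have "Lp_norm p (mixed_difference l u h f) = ennreal (1 / a) * (ennreal a * Lp_norm p (mixed_difference l u h f))"
    using a by (simp add: mult.assoc[symmetric] ennreal_mult[symmetric])
  also have "\<dots> \<le> ennreal (1 / a) * 1" by (intro mult_left_mono le) auto
  finally show ?thesis by (simp add: a_inv)
qed

text \<open>Level 0 contains only the frequency 0, and level a + 1 the frequencies of modulus at
  least 2^a and less than 2^(a+1).\<close>

definition lev :: "int \<Rightarrow> nat" where
  "lev j = (LEAST a. \<bar>j\<bar> < 2 ^ a)"

lemma lev_upper: "\<bar>j\<bar> < 2 ^ lev j"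
proof -
  have "\<bar>j\<bar> < 2 ^ nat \<bar>j\<bar>"
    using of_nat_less_two_power[of "nat \<bar>j\<bar>", where 'a = int] by simp
  then show ?thesis unfolding lev_def by (rule LeastI)
qed

lemma lev_lower: "lev j = Suc a \<Longrightarrow> 2 ^ a \<le> \<bar>j\<bar>"
  unfolding lev_def by (metis lessI not_less_Least not_less)

lemma lev_uminus: "lev (- j) = lev j"
  by (simp add: lev_def)

lemma lev_block: "finite {j. lev j = a} \<and> card {j. lev j = a} \<le> 2 ^ a"
proof (cases a)
  case 0
  have "{j. lev j = 0} \<subseteq> {0}" 
  proof
    fix j assume "j \<in> {j. lev j = 0}"
    then show "j \<in> {0}" using lev_upper[of j] by simp
  qed
  then show ?thesis using 0 by (metis card.empty card.insert card_mono finite.emptyI finite_insert finite_subset empty_iff power_0 One_nat_def)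
next
  case (Suc b)
  have sub: "{j. lev j = a} \<subseteq> {2 ^ b..<2 ^ Suc b} \<union> {- (2 ^ Suc b)<..- (2 ^ b)}"
  proof
    fix j assume "j \<in> {j. lev j = a}"
    then have "lev j = Suc b" by (simp add: Suc)
    then have "2 ^ b \<le> \<bar>j\<bar>" "\<bar>j\<bar> < 2 ^ Suc b"
      using lev_lower[of j b] lev_upper[of j] by simp_all
    then show "j \<in> {2 ^ b..<2 ^ Suc b} \<union> {- (2 ^ Suc b)<..- (2 ^ b)}" by (cases "0 \<le> j") auto
  qed
  have "card {j. lev j = a} \<le> card ({2 ^ b..<2 ^ Suc b} \<union> {- (2 ^ Suc b)<..- (2 ^ b) :: int})"
    by (intro card_mono sub) auto
  also have "\<dots> \<le> card {2 ^ b..<2 ^ Suc b :: int} + card {- (2 ^ Suc b)<..- (2 ^ b) :: int}"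
    by (rule card_Un_le)
  also have "\<dots> = 2 ^ a" by (simp add: Suc nat_power_eq)
  finally show ?thesis using sub finite_subset by blast
qed

lemma norm_cis_minus_one:
  assumes "pi / 2 \<le> \<bar>\<theta>\<bar>" "\<bar>\<theta>\<bar> \<le> pi"
  shows "1 \<le> norm (cis \<theta> - 1)"
proof -
  have "cos \<bar>\<theta>\<bar> \<le> cos (pi / 2)" using assms by (intro cos_monotone_0_pi_le) auto
  then have c: "cos \<theta> \<le> 0" by (simp add: abs_if split: if_splits)
  have "(norm (cis \<theta> - 1))\<^sup>2 = (cos \<theta> - 1)\<^sup>2 + (sin \<theta>)\<^sup>2" by (simp add: cmod_power2)
  also have "\<dots> = 2 - 2 * cos \<theta>" by (simp add: power2_eq_square algebra_simps)
  finally have "1\<^sup>2 \<le> (norm (cis \<theta> - 1))\<^sup>2" using c by simp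
  then show ?thesis by (rule power2_le_imp_le) simp
qed

text \<open>Steps \<open>h\<^sub>i = 2\<^bsup>-s\<^sub>i-1\<^esup>\<close> turn every frequency of the dyadic block by an angle in \<open>[\<pi>/2, \<pi>]\<close>.\<close>

lemma block_bound:
  fixes f :: "real ^ 'n \<Rightarrow> 'a::{real_normed_field, euclidean_space}" and s :: "'n \<Rightarrow> nat"
  assumes f: "f \<in> HN_ball l r p" and p: "2 \<le> p" and b: "b \<in> Basis" and S: "finite S"
    and blk: "\<And>k i. k \<in> S \<Longrightarrow> lev (k i) = s i"
  shows "(\<Sum>k\<in>S. (norm (fourier (coord b f) k))\<^sup>2) \<le> 2 powr (- 2 * r * real (\<Sum>i\<in>UNIV. s i))"
proof -
  \<comment> \<open>In a coordinate of level 0 the frequency is 0, and a difference of positive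
    order would destroy the coefficient; so differences are taken only in the other
    coordinates.\<close>
  define u where "u = {i. 0 < s i}"
  define t h :: "real ^ 'n" where "t = (\<chi> i. (1 / 2) ^ s i)" and "h = (\<chi> i. (1 / 2) ^ Suc (s i))"
  have cont: "continuous_on UNIV f" and per: "periodic f"
    using f by (auto simp: HN_ball_def HN_space_def Lp_space_def)
  define g where "g = mixed_difference l u h f"
  have contg: "continuous_on UNIV g" unfolding g_def by (rule continuous_mixed_difference[OF cont])
  have "Lp_norm p g \<le> ennreal (\<Prod>i\<in>u. t $ i powr r)"
    unfolding g_def by (rule HN_ball_difference_bound[OF f]) (auto simp: t_def h_def power_le_one)
  also have "(\<Prod>i\<in>u. t $ i powr r) = (\<Prod>i\<in>UNIV. 2 powr (- r * real (s i)))"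
  proof (rule prod.mono_neutral_cong_left)
    fix i
    have "((1 / 2) ^ s i) powr r = (2 powr (- real (s i))) powr r"
      by (simp add: powr_minus powr_realpow power_one_over inverse_eq_divide)
    then show "t $ i powr r = 2 powr (- r * real (s i))" by (simp add: t_def powr_powr mult.commute)
  qed (auto simp: u_def)
  also have "\<dots> = 2 powr (- r * real (\<Sum>i\<in>UNIV. s i))"
    by (simp add: powr_sum[symmetric] sum_distrib_left sum_negf)
  finally have "(\<integral>x. (norm (g x))\<^sup>2 \<partial>cube) \<le> (2 powr (- r * real (\<Sum>i\<in>UNIV. s i)))\<^sup>2"
    by (intro Lp_norm_square[OF contg p]) auto
  also have "(2 powr (- r * real (\<Sum>i\<in>UNIV. s i)))\<^sup>2 = 2 powr (- 2 * r * real (\<Sum>i\<in>UNIV. s i))"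
    by (simp add: power2_eq_square powr_add[symmetric] algebra_simps)
  finally have L2: "(\<integral>x. (norm (g x))\<^sup>2 \<partial>cube) \<le> 2 powr (- 2 * r * real (\<Sum>i\<in>UNIV. s i))" .
  have "(\<Sum>k\<in>S. (norm (fourier (coord b f) k))\<^sup>2) \<le> (\<Sum>k\<in>S. (norm (fourier (coord b g) k))\<^sup>2)"
  proof (intro sum_mono power_mono)
    fix k assume k: "k \<in> S"
    have "1 \<le> norm (expi k (axis i (h $ i)) - 1)" if "i \<in> u" for i
    proof -
      obtain a where a: "s i = Suc a" using \<open>i \<in> u\<close> by (cases "s i") (auto simp: u_def)
      have "2 ^ a \<le> \<bar>k i\<bar>" "\<bar>k i\<bar> < 2 ^ Suc a"
        using lev_lower[of "k i" a] lev_upper[of "k i"] blk[OF k, of i] a by simp_all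
      then have "real_of_int (2 ^ a) \<le> real_of_int \<bar>k i\<bar>" "real_of_int \<bar>k i\<bar> \<le> real_of_int (2 ^ Suc a)"
        by (simp_all only: of_int_le_iff)
      then have "(2 :: real) ^ a \<le> \<bar>of_int (k i)\<bar>" "\<bar>of_int (k i)\<bar> \<le> (2::real) ^ Suc a"
        by simp_all
      then have "1 / 4 \<le> \<bar>of_int (k i) * h $ i\<bar>" "\<bar>of_int (k i) * h $ i\<bar> \<le> 1 / 2"
        by (simp_all add: h_def a abs_mult power_one_over field_simps)
      then have "2 * pi * (1 / 4) \<le> 2 * pi * \<bar>of_int (k i) * h $ i\<bar>" "2 * pi * \<bar>of_int (k i) * h $ i\<bar> \<le> 2 * pi * (1 / 2)"
        by (intro mult_left_mono; simp)+
      then show ?thesis unfolding expi_def phase_axis by (intro norm_cis_minus_one) (simp_all add: abs_mult)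
    qed
    then have "1 \<le> (\<Prod>i\<in>u. norm (expi k (axis i (h $ i)) - 1) ^ l)"
      by (intro prod_ge_1 one_le_power)
    then have "1 * norm (fourier (coord b f) k) \<le> (\<Prod>i\<in>u. norm (expi k (axis i (h $ i)) - 1) ^ l) * norm (fourier (coord b f) k)"
      by (rule mult_right_mono) simp
    then show "norm (fourier (coord b f) k) \<le> norm (fourier (coord b g) k)"
      unfolding g_def fourier_mixed_difference[OF cont per]
      by (simp add: norm_mult prod_norm[symmetric] norm_power)
  qed simp
  also have "\<dots> \<le> (\<integral>x. (norm (coord b g x))\<^sup>2 \<partial>cube)"
    by (intro bessel S) (auto simp: coord_def intro!: continuous_intros contg)
  also have "\<dots> \<le> (\<integral>x. (norm (g x))\<^sup>2 \<partial>cube)"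
    by (intro integral_mono integrable_cube_continuous continuous_intros power_mono)
      (auto simp: coord_def Basis_le_norm[OF b] intro!: continuous_intros contg)
  also note L2
  finally show ?thesis .
qed

section \<open>Trigonometric polynomials and a positive kernel\<close>

definition trig_poly :: "(real ^ 'n \<Rightarrow> complex) \<Rightarrow> bool" where
  "trig_poly f \<longleftrightarrow> (\<exists>S c. finite S \<and> f = (\<lambda>x. \<Sum>k\<in>S. c k * expi k x))"

lemma trig_poly_mult:
  fixes f g :: "real ^ 'n \<Rightarrow> complex"
  assumes "trig_poly f" "trig_poly g"
  shows "trig_poly (\<lambda>x. f x * g x)"
proof -
  obtain S c where S: "finite S" "f = (\<lambda>x. \<Sum>k\<in>S. c k * expi k x)" using assms(1) unfolding trig_poly_def by blast
  obtain T d where T: "finite T" "g = (\<lambda>x. \<Sum>k\<in>T. d k * expi k x)" using assms(2) unfolding trig_poly_def by blast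
  define add where "add = (\<lambda>(a :: 'n \<Rightarrow> int, b) i. a i + b i)"
  have "f x * g x = (\<Sum>k\<in>add ` (S \<times> T). (\<Sum>(a, b)\<in>{z \<in> S \<times> T. add z = k}. c a * d b) * expi k x)" for x
  proof -
    have "f x * g x = (\<Sum>(a, b)\<in>S \<times> T. c a * d b * expi (add (a, b)) x)"
      by (simp add: S T sum_product sum.cartesian_product add_def expi_add_freq mult_ac)
    also have "\<dots> = (\<Sum>k\<in>add ` (S \<times> T). \<Sum>(a, b)\<in>{z \<in> S \<times> T. add z = k}. c a * d b * expi (add (a, b)) x)"
      using S T by (intro sum.image_gen) auto
    also have "\<dots> = (\<Sum>k\<in>add ` (S \<times> T). \<Sum>(a, b)\<in>{z \<in> S \<times> T. add z = k}. c a * d b * expi k x)"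
      by (intro sum.cong refl) auto
    finally show ?thesis by (simp add: sum_distrib_right case_prod_beta)
  qed
  then show ?thesis unfolding trig_poly_def using S T
    by (intro exI[of _ "add ` (S \<times> T)"] exI[of _ "\<lambda>k. \<Sum>(a, b)\<in>{z \<in> S \<times> T. add z = k}. c a * d b"]) auto
qed

lemma trig_poly_one: "trig_poly (\<lambda>_. 1)"
  unfolding trig_poly_def by (intro exI[of _ "{\<lambda>_. 0}"] exI[of _ "\<lambda>_. 1"]) (simp add: expi_zero_freq)

lemma trig_poly_prod:
  assumes "finite A" "\<And>i. i \<in> A \<Longrightarrow> trig_poly (f i)"
  shows "trig_poly (\<lambda>x. \<Prod>i\<in>A. f i x)"
  using assms by (induction A) (simp_all add: trig_poly_one trig_poly_mult)

lemma trig_poly_power: "trig_poly f \<Longrightarrow> trig_poly (\<lambda>x. f x ^ N)"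
  by (induction N) (simp_all add: trig_poly_one trig_poly_mult)

text \<open>Up to normalization the de la Vallee Poussin kernel, the product of cos(pi x_i)^(2N): a
  nonnegative trigonometric polynomial that concentrates at the integer lattice as N grows.\<close>

definition fejer :: "nat \<Rightarrow> real ^ 'n \<Rightarrow> real" where
  "fejer N x = (\<Prod>i\<in>UNIV. ((1 + cos (2 * pi * x $ i)) / 2) ^ N)"

lemma trig_poly_fejer: "trig_poly (\<lambda>x. of_real (fejer N x))"
proof -
  have "trig_poly (\<lambda>x. of_real ((1 + cos (2 * pi * x $ i)) / 2))" for i :: 'a
  proof -
    define \<delta> where "\<delta> = (\<lambda>j. of_bool (j = i) :: int)"
    define z where "z = (\<lambda>_::'a. 0::int)"
    have ph: "phase \<delta> x = 2 * pi * x $ i" for x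
    proof -
      have "(\<Sum>j\<in>UNIV. of_int (\<delta> j) * x $ j) = (\<Sum>j\<in>UNIV. if j = i then x $ j else 0)"
        by (rule sum.cong) (auto simp: \<delta>_def)
      then show ?thesis by (simp add: phase_def)
    qed
    have "complex_of_real ((1 + cos (2 * pi * x $ i)) / 2)
        = 1 / 2 * expi z x + 1 / 4 * expi \<delta> x + 1 / 4 * expi (\<lambda>j. - \<delta> j) x" for x
      unfolding expi_uminus_freq z_def expi_zero_freq expi_def ph
      by (simp add: complex_eq_iff)
    \<comment> \<open>The three frequencies must be distinct for the sum over the set to have three
      terms.\<close>
    moreover have "z \<noteq> \<delta>" "z \<noteq> (\<lambda>j. - \<delta> j)" "\<delta> \<noteq> (\<lambda>j. - \<delta> j)"
      by (auto simp: z_def \<delta>_def dest!: fun_cong[of _ _ i])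
    ultimately have "(\<lambda>x. complex_of_real ((1 + cos (2 * pi * x $ i)) / 2))
        = (\<lambda>x. \<Sum>k\<in>{z, \<delta>, \<lambda>j. - \<delta> j}. (if k = z then 1 / 2 else 1 / 4) * expi k x)"
      by (intro ext) (simp add: eq_commute[of \<delta> z] eq_commute[of _ z])
    then show ?thesis unfolding trig_poly_def
      by (intro exI[of _ "{z, \<delta>, \<lambda>j. - \<delta> j}"] exI[of _ "\<lambda>k. if k = z then 1 / 2 else 1 / 4"] conjI) simp
  qed
  then show ?thesis
    unfolding fejer_def by (simp only: of_real_prod of_real_power) (intro trig_poly_prod trig_poly_power; simp)
qed

section \<open>Approximation by Fejer-type means\<close>

lemma periodic_int_vec:
  assumes "periodic f"
  shows "f (x + (\<chi> i. of_int (m i))) = f x"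
proof -
  have "f (x + (\<Sum>i\<in>A. axis i (of_int (m i)))) = f x" if "finite A" for A
    using that
  proof (induction A)
    case (insert i A)
    have "f (x + (\<Sum>i\<in>insert i A. axis i (of_int (m i)))) = f (x + (\<Sum>i\<in>A. axis i (of_int (m i))) + axis i (of_int (m i)))"
      using insert by (intro arg_cong[of _ _ f]) (simp add: algebra_simps)
    also have "\<dots> = f (x + (\<Sum>i\<in>A. axis i (of_int (m i))))" by (rule periodic_int[OF assms])
    finally show ?case using insert by simp
  qed simp
  moreover have "(\<Sum>i\<in>UNIV. axis i (of_int (m i))) = (\<chi> i. real_of_int (m i))"
    by (simp add: vec_eq_iff axis_def)
  ultimately show ?thesis by (metis finite_class.finite_UNIV)
qed

lemma half_one_plus_cos: "0 \<le> (1 + cos y) / 2" "(1 + cos y) / 2 \<le> 1" for y :: real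
proof -
  have "0 \<le> (1 + c) / 2 \<and> (1 + c) / 2 \<le> 1" if "-1 \<le> c" "c \<le> 1" for c :: real
    using that by simp
  then show "0 \<le> (1 + cos y) / 2" "(1 + cos y) / 2 \<le> 1"
    using cos_ge_minus_one[of y] cos_le_one[of y] by blast+
qed

lemma fejer_nonneg: "0 \<le> fejer N x"
  unfolding fejer_def
proof (intro prod_nonneg zero_le_power)
  fix i
  show "0 \<le> (1 + cos (2 * pi * x $ i)) / 2" by (rule half_one_plus_cos)
qed

lemma continuous_fejer [continuous_intros]: "continuous_on S (fejer N)"
  unfolding fejer_def by (intro continuous_intros) auto

lemma fejer_far:
  assumes "0 < \<delta>" "\<delta> \<le> 1 / 2" and z: "\<delta> \<le> \<bar>x $ i - of_int z\<bar>" "\<bar>x $ i - of_int z\<bar> \<le> 1 / 2"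
  shows "fejer N x \<le> ((1 + cos (2 * pi * \<delta>)) / 2) ^ N"
proof -
  let ?g = "\<lambda>i. ((1 + cos (2 * pi * x $ i)) / 2) ^ N"
  have g: "0 \<le> ?g i" "?g i \<le> 1" for i
  proof -
    show "0 \<le> ?g i" "?g i \<le> 1" by (intro power_le_one zero_le_power half_one_plus_cos)+
  qed
  have "cos (2 * pi * x $ i) = cos (2 * pi * x $ i - 2 * pi * of_int z)"
    by (simp add: cos_diff)
  also have "\<dots> = cos (2 * pi * (x $ i - of_int z))" by (simp add: algebra_simps)
  also have "\<dots> = cos (2 * pi * \<bar>x $ i - of_int z\<bar>)" by (cases "0 \<le> x $ i - of_int z") (auto simp: algebra_simps cos_diff)
  also have "\<dots> \<le> cos (2 * pi * \<delta>)"
    using assms by (intro cos_monotone_0_pi_le) auto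
  finally have "?g i \<le> ((1 + cos (2 * pi * \<delta>)) / 2) ^ N"
    by (intro power_mono half_one_plus_cos) auto
  moreover have "fejer N x = ?g i * (\<Prod>j\<in>UNIV - {i}. ?g j)"
    unfolding fejer_def by (rule prod.remove) auto
  moreover have "(\<Prod>j\<in>UNIV - {i}. ?g j) \<le> 1" using g by (intro prod_le_1) auto
  ultimately show ?thesis using mult_left_mono[of "\<Prod>j\<in>UNIV - {i}. ?g j" 1 "?g i"] g(1)[of i] by simp
qed

text \<open>Bounds the normalizing constant from below by the contribution of a small cube at the
  origin. For small \<eta> this bound decays more slowly in N than the kernel does away from the
  lattice.\<close>

lemma fejer_mass:
  assumes \<eta>: "0 < \<eta>" "\<eta> \<le> 1 / 2"
  shows "(((1 + cos (2 * pi * \<eta>)) / 2) ^ CARD('n)) ^ N * \<eta> ^ CARD('n) \<le> (\<integral>x. fejer N x \<partial>(cube :: (real ^ 'n) measure))"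
proof -
  interpret finite_measure "cube :: (real ^ 'n) measure" by (rule finite_measure_cube)
  define A :: "(real ^ 'n) set" where "A = cbox 0 (\<chi> i. \<eta>)"
  define c where "c = (((1 + cos (2 * pi * \<eta>)) / 2) ^ CARD('n)) ^ N"
  have sub: "A \<subseteq> cbox 0 1"
  proof
    fix x assume "x \<in> A"
    then have x: "0 \<le> x $ i" "x $ i \<le> \<eta>" for i by (auto simp: A_def mem_box_cart)
    then show "x \<in> cbox 0 1" using \<eta> order_trans[OF x(2), of 1] by (simp add: mem_box_cart)
  qed
  have "measure cube A = measure lborel A"
    using sub by (subst measure_restrict_space) (auto simp: A_def)
  also have "\<dots> = \<eta> ^ CARD('n)"
    unfolding A_def using \<eta> by (subst content_cbox_cart) (auto simp: interval_eq_empty_cart not_less less_imp_le)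
  finally have mA: "measure cube A = \<eta> ^ CARD('n)" .
  have Aset: "A \<in> sets cube"
    using sub by (simp add: A_def sets_restrict_space image_iff) (metis Int_absorb1 inf_commute lborelD sets_completionI_sets sets_lborel borel_closed closed_cbox)
  have "c * \<eta> ^ CARD('n) = (\<integral>x. c * indicator A x \<partial>cube)"
    using sub by (simp add: mA Int_absorb2 Int_absorb1)
  also have "\<dots> \<le> (\<integral>x. fejer N x \<partial>(cube :: (real ^ 'n) measure))"
  proof (rule integral_mono)
    show "integrable cube (\<lambda>x. c * indicator A x)"
      using Aset by (intro integrable_mult_right integrable_indicator) (auto simp: emeasure_eq_measure)
    show "integrable cube (fejer N)" by (intro integrable_cube_continuous continuous_intros)
    show "c * indicator A x \<le> fejer N x" for x
    proof (cases "x \<in> A")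
      case True
      have "c = (\<Prod>i\<in>(UNIV :: 'n set). ((1 + cos (2 * pi * \<eta>)) / 2) ^ N)"
        by (simp add: c_def power_mult[symmetric] mult.commute)
      also have "\<dots> \<le> fejer N x"
        unfolding fejer_def
      proof (intro prod_mono conjI power_mono zero_le_power)
        fix i :: 'n
        show "0 \<le> (1 + cos (2 * pi * \<eta>)) / 2" by (rule half_one_plus_cos)
        have "0 \<le> x $ i" "x $ i \<le> \<eta>" using True by (auto simp: A_def mem_box_cart)
        then have "cos (2 * pi * \<eta>) \<le> cos (2 * pi * x $ i)"
          using \<eta> by (intro cos_monotone_0_pi_le) auto
        then show "(1 + cos (2 * pi * \<eta>)) / 2 \<le> (1 + cos (2 * pi * x $ i)) / 2" by simp
        show "0 \<le> (1 + cos (2 * pi * \<eta>)) / 2" by fact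
      qed
      finally show ?thesis using True by simp
    qed (simp add: fejer_nonneg)
  qed
  finally show ?thesis by (simp add: c_def)
qed

text \<open>A nonnegative kernel has no Fourier coefficient larger than its mass. So the convolution
  means shrink the coefficients of \<open>F\<close> and inherit every bound on blocks, while uniform
  convergence follows from continuity alone.\<close>

lemma fejer_approx:
  fixes F :: "real ^ 'n \<Rightarrow> real"
  assumes cont: "continuous_on UNIV F" and per: "periodic F" and \<epsilon>: "0 < \<epsilon>"
  shows "\<exists>S w. finite S \<and> (\<forall>k. norm (w k) \<le> norm (fourier (\<lambda>x. of_real (F x)) k)) \<and>
    (\<forall>y\<in>cbox 0 1. norm (of_real (F y) - (\<Sum>k\<in>S. w k * expi k y)) \<le> \<epsilon>)"
proof -
  have "compact (F ` cbox 0 1)"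
    by (intro compact_continuous_image continuous_on_subset[OF cont]) auto
  then obtain B where B: "0 < B" "\<And>x. x \<in> cbox 0 1 \<Longrightarrow> \<bar>F x\<bar> \<le> B"
    unfolding bounded_pos[THEN iffD1, OF compact_imp_bounded] by (metis bounded_pos compact_imp_bounded image_eqI real_norm_def)
  \<comment> \<open>The enlarged box contains the lattice translate of x nearest to y, which lies
    within 1/2 of y in every coordinate.\<close>
  have "uniformly_continuous_on (cbox (-1) (\<chi> i. 2)) F"
    by (intro compact_uniformly_continuous continuous_on_subset[OF cont]) auto
  then obtain \<delta>0 where \<delta>0: "0 < \<delta>0" and uc: "\<And>x y. x \<in> cbox (-1) (\<chi> i. 2) \<Longrightarrow> y \<in> cbox (-1) (\<chi> i. 2) \<Longrightarrow>
      dist y x < \<delta>0 \<Longrightarrow> \<bar>F y - F x\<bar> < \<epsilon> / 2"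
    unfolding uniformly_continuous_on_def using \<epsilon> by (metis dist_real_def half_gt_zero)
  \<comment> \<open>If all coordinates are below \<delta>, the norm is below \<delta>0 by comparison
    with the sum of the coordinates. The cap 1/2 is the largest possible distance to an
    integer.\<close>
  define \<delta> where "\<delta> = min (\<delta>0 / (CARD('n) + 1)) (1 / 2)"
  have \<delta>: "0 < \<delta>" "\<delta> \<le> 1 / 2" using \<delta>0 unfolding \<delta>_def by (simp, intro min.cobounded2)
  define q where "q = (1 + cos (2 * pi * \<delta>)) / 2"
  have q: "0 \<le> q" "q < 1"
  proof -
    show "0 \<le> q" unfolding q_def by (rule half_one_plus_cos)
    have "cos (2 * pi * \<delta>) < cos 0" using \<delta> by (intro cos_monotone_0_pi) auto
    then show "q < 1" by (simp add: q_def)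
  qed
  \<comment> \<open>As \<eta> tends to 0, the base in \<open>fejer_mass\<close> tends to 1 and so
    exceeds \<open>q\<close>, the base of the decay away from the lattice.\<close>
  have "((\<lambda>\<eta>. ((1 + cos (2 * pi * \<eta>)) / 2) ^ CARD('n)) \<longlongrightarrow> ((1 + cos (2 * pi * 0)) / 2) ^ CARD('n)) (at_right (0::real))"
    by (intro tendsto_intros) simp
  then have "\<forall>\<^sub>F \<eta> in at_right 0. q < ((1 + cos (2 * pi * \<eta>)) / 2) ^ CARD('n)"
    using q by (intro order_tendstoD) auto
  then have "\<forall>\<^sub>F \<eta> in at_right 0. q < ((1 + cos (2 * pi * \<eta>)) / 2) ^ CARD('n) \<and> \<eta> < 1 / 2 \<and> 0 < \<eta>"
    using eventually_at_right_real[of 0 "1/2", OF zero_less_divide_1_iff[THEN iffD2], OF zero_less_numeral]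
    by eventually_elim auto
  then obtain \<eta> where \<eta>: "0 < \<eta>" "\<eta> \<le> 1 / 2" and qe: "q < ((1 + cos (2 * pi * \<eta>)) / 2) ^ CARD('n)"
    using eventually_happens[of _ "at_right (0::real)"] by (force simp: trivial_limit_at_right_real)
  define qe where "qe = ((1 + cos (2 * pi * \<eta>)) / 2) ^ CARD('n)"
  have qe0: "0 < qe" and qqe: "q / qe < 1" using q qe by (auto simp: qe_def)
  have "(\<lambda>N. 2 * B * (q / qe) ^ N / \<eta> ^ CARD('n)) \<longlonglongrightarrow> 2 * B * 0 / \<eta> ^ CARD('n)"
    using q qe0 qqe \<eta> by (intro tendsto_intros LIMSEQ_realpow_zero) auto
  then have "\<forall>\<^sub>F N in sequentially. 2 * B * (q / qe) ^ N / \<eta> ^ CARD('n) < \<epsilon> / 2"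
    using \<epsilon> by (intro order_tendstoD) auto
  then obtain N where N: "2 * B * (q / qe) ^ N / \<eta> ^ CARD('n) < \<epsilon> / 2"
    by (auto simp: eventually_sequentially)
  obtain S c where S: "finite S" and c: "\<And>x. complex_of_real (fejer N x) = (\<Sum>k\<in>S. c k * expi k (x :: real ^ 'n))"
    using trig_poly_fejer[of N, where 'a = 'n] unfolding trig_poly_def by (metis (mono_tags))
  define m where "m = (\<integral>x. fejer N x \<partial>(cube :: (real ^ 'n) measure))"
  have m: "qe ^ N * \<eta> ^ CARD('n) \<le> m" unfolding m_def qe_def by (rule fejer_mass[OF \<eta>])
  have m0: "0 < m" using m qe0 \<eta> by (metis less_le_trans mult_pos_pos zero_less_power)
  \<comment> \<open>Continued by 0 outside \<open>S\<close>, the coefficients are the Fourier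
    coefficients of the kernel at every frequency.\<close>
  define c' where "c' = (\<lambda>k. if k \<in> S then c k else 0)"
  have c'_eq: "c' k = (\<integral>x. of_real (fejer N x) * cnj (expi k x) \<partial>cube)" for k :: "'n \<Rightarrow> int"
    unfolding c'_def fourier_trig_poly[OF S, symmetric] c by (simp add: fourier_def)
  have c'0: "c' (\<lambda>_. 0) = of_real m"
    unfolding c'_eq expi_zero_freq m_def by simp
  have c'_le: "norm (c' k) \<le> m" for k :: "'n \<Rightarrow> int"
  proof -
    have "norm (c' k) \<le> (\<integral>x. norm (of_real (fejer N x) * cnj (expi k x)) \<partial>cube)"
      unfolding c'_eq by (rule integral_norm_bound)
    then show ?thesis by (simp add: norm_mult fejer_nonneg m_def)
  qed
  have conv: "(\<integral>x. f x * of_real (fejer N (y - x)) \<partial>cube) = (\<Sum>k\<in>S. c k * fourier f k * expi k y)"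
    if f: "continuous_on UNIV f" for f :: "real ^ 'n \<Rightarrow> complex" and y
  proof -
    have "expi k (y - x) = expi k y * cnj (expi k x)" for k :: "'n \<Rightarrow> int" and x
      using cis_mult[of "phase k y" "- phase k x"] by (simp add: expi_def phase_diff cis_cnj)
    then have "(\<integral>x. f x * of_real (fejer N (y - x)) \<partial>cube) = (\<integral>x. (\<Sum>k\<in>S. (c k * expi k y) * (f x * cnj (expi k x))) \<partial>cube)"
      by (simp only: c sum_distrib_left) (simp add: mult_ac)
    also have "\<dots> = (\<Sum>k\<in>S. (c k * expi k y) * fourier f k)"
      unfolding fourier_def
      by (subst Bochner_Integration.integral_sum) (auto intro!: integrable_cube_continuous continuous_intros f)
    finally show ?thesis by (simp add: mult_ac)
  qed
  define fF where "fF = (\<lambda>x. complex_of_real (F x))"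
  have contfF: "continuous_on UNIV fF" unfolding fF_def by (intro continuous_intros cont)
  define w where "w = (\<lambda>k. c' k / of_real m * fourier fF k)"
  have wF: "norm (w k) \<le> norm (fourier fF k)" for k
  proof -
    have "norm (w k) = norm (c' k) / m * norm (fourier fF k)"
      using m0 by (simp add: w_def norm_mult norm_divide)
    also have "\<dots> \<le> 1 * norm (fourier fF k)"
      using c'_le[of k] m0 by (intro mult_right_mono) auto
    finally show ?thesis by simp
  qed
  \<comment> \<open>The mass of the reflected and translated kernel is read off from the convolution
    formula for the constant function 1.\<close>
  have mass: "(\<integral>x. fejer N (y - x) \<partial>cube) = m" for y :: "real ^ 'n"
  proof -
    have "complex_of_real (\<integral>x. fejer N (y - x) \<partial>cube) = (\<integral>x. 1 * of_real (fejer N (y - x)) \<partial>cube)"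
      by simp
    also have "\<dots> = (\<Sum>k\<in>S. c k * fourier (\<lambda>_. 1) k * expi k y)" by (rule conv) (intro continuous_intros)
    also have "\<dots> = (\<Sum>k\<in>S. if k = (\<lambda>_. 0) then c k else 0)"
    proof (intro sum.cong refl)
      fix k :: "'n \<Rightarrow> int"
      have "fourier (\<lambda>_. 1) k = of_bool (k = (\<lambda>_. 0))"
        using integral_expi_expi[of "\<lambda>_. 0" k] by (auto simp: fourier_def expi_zero_freq eq_commute)
      then show "c k * fourier (\<lambda>_. 1) k * expi k y = (if k = (\<lambda>_. 0) then c k else 0)"
        by (simp add: expi_zero_freq)
    qed
    also have "\<dots> = c' (\<lambda>_. 0)" using S by (simp add: c'_def)
    finally show ?thesis using c'0 by simp
  qed
  have shiftcont: "continuous_on UNIV (\<lambda>x. fejer N (y - x))" for y :: "real ^ 'n"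
    by (rule continuous_on_compose2[of UNIV "fejer N"]) (auto intro!: continuous_intros)
  have approx: "norm (of_real (F y) - (\<Sum>k\<in>S. w k * expi k y)) \<le> \<epsilon>" if y: "y \<in> cbox 0 1" for y
  proof -
    have pw: "\<bar>F y - F x\<bar> * fejer N (y - x) \<le> \<epsilon> / 2 * fejer N (y - x) + 2 * B * q ^ N" if x: "x \<in> cbox 0 1" for x
    proof -
      define z where "z = (\<lambda>i. round ((y - x) $ i))"
      have zle: "\<bar>(y - x) $ i - of_int (z i)\<bar> \<le> 1 / 2" for i
        using of_int_round_abs_le[of "(y - x) $ i"] by (simp add: z_def abs_minus_commute)
      define x' where "x' = x + (\<chi> i. of_int (z i))"
      have Fx: "F x' = F x" unfolding x'_def by (rule periodic_int_vec[OF per])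
      have diff: "(y - x') $ i = (y - x) $ i - of_int (z i)" for i by (simp add: x'_def)
      show ?thesis
      proof (cases "\<forall>i. \<bar>(y - x') $ i\<bar> < \<delta>")
        case True
        have "norm (y - x') \<le> (\<Sum>i\<in>UNIV. \<bar>(y - x') $ i\<bar>)" by (rule norm_le_l1_cart)
        also have "\<dots> \<le> (\<Sum>i\<in>(UNIV :: 'n set). \<delta>0 / (CARD('n) + 1))"
          using True by (intro sum_mono less_imp_le) (auto simp: \<delta>_def)
        also have "\<dots> < \<delta>0" using \<delta>0 by (simp add: field_simps)
        finally have d: "dist y x' < \<delta>0" by (simp add: dist_norm)
        have "x' \<in> cbox (-1) (\<chi> i. 2)"
          unfolding mem_box_cart
        proof
          fix i
          have "\<bar>y $ i - x' $ i\<bar> \<le> 1 / 2" using zle[of i] unfolding diff[symmetric] by simp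
          moreover have "0 \<le> y $ i" "y $ i \<le> 1" using y by (auto simp: mem_box_cart)
          ultimately have "-1 \<le> x' $ i" "x' $ i \<le> 2" unfolding abs_le_iff by linarith+
          then show "(- 1) $ i \<le> x' $ i \<and> x' $ i \<le> (\<chi> i. 2) $ i" by simp
        qed
        moreover have "y \<in> cbox (-1) (\<chi> i. 2)"
          unfolding mem_box_cart
        proof
          fix i
          have "0 \<le> y $ i" "y $ i \<le> 1" using y by (auto simp: mem_box_cart)
          then show "(- 1) $ i \<le> y $ i \<and> y $ i \<le> (\<chi> i. 2) $ i" by simp
        qed
        ultimately have "\<bar>F y - F x\<bar> \<le> \<epsilon> / 2" using uc d Fx by fastforce
        then have "\<bar>F y - F x\<bar> * fejer N (y - x) \<le> \<epsilon> / 2 * fejer N (y - x)"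
          by (rule mult_right_mono) (rule fejer_nonneg)
        moreover have "0 \<le> 2 * B * q ^ N" using B q by simp
        ultimately show ?thesis by linarith
      next
        case False
        then obtain i where "\<delta> \<le> \<bar>(y - x) $ i - of_int (z i)\<bar>" unfolding diff by (meson not_less)
        then have "fejer N (y - x) \<le> q ^ N"
          unfolding q_def using fejer_far[OF \<delta>] zle by blast
        moreover have "\<bar>F y - F x\<bar> \<le> 2 * B" using B(2)[OF x] B(2)[OF y] by linarith
        ultimately have "\<bar>F y - F x\<bar> * fejer N (y - x) \<le> (2 * B) * q ^ N"
          using B by (intro mult_mono) (auto simp: fejer_nonneg)
        moreover have "0 \<le> \<epsilon> / 2 * fejer N (y - x)" using \<epsilon> fejer_nonneg[of N "y - x"] by simp
        ultimately show ?thesis by linarith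
      qed
    qed
    have int: "integrable cube (\<lambda>x. (F y - F x) * fejer N (y - x))"
      by (intro integrable_cube_continuous continuous_intros cont shiftcont)
    have intf: "integrable cube (\<lambda>x. fejer N (y - x))"
      by (intro integrable_cube_continuous shiftcont)
    have "(\<Sum>k\<in>S. w k * expi k y) = (\<Sum>k\<in>S. c k * fourier fF k * expi k y) / of_real m"
      unfolding sum_divide_distrib by (intro sum.cong refl) (simp add: w_def c'_def)
    also have "\<dots> = (\<integral>x. of_real (F x * fejer N (y - x)) \<partial>cube) / of_real m"
      using conv[OF contfF, of y] by (simp add: fF_def)
    also have "\<dots> = of_real ((\<integral>x. F x * fejer N (y - x) \<partial>cube) / m)"
      by (simp only: integral_complex_of_real of_real_divide)
    finally have "of_real (F y) - (\<Sum>k\<in>S. w k * expi k y) = complex_of_real (F y - (\<integral>x. F x * fejer N (y - x) \<partial>cube) / m)"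
      by simp
    also have "F y - (\<integral>x. F x * fejer N (y - x) \<partial>cube) / m = (\<integral>x. (F y - F x) * fejer N (y - x) \<partial>cube) / m"
    proof -
      have "(\<integral>x. (F y - F x) * fejer N (y - x) \<partial>cube) = F y * m - (\<integral>x. F x * fejer N (y - x) \<partial>cube)"
        unfolding mass[of y, symmetric] left_diff_distrib
        by (subst Bochner_Integration.integral_diff) (auto intro!: integrable_cube_continuous continuous_intros cont shiftcont)
      then show ?thesis using m0 by (simp add: field_simps)
    qed
    finally have "norm (of_real (F y) - (\<Sum>k\<in>S. w k * expi k y)) = \<bar>\<integral>x. (F y - F x) * fejer N (y - x) \<partial>cube\<bar> / m"
      using m0 by (simp del: of_real_diff of_real_divide)
    also have "\<bar>\<integral>x. (F y - F x) * fejer N (y - x) \<partial>cube\<bar> \<le> (\<integral>x. \<bar>(F y - F x) * fejer N (y - x)\<bar> \<partial>cube)"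
      using integral_norm_bound[of cube "\<lambda>x. (F y - F x) * fejer N (y - x)"] by simp
    also have "\<dots> \<le> (\<integral>x. \<epsilon> / 2 * fejer N (y - x) + 2 * B * q ^ N \<partial>cube)"
      using pw by (intro integral_mono integrable_abs int Bochner_Integration.integrable_add integrable_mult_right intf)
        (auto simp: abs_mult fejer_nonneg intro!: integrable_cube_continuous continuous_intros)
    also have "\<dots> = \<epsilon> / 2 * m + 2 * B * q ^ N"
    proof -
      have const: "integrable (cube :: (real ^ 'n) measure) (\<lambda>x. 2 * B * q ^ N)"
        by (intro integrable_cube_continuous continuous_intros)
      show ?thesis
        unfolding Bochner_Integration.integral_add[OF integrable_mult_right[OF intf] const]
          integral_mult_right_zero mass integral_cube_const ..
    qed
    finally have "norm (of_real (F y) - (\<Sum>k\<in>S. w k * expi k y)) \<le> (\<epsilon> / 2 * m + 2 * B * q ^ N) / m"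
      using m0 by (simp add: divide_right_mono)
    also have "\<dots> = \<epsilon> / 2 + 2 * B * q ^ N / m" using m0 by (simp add: field_simps)
    also have "2 * B * q ^ N / m \<le> 2 * B * q ^ N / (qe ^ N * \<eta> ^ CARD('n))"
      using m m0 q B qe0 \<eta> by (intro divide_left_mono) auto
    also have "\<dots> = 2 * B * (q / qe) ^ N / \<eta> ^ CARD('n)" by (simp add: power_divide)
    also have "\<dots> \<le> \<epsilon> / 2" using N by simp
    finally show ?thesis by simp
  qed
  show ?thesis using S wF approx unfolding fF_def by (intro exI[of _ S] exI[of _ w]) auto
qed

section \<open>The Hartley basis and dyadic blocks\<close>

text \<open>Hartley functions: a real orthonormal system with exactly one member per integer
  frequency, so that the real matrices of the barrier argument apply without pairing sines and
  cosines.\<close>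

definition cas :: "('n::finite \<Rightarrow> int) \<Rightarrow> real ^ 'n \<Rightarrow> real" where
  "cas k x = cos (phase k x) + sin (phase k x)"

lemma continuous_cas [continuous_intros]: "continuous_on S (cas k)"
  unfolding cas_def by (intro continuous_intros)

lemma cas_eq_expi: "cas k x = Re (expi k x) + Im (expi k x)"
  by (simp add: cas_def expi_def)

lemma periodic_cas: "periodic (cas k)"
  using periodic_expi[of k] by (simp add: periodic_def cas_eq_expi)

lemma abs_cas_le: "\<bar>cas k x\<bar> \<le> 2"
proof -
  have "\<bar>cos (phase k x)\<bar> \<le> 1" "\<bar>sin (phase k x)\<bar> \<le> 1" by (rule abs_cos_le_one abs_sin_le_one)+
  then show ?thesis unfolding cas_def by linarith
qed

lemma integral_cas_cas: "(\<integral>x. cas j x * cas k x \<partial>cube) = of_bool (j = k)"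
proof -
  \<comment> \<open>The product is cos(phase j - phase k) + sin(phase j + phase k); the sine term
    integrates to 0 also for j = -k.\<close>
  have "cas j x * cas k x = Re (expi j x * cnj (expi k x)) + Im (expi (\<lambda>i. j i + k i) x)" for x
    by (simp add: cas_def expi_def phase_add_freq sin_add algebra_simps)
  then have "(\<integral>x. cas j x * cas k x \<partial>cube)
      = (\<integral>x. Re (expi j x * cnj (expi k x)) \<partial>cube) + (\<integral>x. Im (expi (\<lambda>i. j i + k i) x) \<partial>cube)"
    by (simp only:) (intro Bochner_Integration.integral_add integrable_cube_continuous continuous_intros)
  also have "(\<integral>x. Re (expi j x * cnj (expi k x)) \<partial>cube) = Re (of_bool (j = k))"
    unfolding integral_expi_expi[symmetric] by (intro integral_Re integrable_cube_continuous continuous_intros)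
  also have "(\<integral>x. Im (expi (\<lambda>i. j i + k i) x) \<partial>cube) = Im (of_bool ((\<lambda>i. j i + k i) = (\<lambda>_. 0)))"
    unfolding integral_expi[symmetric] by (intro integral_Im integrable_cube_continuous continuous_intros)
  finally show ?thesis by simp
qed

lemma integral_cas_sum_square:
  assumes "finite I"
  shows "(\<integral>x. (\<Sum>k\<in>I. e k * cas k x)\<^sup>2 \<partial>cube) = (\<Sum>k\<in>I. (e k)\<^sup>2)"
proof -
  have "(\<integral>x. (\<Sum>k\<in>I. e k * cas k x)\<^sup>2 \<partial>cube) = (\<integral>x. (\<Sum>j\<in>I. \<Sum>k\<in>I. (e j * e k) * (cas j x * cas k x)) \<partial>cube)"
    by (simp add: power2_eq_square sum_product mult_ac)
  also have "\<dots> = (\<Sum>j\<in>I. \<Sum>k\<in>I. (e j * e k) * (\<integral>x. cas j x * cas k x \<partial>cube))"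
    by (subst Bochner_Integration.integral_sum, (intro integrable_cube_continuous continuous_intros)[1])+ simp
  also have "\<dots> = (\<Sum>j\<in>I. \<Sum>k\<in>I. if j = k then (e k)\<^sup>2 else 0)"
    unfolding integral_cas_cas by (intro sum.cong refl) (simp add: power2_eq_square)
  finally show ?thesis using assms by simp
qed

text \<open>The sampling hypothesis of the barrier argument: by orthonormality the integral of the
  form is the trace, and the maximum over the cube is at least the mean.\<close>

lemma cas_sampling:
  assumes "finite I"
  shows "\<exists>x\<in>cbox 0 (1 :: real ^ 'n). trace_on I A \<le> inner_on I (\<lambda>k. cas k x) (mat_vec I A (\<lambda>k. cas k x))"
proof -
  define F where "F = (\<lambda>x :: real ^ 'n. inner_on I (\<lambda>k. cas k x) (mat_vec I A (\<lambda>k. cas k x)))"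
  have cont: "continuous_on UNIV F" unfolding F_def inner_on_def mat_vec_def by (intro continuous_intros)
  have "(\<integral>x. F x \<partial>cube) = (\<integral>x. (\<Sum>j\<in>I. \<Sum>k\<in>I. A j k * (cas j x * cas k x)) \<partial>cube)"
    by (simp add: F_def inner_on_def mat_vec_def sum_distrib_left mult_ac)
  also have "\<dots> = (\<Sum>j\<in>I. \<Sum>k\<in>I. A j k * (\<integral>x. cas j x * cas k x \<partial>cube))"
    by (subst Bochner_Integration.integral_sum, (intro integrable_cube_continuous continuous_intros)[1])+ simp
  also have "\<dots> = (\<Sum>j\<in>I. \<Sum>k\<in>I. if j = k then A j k else 0)"
    unfolding integral_cas_cas by (intro sum.cong refl) simp
  also have "\<dots> = trace_on I A" using assms by (simp add: trace_on_def)
  finally have F: "(\<integral>x. F x \<partial>cube) = trace_on I A" .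
  obtain x where x: "x \<in> cbox 0 (1 :: real ^ 'n)" "\<And>y. y \<in> cbox 0 1 \<Longrightarrow> F y \<le> F x"
    using continuous_attains_sup[of "cbox 0 (1 :: real ^ 'n)" F] continuous_on_subset[OF cont]
    by (auto simp: interval_eq_empty_cart not_less)
  have "(\<integral>x. F x \<partial>cube) \<le> (\<integral>y. F x \<partial>(cube :: (real ^ 'n) measure))"
    using x(2) by (intro integral_mono integrable_cube_continuous cont continuous_intros) auto
  also have "\<dots> = F x" by (rule integral_cube_const)
  finally show ?thesis using F x(1) unfolding F_def by (intro bexI[of _ x]) auto
qed

lemma cas_uminus: "cas (\<lambda>i. - k i) x = cos (phase k x) - sin (phase k x)"
  by (simp add: cas_def phase_uminus_freq)

text \<open>Cosine and sine of a phase are half the sum and half the difference of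
  \<open>cas\<close> at k and -k. Sorting by frequency over a symmetric set gives the coefficients
  \<open>a\<close>.\<close>

lemma hartley_of_fourier:
  fixes w :: "('n::finite \<Rightarrow> int) \<Rightarrow> complex"
  assumes fin: "finite S"
  defines "a \<equiv> (\<lambda>k. (Re (w k) - Im (w k)) / 2 + (Re (w (\<lambda>i. - k i)) + Im (w (\<lambda>i. - k i))) / 2)"
  assumes sym: "\<And>k. k \<in> S \<Longrightarrow> (\<lambda>i. - k i) \<in> S"
  shows "Re (\<Sum>k\<in>S. w k * expi k x) = (\<Sum>k\<in>S. a k * cas k x)"
    and "(a k)\<^sup>2 \<le> (norm (w k))\<^sup>2 + (norm (w (\<lambda>i. - k i)))\<^sup>2"
proof -
  have flip: "(\<Sum>k\<in>S. g (\<lambda>i. - k i)) = (\<Sum>k\<in>S. g k)" for g :: "('n \<Rightarrow> int) \<Rightarrow> real"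
    by (rule sum.reindex_bij_witness[of _ "\<lambda>k i. - k i" "\<lambda>k i. - k i"]) (auto simp: sym)
  have "(\<Sum>k\<in>S. a k * cas k x) = (\<Sum>k\<in>S. (Re (w k) - Im (w k)) / 2 * cas k x)
      + (\<Sum>k\<in>S. (Re (w (\<lambda>i. - k i)) + Im (w (\<lambda>i. - k i))) / 2 * cas k x)"
    by (simp only: a_def distrib_right sum.distrib)
  also have "(\<Sum>k\<in>S. (Re (w (\<lambda>i. - k i)) + Im (w (\<lambda>i. - k i))) / 2 * cas k x)
      = (\<Sum>k\<in>S. (Re (w k) + Im (w k)) / 2 * cas (\<lambda>i. - k i) x)"
    using flip[of "\<lambda>k. (Re (w k) + Im (w k)) / 2 * cas (\<lambda>i. - k i) x"] by simp
  also have "(\<Sum>k\<in>S. (Re (w k) - Im (w k)) / 2 * cas k x) + \<dots>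
      = (\<Sum>k\<in>S. Re (w k) * cos (phase k x) - Im (w k) * sin (phase k x))"
    unfolding sum.distrib[symmetric] cas_uminus by (intro sum.cong refl) (simp add: cas_def field_simps)
  also have "\<dots> = Re (\<Sum>k\<in>S. w k * expi k x)" by (simp add: expi_def)
  finally show "Re (\<Sum>k\<in>S. w k * expi k x) = (\<Sum>k\<in>S. a k * cas k x)" by simp
  define p m where "p = (Re (w k) - Im (w k)) / 2" and "m = (Re (w (\<lambda>i. - k i)) + Im (w (\<lambda>i. - k i))) / 2"
  have "p\<^sup>2 \<le> (norm (w k))\<^sup>2 / 2"
    using sum_squares_bound[of "Re (w k)" "- Im (w k)"]
    unfolding p_def cmod_power2 by (simp add: power2_eq_square field_simps)
  moreover have "m\<^sup>2 \<le> (norm (w (\<lambda>i. - k i)))\<^sup>2 / 2"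
    using sum_squares_bound[of "Re (w (\<lambda>i. - k i))" "Im (w (\<lambda>i. - k i))"]
    unfolding m_def cmod_power2 by (simp add: power2_eq_square field_simps)
  moreover have "(p + m)\<^sup>2 \<le> 2 * p\<^sup>2 + 2 * m\<^sup>2"
    using sum_squares_bound[of p m] by (simp add: power2_eq_square algebra_simps)
  ultimately show "(a k)\<^sup>2 \<le> (norm (w k))\<^sup>2 + (norm (w (\<lambda>i. - k i)))\<^sup>2"
    by (simp add: a_def p_def m_def)
qed

definition levs :: "('n \<Rightarrow> int) \<Rightarrow> 'n \<Rightarrow> nat" where
  "levs k = (\<lambda>i. lev (k i))"

text \<open>The block bound doubles because a Hartley coefficient mixes the Fourier coefficients at
  k and -k, which lie in the same block.\<close>

lemma hartley_approx:
  fixes f :: "real ^ 'n \<Rightarrow> 'a::{real_normed_field, euclidean_space}"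
  assumes f: "f \<in> HN_ball l r p" and p: "2 \<le> p" and b: "b \<in> Basis" and \<epsilon>: "0 < \<epsilon>"
  shows "\<exists>S a. finite S \<and> (\<forall>s. (\<Sum>k\<in>{k \<in> S. levs k = s}. (a k)\<^sup>2) \<le> 2 * 2 powr (- 2 * r * real (\<Sum>i\<in>UNIV. s i))) \<and>
    (\<forall>y\<in>cbox 0 1. \<bar>f y \<bullet> b - (\<Sum>k\<in>S. a k * cas k y)\<bar> \<le> \<epsilon>)"
proof -
  define F where "F = (\<lambda>x. f x \<bullet> b)"
  have cont: "continuous_on UNIV F" and per: "periodic F"
    using f by (auto simp: HN_ball_def HN_space_def Lp_space_def F_def periodic_def intro!: continuous_intros)
  have coordF: "coord b f = (\<lambda>x. of_real (F x))" by (simp add: coord_def F_def fun_eq_iff)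
  obtain S w where S: "finite S" and w: "\<And>k. norm (w k) \<le> norm (fourier (coord b f) k)"
    and approx: "\<And>y. y \<in> cbox 0 1 \<Longrightarrow> norm (of_real (F y) - (\<Sum>k\<in>S. w k * expi k y)) \<le> \<epsilon>"
    using fejer_approx[OF cont per \<epsilon>] unfolding coordF by blast
  define neg where "neg = (\<lambda>(k :: 'n \<Rightarrow> int) i. - k i)"
  \<comment> \<open>The symmetrized frequency set, on which the coefficients are continued by
    0.\<close>
  define T where "T = S \<union> neg ` S"
  have T: "finite T" using S by (simp add: T_def)
  have neg_neg: "neg (neg k) = k" for k by (simp add: neg_def)
  have symT: "neg k \<in> T" if "k \<in> T" for k using that neg_neg by (auto simp: T_def)
  define w' where "w' = (\<lambda>k. if k \<in> S then w k else 0)"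
  have w': "norm (w' k) \<le> norm (fourier (coord b f) k)" for k by (simp add: w'_def w)
  define a where "a = (\<lambda>k. (Re (w' k) - Im (w' k)) / 2 + (Re (w' (neg k)) + Im (w' (neg k))) / 2)"
  have a: "Re (\<Sum>k\<in>T. w' k * expi k x) = (\<Sum>k\<in>T. a k * cas k x)"
    "(a k)\<^sup>2 \<le> (norm (w' k))\<^sup>2 + (norm (w' (neg k)))\<^sup>2" for x k
    using hartley_of_fourier[OF T, of w'] symT unfolding a_def neg_def by auto
  have "\<bar>f y \<bullet> b - (\<Sum>k\<in>T. a k * cas k y)\<bar> \<le> \<epsilon>" if y: "y \<in> cbox 0 1" for y
  proof -
    have "(\<Sum>k\<in>S. w k * expi k y) = (\<Sum>k\<in>T. w' k * expi k y)"
      using T by (intro sum.mono_neutral_cong_left) (auto simp: T_def w'_def)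
    then have "norm (of_real (F y) - (\<Sum>k\<in>T. w' k * expi k y)) \<le> \<epsilon>" using approx[OF y] by simp
    moreover have "\<bar>Re (of_real (F y) - (\<Sum>k\<in>T. w' k * expi k y))\<bar> \<le> norm (of_real (F y) - (\<Sum>k\<in>T. w' k * expi k y))"
      by (rule abs_Re_le_cmod)
    ultimately show ?thesis using a(1)[of y] by (simp add: F_def)
  qed
  moreover have "(\<Sum>k\<in>{k \<in> T. levs k = s}. (a k)\<^sup>2) \<le> 2 * 2 powr (- 2 * r * real (\<Sum>i\<in>UNIV. s i))" for s
  proof -
    let ?B = "{k \<in> T. levs k = s}"
    have "(\<Sum>k\<in>?B. (a k)\<^sup>2) \<le> (\<Sum>k\<in>?B. (norm (w' k))\<^sup>2) + (\<Sum>k\<in>?B. (norm (w' (neg k)))\<^sup>2)"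
      unfolding sum.distrib[symmetric] by (intro sum_mono a(2))
    also have "(\<Sum>k\<in>?B. (norm (w' (neg k)))\<^sup>2) = (\<Sum>k\<in>?B. (norm (w' k))\<^sup>2)"
      by (rule sum.reindex_bij_witness[of _ neg neg])
        (auto simp: neg_neg symT, auto simp: neg_def levs_def lev_uminus)
    also have "(\<Sum>k\<in>?B. (norm (w' k))\<^sup>2) \<le> (\<Sum>k\<in>?B. (norm (fourier (coord b f) k))\<^sup>2)"
      by (intro sum_mono power_mono w') simp
    also have "\<dots> \<le> 2 powr (- 2 * r * real (\<Sum>i\<in>UNIV. s i))"
      using T by (intro block_bound[OF f p b]) (auto simp: levs_def)
    finally show ?thesis by simp
  qed
  ultimately show ?thesis using T by blast
qed

section \<open>Counting dyadic blocks of a given total level\<close>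

definition level_count :: "'n::finite itself \<Rightarrow> nat \<Rightarrow> nat" where
  "level_count _ j = card {s :: 'n \<Rightarrow> nat. (\<Sum>i\<in>UNIV. s i) = j}"

lemma finite_level: "finite {s :: 'n::finite \<Rightarrow> nat. (\<Sum>i\<in>UNIV. s i) = j}"
proof (rule finite_subset)
  show "{s :: 'n \<Rightarrow> nat. (\<Sum>i\<in>UNIV. s i) = j} \<subseteq> PiE UNIV (\<lambda>_. {..j})"
  proof
    fix s :: "'n \<Rightarrow> nat" assume "s \<in> {s. (\<Sum>i\<in>UNIV. s i) = j}"
    then have "s i \<le> j" for i using member_le_sum[of i UNIV s] by auto
    then show "s \<in> PiE UNIV (\<lambda>_. {..j})" by (auto simp: PiE_def extensional_def)
  qed
  show "finite (PiE UNIV (\<lambda>_ :: 'n. {..j}))" by (intro finite_PiE) auto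
qed

text \<open>One coordinate is determined by the others, each of which takes at most j + 1
  values.\<close>

lemma level_count_upper: "level_count TYPE('n::finite) j \<le> (j + 1) ^ (CARD('n) - 1)"
proof -
  obtain a :: 'n where True by simp
  let ?S = "{s :: 'n \<Rightarrow> nat. (\<Sum>i\<in>UNIV. s i) = j}"
  have sum_split: "(\<Sum>i\<in>UNIV. s i) = s a + (\<Sum>i\<in>UNIV - {a}. s i)" for s :: "'n \<Rightarrow> nat"
    by (rule sum.remove) auto
  have "inj_on (\<lambda>s. restrict s (UNIV - {a})) ?S"
  proof (rule inj_onI)
    fix s t assume st: "s \<in> ?S" "t \<in> ?S" and eq: "restrict s (UNIV - {a}) = restrict t (UNIV - {a})"
    have *: "s i = t i" if "i \<noteq> a" for i using fun_cong[OF eq, of i] that by simp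
    then have "(\<Sum>i\<in>UNIV - {a}. s i) = (\<Sum>i\<in>UNIV - {a}. t i)" by (intro sum.cong) auto
    then have "s a = t a" using st sum_split[of s] sum_split[of t] by simp
    then show "s = t" using * by (metis ext)
  qed
  then have "card ?S = card ((\<lambda>s. restrict s (UNIV - {a})) ` ?S)" by (rule card_image[symmetric])
  also have "\<dots> \<le> card (PiE (UNIV - {a}) (\<lambda>_. {..j}))"
  proof (intro card_mono finite_PiE)
    show "(\<lambda>s. restrict s (UNIV - {a})) ` ?S \<subseteq> PiE (UNIV - {a}) (\<lambda>_. {..j})"
    proof
      fix u assume "u \<in> (\<lambda>s. restrict s (UNIV - {a})) ` ?S"
      then obtain s where s: "(\<Sum>i\<in>UNIV. s i) = j" "u = restrict s (UNIV - {a})" by auto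
      have "s i \<le> j" for i using member_le_sum[of i UNIV s] s by auto
      then show "u \<in> PiE (UNIV - {a}) (\<lambda>_. {..j})" by (auto simp: s)
    qed
  qed auto
  also have "\<dots> = (j + 1) ^ (CARD('n) - 1)" by (simp add: card_PiE card_Diff_singleton)
  finally show ?thesis by (simp add: level_count_def)
qed

text \<open>All coordinates but one may be chosen freely up to j div d; the remaining one fills the
  sum up to j.\<close>

lemma level_count_lower: "((j + 1) / CARD('n)) ^ (CARD('n) - 1) \<le> real (level_count TYPE('n::finite) j)"
proof -
  obtain a :: 'n where True by simp
  let ?S = "{s :: 'n \<Rightarrow> nat. (\<Sum>i\<in>UNIV. s i) = j}"
  define c where "c = j div CARD('n)"
  let ?P = "PiE (UNIV - {a}) (\<lambda>_. {..c})"
  define ext where "ext = (\<lambda>u :: 'n \<Rightarrow> nat. \<lambda>i. if i = a then j - (\<Sum>i\<in>UNIV - {a}. u i) else u i)"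
  have le: "(\<Sum>i\<in>UNIV - {a}. u i) \<le> j" if "u \<in> ?P" for u
  proof -
    have "(\<Sum>i\<in>UNIV - {a}. u i) \<le> (\<Sum>i\<in>UNIV - {a}. c)" using that by (intro sum_mono) (auto simp: PiE_iff)
    also have "\<dots> \<le> CARD('n) * c" by (simp add: card_Diff_singleton)
    also have "\<dots> \<le> j" by (simp add: c_def)
    finally show ?thesis .
  qed
  have "ext ` ?P \<subseteq> ?S"
  proof
    fix s assume "s \<in> ext ` ?P"
    then obtain u where u: "u \<in> ?P" "s = ext u" by auto
    have "(\<Sum>i\<in>UNIV. s i) = s a + (\<Sum>i\<in>UNIV - {a}. s i)" by (rule sum.remove) auto
    also have "(\<Sum>i\<in>UNIV - {a}. s i) = (\<Sum>i\<in>UNIV - {a}. u i)" by (intro sum.cong) (auto simp: u ext_def)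
    also have "s a + \<dots> = j" using le[OF u(1)] by (simp add: u ext_def)
    finally show "s \<in> ?S" by simp
  qed
  then have "card (ext ` ?P) \<le> card ?S" by (intro card_mono finite_level)
  moreover have "inj_on ext ?P"
  proof (rule inj_onI)
    fix u v assume uv: "u \<in> ?P" "v \<in> ?P" "ext u = ext v"
    show "u = v"
    proof (rule PiE_ext[OF uv(1,2)])
      fix i assume "i \<in> UNIV - {a}"
      then show "u i = v i" using fun_cong[OF uv(3), of i] by (simp add: ext_def)
    qed
  qed
  ultimately have "card ?P \<le> level_count TYPE('n) j"
    by (simp add: card_image level_count_def)
  then have "(c + 1) ^ (CARD('n) - 1) \<le> level_count TYPE('n) j"
    by (simp add: card_PiE card_Diff_singleton)
  then have "real ((c + 1) ^ (CARD('n) - 1)) \<le> real (level_count TYPE('n) j)" by (rule of_nat_mono)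
  moreover have "((j + 1) / CARD('n)) ^ (CARD('n) - 1) \<le> (real (c + 1)) ^ (CARD('n) - 1)"
  proof (intro power_mono)
    have "j + 1 \<le> CARD('n) * (c + 1)"
      unfolding c_def using dividend_less_div_times[of "CARD('n)" j] by (simp add: algebra_simps)
    then have "real (j + 1) \<le> real (CARD('n) * (c + 1))" by (rule of_nat_mono)
    then show "(j + 1) / CARD('n) \<le> real (c + 1)" by (simp add: field_simps)
  qed simp
  ultimately show ?thesis by (simp add: add.commute)
qed

abbreviation total_lev :: "('n::finite \<Rightarrow> int) \<Rightarrow> nat" where
  "total_lev k \<equiv> (\<Sum>i\<in>UNIV. lev (k i))"

lemma levs_block: "finite {k :: 'n::finite \<Rightarrow> int. levs k = s} \<and> card {k. levs k = s} \<le> 2 ^ (\<Sum>i\<in>UNIV. s i)"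
proof -
  have eq: "{k :: 'n \<Rightarrow> int. levs k = s} = PiE UNIV (\<lambda>i. {j. lev j = s i})"
    by (auto simp: levs_def PiE_def extensional_def fun_eq_iff)
  have "card {k :: 'n \<Rightarrow> int. levs k = s} = (\<Prod>i\<in>UNIV. card {j. lev j = s i})"
    unfolding eq by (rule card_PiE) simp
  also have "\<dots> \<le> (\<Prod>i\<in>UNIV. 2 ^ s i)" using lev_block by (intro prod_mono) auto
  finally show ?thesis using lev_block eq by (auto simp: power_sum intro!: finite_PiE)
qed

text \<open>Frequencies are grouped first by block and then by total level. This serves for
  cardinalities, sums of moduli and weighted sums of squares alike.\<close>

lemma level_sum:
  fixes g :: "('n::finite \<Rightarrow> int) \<Rightarrow> real" and \<phi> Y :: "nat \<Rightarrow> real"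
  assumes S: "finite S" and J: "finite J" and SJ: "\<And>k. k \<in> S \<Longrightarrow> total_lev k \<in> J"
    and \<phi>: "\<And>j. 0 \<le> \<phi> j" and Y: "\<And>j. 0 \<le> Y j"
    and blk: "\<And>s. (\<Sum>k\<in>{k \<in> S. levs k = s}. g k) \<le> Y (\<Sum>i\<in>UNIV. s i)"
  shows "(\<Sum>k\<in>S. \<phi> (total_lev k) * g k) \<le> (\<Sum>j\<in>J. level_count TYPE('n) j * (\<phi> j * Y j))"
proof -
  let ?W = "{s :: 'n \<Rightarrow> nat. (\<Sum>i\<in>UNIV. s i) \<in> J}"
  have finW: "finite ?W"
  proof -
    have "?W = (\<Union>j\<in>J. {s. (\<Sum>i\<in>UNIV. s i) = j})" by auto
    then show ?thesis using J by (simp add: finite_level)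
  qed
  have "(\<Sum>k\<in>S. \<phi> (total_lev k) * g k) = (\<Sum>s\<in>levs ` S. \<Sum>k\<in>{k \<in> S. levs k = s}. \<phi> (total_lev k) * g k)"
    by (rule sum.image_gen[OF S])
  also have "\<dots> = (\<Sum>s\<in>levs ` S. \<phi> (\<Sum>i\<in>UNIV. s i) * (\<Sum>k\<in>{k \<in> S. levs k = s}. g k))"
  proof (intro sum.cong refl)
    fix s :: "'n \<Rightarrow> nat"
    have "total_lev k = (\<Sum>i\<in>UNIV. s i)" if "levs k = s" for k
      using that by (auto simp: levs_def)
    then show "(\<Sum>k\<in>{k \<in> S. levs k = s}. \<phi> (total_lev k) * g k)
        = \<phi> (\<Sum>i\<in>UNIV. s i) * (\<Sum>k\<in>{k \<in> S. levs k = s}. g k)"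
      unfolding sum_distrib_left by (intro sum.cong refl) auto
  qed
  also have "\<dots> \<le> (\<Sum>s\<in>levs ` S. \<phi> (\<Sum>i\<in>UNIV. s i) * Y (\<Sum>i\<in>UNIV. s i))"
    by (intro sum_mono mult_left_mono blk \<phi>)
  also have "\<dots> \<le> (\<Sum>s\<in>?W. \<phi> (\<Sum>i\<in>UNIV. s i) * Y (\<Sum>i\<in>UNIV. s i))"
    using SJ \<phi> Y finW by (intro sum_mono2) (auto simp: levs_def)
  also have "\<dots> = (\<Sum>j\<in>J. \<Sum>s\<in>{s \<in> ?W. (\<Sum>i\<in>UNIV. s i) = j}. \<phi> (\<Sum>i\<in>UNIV. s i) * Y (\<Sum>i\<in>UNIV. s i))"
    using finW J by (intro sum.group[symmetric]) auto
  also have "\<dots> = (\<Sum>j\<in>J. level_count TYPE('n) j * (\<phi> j * Y j))"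
  proof (intro sum.cong refl)
    fix j assume "j \<in> J"
    then have eq: "{s \<in> ?W. (\<Sum>i\<in>UNIV. s i) = j} = {s. (\<Sum>i\<in>UNIV. s i) = j}" by auto
    show "(\<Sum>s\<in>{s \<in> ?W. (\<Sum>i\<in>UNIV. s i) = j}. \<phi> (\<Sum>i\<in>UNIV. s i) * Y (\<Sum>i\<in>UNIV. s i)) = level_count TYPE('n) j * (\<phi> j * Y j)"
      unfolding eq by (simp add: level_count_def)
  qed
  finally show ?thesis .
qed

section \<open>Sums of a polynomial times a geometric sequence\<close>

lemma summable_poly_geometric:
  fixes \<alpha> :: real
  assumes "0 < \<alpha>"
  shows "summable (\<lambda>i. (real i + 1) ^ D * 2 powr (- \<alpha> * real i))"
proof (rule summable_comparison_test)
  \<comment> \<open>Half of the exponential decay absorbs the polynomial; the other half is the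
    ratio of the geometric majorant.\<close>
  define c where "c = \<alpha> * ln 2 / 2"
  have c: "0 < c" using assms by (simp add: c_def)
  define K where "K = (real D + 1) powr (real D + 1) * exp c / c ^ (D + 1)"
  show "summable (\<lambda>i. K * (exp (- c)) ^ i)"
    using c by (intro summable_mult summable_geometric) simp
  have "norm ((real i + 1) ^ D * 2 powr (- \<alpha> * real i)) \<le> K * (exp (- c)) ^ i" for i
  proof -
    have "(c * (real i + 1)) powr (real D + 1) \<le> (real D + 1) powr (real D + 1) * exp (c * (real i + 1))"
      using c by (intro powr_le_exp) auto
    also have "(c * (real i + 1)) powr (real D + 1) = (c * (real i + 1)) ^ (D + 1)"
      using c powr_realpow[of "c * (real i + 1)" "D + 1"] by (simp add: add.commute)
    finally have "(real i + 1) ^ (D + 1) \<le> (real D + 1) powr (real D + 1) * exp (c * (real i + 1)) / c ^ (D + 1)"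
      using c by (simp only: power_mult_distrib pos_le_divide_eq zero_less_power mult.commute)
    also have "\<dots> = K * exp (c * real i)" by (simp add: K_def exp_add[symmetric] algebra_simps)
    finally have "(real i + 1) ^ (D + 1) \<le> K * exp (c * real i)" .
    moreover have "(real i + 1) ^ D \<le> (real i + 1) ^ (D + 1)" by (rule power_increasing) auto
    ultimately have "(real i + 1) ^ D \<le> K * exp (c * real i)" by linarith
    moreover have "2 powr (- \<alpha> * real i) = exp (- (2 * c) * real i)"
      by (simp add: powr_def c_def mult_ac)
    ultimately have "(real i + 1) ^ D * 2 powr (- \<alpha> * real i) \<le> K * exp (c * real i) * exp (- (2 * c) * real i)"
      by (simp add: mult_right_mono)
    also have "\<dots> = K * exp (- c) ^ i"
      by (simp add: mult.assoc exp_add[symmetric] exp_of_nat_mult[symmetric] algebra_simps)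
    finally show ?thesis by simp
  qed
  then show "\<exists>N. \<forall>i\<ge>N. norm ((real i + 1) ^ D * 2 powr (- \<alpha> * real i)) \<le> K * (exp (- c)) ^ i" by blast
qed

text \<open>Uniformity in m comes from j + 1 \<le> (m + 1) (j - m + 1), which splits the polynomial
  factor.\<close>

lemma poly_geometric_sum:
  fixes \<alpha> :: real
  assumes \<alpha>: "0 < \<alpha>"
  shows "\<exists>K>0. \<forall>m J. finite J \<longrightarrow> (\<forall>j\<in>J. m \<le> j) \<longrightarrow>
    (\<Sum>j\<in>J. (real j + 1) ^ D * 2 powr (- \<alpha> * (real j - real m))) \<le> K * (real m + 1) ^ D"
proof (intro exI conjI allI impI)
  let ?f = "\<lambda>i. (real i + 1) ^ D * 2 powr (- \<alpha> * real i)"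
  show "0 < suminf ?f" by (intro suminf_pos summable_poly_geometric \<alpha>) simp
  fix m :: nat and J assume J: "finite J" "\<forall>j\<in>J. m \<le> j"
  have "(\<Sum>j\<in>J. (real j + 1) ^ D * 2 powr (- \<alpha> * (real j - real m))) \<le> (\<Sum>j\<in>J. (real m + 1) ^ D * ?f (j - m))"
  proof (rule sum_mono)
    fix j assume "j \<in> J"
    then have j: "m \<le> j" using J by auto
    have "real j + 1 = real m + real (j - m) + 1" using j by simp
    also have "\<dots> \<le> (real m + 1) * (real (j - m) + 1)" by (simp add: distrib_left distrib_right)
    finally have "real j + 1 \<le> (real m + 1) * (real (j - m) + 1)" .
    then have "(real j + 1) ^ D \<le> ((real m + 1) * (real (j - m) + 1)) ^ D" by (intro power_mono) auto
    then have "(real j + 1) ^ D * 2 powr (- \<alpha> * (real j - real m))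
        \<le> ((real m + 1) * (real (j - m) + 1)) ^ D * 2 powr (- \<alpha> * (real j - real m))"
      by (rule mult_right_mono) simp
    then show "(real j + 1) ^ D * 2 powr (- \<alpha> * (real j - real m)) \<le> (real m + 1) ^ D * ?f (j - m)"
      using j by (simp add: power_mult_distrib of_nat_diff mult_ac)
  qed
  also have "\<dots> = (real m + 1) ^ D * (\<Sum>j\<in>J. ?f (j - m))" by (simp add: sum_distrib_left)
  also have "(\<Sum>j\<in>J. ?f (j - m)) = (\<Sum>i\<in>(\<lambda>j. j - m) ` J. ?f i)"
    using J by (subst sum.reindex) (auto intro!: inj_onI simp: comp_def eq_diff_iff)
  also have "\<dots> \<le> suminf ?f"
    using J by (intro sum_le_suminf summable_poly_geometric \<alpha>) auto
  finally show "(\<Sum>j\<in>J. (real j + 1) ^ D * 2 powr (- \<alpha> * (real j - real m))) \<le> suminf ?f * (real m + 1) ^ D"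
    by (simp add: mult.commute mult_left_mono)
qed

section \<open>Sampling points and recovery\<close>

lemma finite_total_lev: "finite {k :: 'n::finite \<Rightarrow> int. total_lev k \<le> m}"
proof (rule finite_subset)
  show "{k :: 'n \<Rightarrow> int. total_lev k \<le> m} \<subseteq> (\<Union>s\<in>(\<Union>j\<in>{..m}. {s. (\<Sum>i\<in>UNIV. s i) = j}). {k. levs k = s})"
    by (auto simp: levs_def)
  show "finite (\<Union>s\<in>(\<Union>j\<in>{..m}. {s :: 'n \<Rightarrow> nat. (\<Sum>i\<in>UNIV. s i) = j}). {k. levs k = s})"
    by (intro finite_UN_I finite_level conjunct1[OF levs_block]) auto
qed

lemma level_count_le: "real (level_count TYPE('n::finite) j) \<le> (real j + 1) ^ (CARD('n) - 1)"
proof -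
  have "real (level_count TYPE('n) j) \<le> real ((j + 1) ^ (CARD('n) - 1))"
    by (intro of_nat_mono level_count_upper)
  then show ?thesis by (simp add: add.commute)
qed

lemma block_card_le:
  fixes S :: "('n::finite \<Rightarrow> int) set"
  assumes "finite S"
  shows "real (card {k \<in> S. levs k = s}) \<le> 2 ^ (\<Sum>i\<in>UNIV. s i)"
proof -
  have "card {k \<in> S. levs k = s} \<le> card {k. levs k = s}"
    by (intro card_mono conjunct1[OF levs_block]) auto
  also have "\<dots> \<le> 2 ^ (\<Sum>i\<in>UNIV. s i)" by (rule conjunct2[OF levs_block])
  finally have "real (card {k \<in> S. levs k = s}) \<le> real (2 ^ (\<Sum>i\<in>UNIV. s i))" by (rule of_nat_mono)
  then show ?thesis by simp
qed

text \<open>The size of a step hyperbolic cross: block sizes double with the level, so the top level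
  dominates.\<close>

lemma card_total_lev: "card {k :: 'n::finite \<Rightarrow> int. total_lev k \<le> m} \<le> 2 ^ (m + 1) * (m + 1) ^ (CARD('n) - 1)"
proof -
  define S where "S = {k :: 'n \<Rightarrow> int. total_lev k \<le> m}"
  have S: "finite S" unfolding S_def by (rule finite_total_lev)
  have "real (card S) = (\<Sum>k\<in>S. 1 * 1)" by simp
  also have "\<dots> \<le> (\<Sum>j\<in>{..m}. real (level_count TYPE('n) j) * (1 * 2 ^ j))"
    using block_card_le[OF S]
    by (intro level_sum[where \<phi> = "\<lambda>_. 1" and g = "\<lambda>_. 1" and Y = "\<lambda>j. 2 ^ j"] S) (auto simp: S_def)
  also have "\<dots> \<le> (\<Sum>j\<in>{..m}. (real m + 1) ^ (CARD('n) - 1) * 2 ^ j)"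
  proof (intro sum_mono)
    fix j assume "j \<in> {..m}"
    then have "(real j + 1) ^ (CARD('n) - 1) \<le> (real m + 1) ^ (CARD('n) - 1)" by (intro power_mono) auto
    then have "real (level_count TYPE('n) j) \<le> (real m + 1) ^ (CARD('n) - 1)"
      using level_count_le[of j, where 'n = 'n] by linarith
    then show "real (level_count TYPE('n) j) * (1 * 2 ^ j) \<le> (real m + 1) ^ (CARD('n) - 1) * 2 ^ j"
      by (simp add: mult_right_mono)
  qed
  also have "\<dots> = (real m + 1) ^ (CARD('n) - 1) * (2 ^ (m + 1) - 1)"
  proof -
    have "(\<Sum>j\<in>{..m}. 2 ^ j :: real) = 2 ^ (m + 1) - 1" by (induction m) auto
    then show ?thesis by (simp only: sum_distrib_left[symmetric])
  qed
  also have "\<dots> \<le> (real m + 1) ^ (CARD('n) - 1) * 2 ^ (m + 1)" by (intro mult_left_mono) auto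
  also have "\<dots> = real (2 ^ (m + 1) * (m + 1) ^ (CARD('n) - 1))" by (simp add: add.commute mult.commute)
  finally show ?thesis unfolding S_def of_nat_le_iff .
qed

text \<open>On a block of at most 2^j frequencies, Cauchy-Schwarz bounds the sum of moduli by 2
  times 2^(-(r - 1/2) j), and the number of blocks is polynomial in j. The cutoff is common to the
  whole class, so one finite frequency set serves all functions.\<close>

lemma high_frequencies_small:
  fixes r :: real
  assumes r: "1 / 2 < r" and \<epsilon>: "0 < \<epsilon>"
  shows "\<exists>\<Lambda>\<ge>m. \<forall>S (a :: ('n::finite \<Rightarrow> int) \<Rightarrow> real). finite S \<longrightarrow>
    (\<forall>s. (\<Sum>k\<in>{k \<in> S. levs k = s}. (a k)\<^sup>2) \<le> 2 * 2 powr (- 2 * r * real (\<Sum>i\<in>UNIV. s i))) \<longrightarrow>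
    (\<Sum>k\<in>{k \<in> S. \<Lambda> < total_lev k}. \<bar>a k\<bar>) \<le> \<epsilon>"
proof -
  define D where "D = CARD('n) - 1"
  define \<alpha> where "\<alpha> = r - 1 / 2"
  have \<alpha>: "0 < \<alpha>" using r by (simp add: \<alpha>_def)
  obtain K where K: "0 < K" and sumK: "\<And>m J. finite J \<Longrightarrow> \<forall>j\<in>J. m \<le> j \<Longrightarrow>
      (\<Sum>j\<in>J. (real j + 1) ^ D * 2 powr (- \<alpha> * (real j - real m))) \<le> K * (real m + 1) ^ D"
    using poly_geometric_sum[OF \<alpha>, of D] by blast
  have "(\<lambda>i. 2 * K * ((real i + 1) ^ D * 2 powr (- \<alpha> * real i))) \<longlonglongrightarrow> 2 * K * 0"
    by (intro tendsto_mult_left summable_LIMSEQ_zero summable_poly_geometric \<alpha>)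
  then have "\<forall>\<^sub>F i in sequentially. 2 * K * ((real i + 1) ^ D * 2 powr (- \<alpha> * real i)) < \<epsilon>"
    using \<epsilon> by (intro order_tendstoD) auto
  then obtain \<Lambda>0 where \<Lambda>0: "\<And>i. \<Lambda>0 \<le> i \<Longrightarrow> 2 * K * ((real i + 1) ^ D * 2 powr (- \<alpha> * real i)) < \<epsilon>"
    by (auto simp: eventually_sequentially)
  define \<Lambda> where "\<Lambda> = max m \<Lambda>0"
  have "(\<Sum>k\<in>{k \<in> S. \<Lambda> < total_lev k}. \<bar>a k\<bar>) \<le> \<epsilon>"
    if S: "finite S" and blk: "\<And>s. (\<Sum>k\<in>{k \<in> S. levs k = s}. (a k)\<^sup>2) \<le> 2 * 2 powr (- 2 * r * real (\<Sum>i\<in>UNIV. s i))"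
    for S and a :: "('n \<Rightarrow> int) \<Rightarrow> real"
  proof -
    define T where "T = {k \<in> S. \<Lambda> < total_lev k}"
    define J where "J = total_lev ` T"
    have T: "finite T" and J: "finite J" using S by (auto simp: T_def J_def)
    have "(\<Sum>k\<in>T. \<bar>a k\<bar>) = (\<Sum>k\<in>T. 1 * \<bar>a k\<bar>)" by simp
    also have "\<dots> \<le> (\<Sum>j\<in>J. level_count TYPE('n) j * (1 * (2 * 2 powr (- \<alpha> * real j))))"
    proof (intro level_sum[where \<phi> = "\<lambda>_. 1"] T J)
      fix s :: "'n \<Rightarrow> nat"
      define j where "j = (\<Sum>i\<in>UNIV. s i)"
      let ?B = "{k \<in> T. levs k = s}"
      have "(\<Sum>k\<in>?B. (a k)\<^sup>2) \<le> (\<Sum>k\<in>{k \<in> S. levs k = s}. (a k)\<^sup>2)"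
        using S by (intro sum_mono2) (auto simp: T_def)
      then have b: "(\<Sum>k\<in>?B. (a k)\<^sup>2) \<le> 2 * 2 powr (- 2 * r * real j)"
        using blk[of s] by (simp add: j_def)
      have "(\<Sum>k\<in>?B. \<bar>a k\<bar>)\<^sup>2 \<le> (\<Sum>k\<in>?B. 1\<^sup>2) * (\<Sum>k\<in>?B. \<bar>a k\<bar>\<^sup>2)"
        using Cauchy_Schwarz_ineq_sum[of "\<lambda>_. 1" "\<lambda>k. \<bar>a k\<bar>" ?B] by simp
      also have "\<dots> \<le> 2 ^ j * (2 * 2 powr (- 2 * r * real j))"
        using block_card_le[OF T, of s] b by (intro mult_mono) (auto simp: j_def sum_nonneg)
      also have "\<dots> \<le> 4 * (2 powr real j * 2 powr (- 2 * r * real j))"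
        by (simp add: powr_realpow)
      also have "2 powr real j * 2 powr (- 2 * r * real j) = (2 powr (- \<alpha> * real j))\<^sup>2"
        unfolding power2_eq_square powr_add[symmetric] by (simp add: \<alpha>_def algebra_simps)
      finally have "(\<Sum>k\<in>?B. \<bar>a k\<bar>)\<^sup>2 \<le> (2 * 2 powr (- \<alpha> * real j))\<^sup>2"
        by (simp add: power_mult_distrib)
      then show "(\<Sum>k\<in>?B. \<bar>a k\<bar>) \<le> 2 * 2 powr (- \<alpha> * real (\<Sum>i\<in>UNIV. s i))"
        unfolding j_def by (rule power2_le_imp_le) simp
    qed (auto simp: J_def)
    also have "\<dots> \<le> (\<Sum>j\<in>J. (2 * 2 powr (- \<alpha> * real \<Lambda>)) * ((real j + 1) ^ D * 2 powr (- \<alpha> * (real j - real \<Lambda>))))"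
    proof (intro sum_mono)
      fix j
      have eq: "2 powr (- \<alpha> * real j) = 2 powr (- \<alpha> * real \<Lambda>) * 2 powr (- \<alpha> * (real j - real \<Lambda>))"
        unfolding powr_add[symmetric] by (simp add: algebra_simps)
      have "level_count TYPE('n) j * (1 * (2 * 2 powr (- \<alpha> * real j))) \<le> (real j + 1) ^ D * (1 * (2 * 2 powr (- \<alpha> * real j)))"
        using level_count_le[of j, where 'n = 'n] by (intro mult_right_mono) (auto simp: D_def)
      then show "level_count TYPE('n) j * (1 * (2 * 2 powr (- \<alpha> * real j)))
          \<le> (2 * 2 powr (- \<alpha> * real \<Lambda>)) * ((real j + 1) ^ D * 2 powr (- \<alpha> * (real j - real \<Lambda>)))"
        unfolding eq by (simp add: mult_ac)
    qed
    also have "\<dots> \<le> (2 * 2 powr (- \<alpha> * real \<Lambda>)) * (K * (real \<Lambda> + 1) ^ D)"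
      unfolding sum_distrib_left[symmetric]
      by (intro mult_left_mono sumK J) (auto simp: J_def T_def)
    also have "\<dots> \<le> \<epsilon>" using \<Lambda>0[of \<Lambda>] by (simp add: \<Lambda>_def mult_ac)
    finally show ?thesis by (simp add: T_def)
  qed
  then show ?thesis by (intro exI[of _ \<Lambda>]) (auto simp: \<Lambda>_def)
qed

text \<open>Weights growing slower than \<open>2\<^bsup>2rj\<^esup>\<close> keep the energy of the class finite, and growing faster than \<open>2\<^sup>j\<close> keep
  the sum of the inverse weights finite; the exponent \<open>2\<rho>\<close> lies halfway between \<open>1\<close> and \<open>2r\<close>.\<close>

lemma weighted_points:
  fixes r :: real
  assumes r: "1 / 2 < r"
  shows "\<exists>K1>0. \<exists>K2>0. \<forall>m \<Lambda>. m \<le> \<Lambda> \<longrightarrow>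
    (\<exists>(\<tau>::real) L d (x :: nat \<Rightarrow> real ^ 'n). let I = {k :: 'n \<Rightarrow> int. total_lev k \<le> \<Lambda>};
        N = 2 ^ (m + 1) * (m + 1) ^ (CARD('n) - 1) in
      0 < \<tau> \<and> L = real N / \<tau> \<and> L * K1 = 2 * 2 powr (2 * r * real m) \<and> (\<forall>k. 0 < d k) \<and> (\<forall>j. x j \<in> cbox 0 1) \<and>
      (\<forall>a. L * inner_on I a a \<le> (\<Sum>k\<in>I. d k * (a k)\<^sup>2) + 1 / (4 * \<tau>) * (\<Sum>j<32 * N. (inner_on I a (\<lambda>k. cas k (x j)))\<^sup>2)) \<and>
      (\<forall>a. (\<forall>s. (\<Sum>k\<in>{k \<in> I. levs k = s}. (a k)\<^sup>2) \<le> 2 * 2 powr (- 2 * r * real (\<Sum>i\<in>UNIV. s i))) \<longrightarrow>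
        (\<Sum>k\<in>I. d k * (a k)\<^sup>2) \<le> K2 * (real m + 1) ^ (CARD('n) - 1)))"
proof -
  define D where "D = CARD('n) - 1"
  define \<rho> where "\<rho> = (r + 1 / 2) / 2"
  have \<rho>: "1 / 2 < \<rho>" "\<rho> < r" using r by (auto simp: \<rho>_def)
  obtain K1 where K1: "0 < K1" and sum1: "\<And>m J. finite J \<Longrightarrow> \<forall>j\<in>J. m \<le> j \<Longrightarrow>
      (\<Sum>j\<in>J. (real j + 1) ^ D * 2 powr (- (2 * \<rho> - 1) * (real j - real m))) \<le> K1 * (real m + 1) ^ D"
    using poly_geometric_sum[of "2 * \<rho> - 1" D] \<rho> by auto
  obtain Ka where Ka: "0 < Ka" and suma: "\<And>m J. finite J \<Longrightarrow> \<forall>j\<in>J. m \<le> j \<Longrightarrow>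
      (\<Sum>j\<in>J. (real j + 1) ^ D * 2 powr (- (2 * r) * (real j - real m))) \<le> Ka * (real m + 1) ^ D"
    using poly_geometric_sum[of "2 * r" D] r by auto
  obtain Kb where Kb: "0 < Kb" and sumb: "\<And>m J. finite J \<Longrightarrow> \<forall>j\<in>J. m \<le> j \<Longrightarrow>
      (\<Sum>j\<in>J. (real j + 1) ^ D * 2 powr (- (2 * (r - \<rho>)) * (real j - real m))) \<le> Kb * (real m + 1) ^ D"
    using poly_geometric_sum[of "2 * (r - \<rho>)" D] \<rho> by auto
  have main: "\<exists>(\<tau>::real) L d (x :: nat \<Rightarrow> real ^ 'n). let I = {k :: 'n \<Rightarrow> int. total_lev k \<le> \<Lambda>};
        N = 2 ^ (m + 1) * (m + 1) ^ (CARD('n) - 1) in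
      0 < \<tau> \<and> L = real N / \<tau> \<and> L * K1 = 2 * 2 powr (2 * r * real m) \<and> (\<forall>k. 0 < d k) \<and> (\<forall>j. x j \<in> cbox 0 1) \<and>
      (\<forall>a. L * inner_on I a a \<le> (\<Sum>k\<in>I. d k * (a k)\<^sup>2) + 1 / (4 * \<tau>) * (\<Sum>j<32 * N. (inner_on I a (\<lambda>k. cas k (x j)))\<^sup>2)) \<and>
      (\<forall>a. (\<forall>s. (\<Sum>k\<in>{k \<in> I. levs k = s}. (a k)\<^sup>2) \<le> 2 * 2 powr (- 2 * r * real (\<Sum>i\<in>UNIV. s i))) \<longrightarrow>
        (\<Sum>k\<in>I. d k * (a k)\<^sup>2) \<le> (2 * Ka + 2 * Kb) * (real m + 1) ^ (CARD('n) - 1))"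
    if m\<Lambda>: "m \<le> \<Lambda>" for m \<Lambda>
  proof -
    define I where "I = {k :: 'n \<Rightarrow> int. total_lev k \<le> \<Lambda>}"
    define J where "J = {k :: 'n \<Rightarrow> int. total_lev k \<le> m}"
    define N :: nat where "N = 2 ^ (m + 1) * (m + 1) ^ D"
    have finI: "finite I" unfolding I_def by (rule finite_total_lev)
    have JI: "J \<subseteq> I" using m\<Lambda> by (auto simp: I_def J_def)
    have cardJ: "card J \<le> N" unfolding J_def N_def D_def by (rule card_total_lev)
    have N0: "0 < N" by (simp add: N_def)
    \<comment> \<open>The exponent is normalized so that at j = m it would be 2 r m; beyond m both
      the energies and the inverse weights times block sizes then decay geometrically. Up to m the
      weight 1 suffices, since these directions are covered by the initial barrier.\<close>
    define w where "w = (\<lambda>j. if j \<le> m then 1 else 2 powr (2 * \<rho> * real j + 2 * (r - \<rho>) * real m))"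
    define d where "d = (\<lambda>k :: 'n \<Rightarrow> int. w (total_lev k))"
    have w: "0 < w j" for j by (simp add: w_def)
    \<comment> \<open>The bound for the tail of inverse weights, arranged so that N/\<tau> is
      exactly 2/\<open>K1\<close> times 2^(2 r m).\<close>
    define \<tau> where "\<tau> = 2 powr ((1 - 2 * r) * real m) * (K1 * (real m + 1) ^ D)"
    have \<tau>: "0 < \<tau>" using K1 by (simp add: \<tau>_def)
    have tail: "(\<Sum>k\<in>I - J. 1 / d k) \<le> \<tau>"
    proof -
      have finIJ: "finite (I - J)" using finI by simp
      have "(\<Sum>k\<in>I - J. 1 / d k) = (\<Sum>k\<in>I - J. 1 / w (total_lev k) * 1)" by (simp add: d_def)
      also have "\<dots> \<le> (\<Sum>j\<in>{m<..\<Lambda>}. level_count TYPE('n) j * (1 / w j * 2 ^ j))"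
        using block_card_le[OF finIJ] w
        by (intro level_sum finIJ) (auto simp: I_def J_def less_imp_le)
      also have "\<dots> \<le> (\<Sum>j\<in>{m<..\<Lambda>}. 2 powr ((1 - 2 * r) * real m) * ((real j + 1) ^ D * 2 powr (- (2 * \<rho> - 1) * (real j - real m))))"
      proof (intro sum_mono)
        fix j assume j: "j \<in> {m<..\<Lambda>}"
        have "1 / w j = 2 powr (- (2 * \<rho> * real j + 2 * (r - \<rho>) * real m))"
          using j unfolding w_def powr_minus by (simp add: inverse_eq_divide)
        then have "1 / w j * 2 ^ j = 2 powr (- (2 * \<rho> * real j + 2 * (r - \<rho>) * real m)) * 2 powr real j"
          by (simp add: powr_realpow)
        also have "\<dots> = 2 powr ((1 - 2 * r) * real m) * 2 powr (- (2 * \<rho> - 1) * (real j - real m))"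
          unfolding powr_add[symmetric] by (simp add: algebra_simps)
        finally have eq: "1 / w j * 2 ^ j = 2 powr ((1 - 2 * r) * real m) * 2 powr (- (2 * \<rho> - 1) * (real j - real m))" .
        have "level_count TYPE('n) j * (1 / w j * 2 ^ j) \<le> (real j + 1) ^ D * (1 / w j * 2 ^ j)"
          using level_count_le[of j, where 'n = 'n] w[of j] by (intro mult_right_mono) (auto simp: D_def less_imp_le)
        then show "level_count TYPE('n) j * (1 / w j * 2 ^ j)
            \<le> 2 powr ((1 - 2 * r) * real m) * ((real j + 1) ^ D * 2 powr (- (2 * \<rho> - 1) * (real j - real m)))"
          unfolding eq by (simp only: mult_ac)
      qed
      also have "\<dots> \<le> \<tau>"
        unfolding sum_distrib_left[symmetric] \<tau>_def by (intro mult_left_mono sum1) auto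
      finally show ?thesis .
    qed
    obtain xs where xs: "length xs = 32 * N" "set xs \<subseteq> cbox 0 (1 :: real ^ 'n)"
      and ineq: "\<And>a. N / \<tau> * inner_on I a a \<le> (\<Sum>k\<in>I. d k * (a k)\<^sup>2) + 1 / (4 * \<tau>) * (\<Sum>x\<leftarrow>xs. (inner_on I a (\<lambda>k. cas k x))\<^sup>2)"
      using barrier_points[OF finI, of d \<tau> N J "cbox 0 (1 :: real ^ 'n)" "\<lambda>x k. cas k x"]
        w \<tau> N0 JI cardJ tail cas_sampling[OF finI] unfolding d_def by blast
    \<comment> \<open>The list becomes a sequence; positions beyond its length receive the point 0
      of the cube.\<close>
    define x where "x = (\<lambda>j. if j < length xs then xs ! j else 0)"
    have x: "x j \<in> cbox 0 1" for j
      using xs(2) by (auto simp: x_def mem_box_cart subset_iff)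
    have sums: "(\<Sum>x\<leftarrow>xs. (inner_on I a (\<lambda>k. cas k x))\<^sup>2) = (\<Sum>j<32 * N. (inner_on I a (\<lambda>k. cas k (x j)))\<^sup>2)" for a
      unfolding sum_list_sum_nth xs(1)[symmetric]
      by (rule sum.cong) (auto simp: x_def atLeast0LessThan)
    have LK: "N / \<tau> * K1 = 2 * 2 powr (2 * r * real m)"
    proof -
      have "real N = 2 * (2 powr real m * (real m + 1) ^ D)"
        by (simp add: N_def powr_realpow add.commute)
      moreover have "2 powr real m = 2 powr ((1 - 2 * r) * real m) * 2 powr (2 * r * real m)"
        unfolding powr_add[symmetric] by (simp add: algebra_simps)
      moreover have "(real m + 1) ^ D > 0" by simp
      ultimately show ?thesis using K1 by (simp add: \<tau>_def)
    qed
    have energy: "(\<Sum>k\<in>I. d k * (a k)\<^sup>2) \<le> (2 * Ka + 2 * Kb) * (real m + 1) ^ D"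
      if blk: "\<And>s. (\<Sum>k\<in>{k \<in> I. levs k = s}. (a k)\<^sup>2) \<le> 2 * 2 powr (- 2 * r * real (\<Sum>i\<in>UNIV. s i))" for a
    proof -
      have "(\<Sum>k\<in>I. d k * (a k)\<^sup>2) \<le> (\<Sum>j\<in>{..\<Lambda>}. level_count TYPE('n) j * (w j * (2 * 2 powr (- 2 * r * real j))))"
        unfolding d_def using blk w by (intro level_sum finI) (auto simp: I_def less_imp_le)
      also have "\<dots> \<le> (\<Sum>j\<in>{..\<Lambda>}. (real j + 1) ^ D * (w j * (2 * 2 powr (- 2 * r * real j))))"
        using level_count_le[where 'n = 'n] w by (intro sum_mono mult_right_mono) (auto simp: D_def less_imp_le)
      also have "{..\<Lambda>} = {..m} \<union> {m<..\<Lambda>}" using m\<Lambda> by auto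
      also have "(\<Sum>j\<in>{..m} \<union> {m<..\<Lambda>}. (real j + 1) ^ D * (w j * (2 * 2 powr (- 2 * r * real j)))) =
          (\<Sum>j\<in>{..m}. (real j + 1) ^ D * (w j * (2 * 2 powr (- 2 * r * real j))))
          + (\<Sum>j\<in>{m<..\<Lambda>}. (real j + 1) ^ D * (w j * (2 * 2 powr (- 2 * r * real j))))"
        by (intro sum.union_disjoint) auto
      also have "(\<Sum>j\<in>{..m}. (real j + 1) ^ D * (w j * (2 * 2 powr (- 2 * r * real j))))
          = 2 * (\<Sum>j\<in>{..m}. (real j + 1) ^ D * 2 powr (- (2 * r) * (real j - real 0)))"
        unfolding sum_distrib_left by (intro sum.cong refl) (simp add: w_def)
      also have "\<dots> \<le> 2 * (Ka * (real 0 + 1) ^ D)" by (intro mult_left_mono suma) auto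
      also have "\<dots> \<le> 2 * (Ka * (real m + 1) ^ D)"
        using Ka by (intro mult_left_mono power_mono) auto
      also have "(\<Sum>j\<in>{m<..\<Lambda>}. (real j + 1) ^ D * (w j * (2 * 2 powr (- 2 * r * real j))))
          = 2 * (\<Sum>j\<in>{m<..\<Lambda>}. (real j + 1) ^ D * 2 powr (- (2 * (r - \<rho>)) * (real j - real m)))"
        unfolding sum_distrib_left
      proof (intro sum.cong refl)
        fix j assume j: "j \<in> {m<..\<Lambda>}"
        have "w j * 2 powr (- 2 * r * real j) = 2 powr (- (2 * (r - \<rho>)) * (real j - real m))"
          using j by (simp add: w_def powr_add[symmetric] algebra_simps)
        then show "(real j + 1) ^ D * (w j * (2 * 2 powr (- 2 * r * real j)))
            = 2 * ((real j + 1) ^ D * 2 powr (- (2 * (r - \<rho>)) * (real j - real m)))"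
          by (simp add: mult_ac)
      qed
      also have "\<dots> \<le> 2 * (Kb * (real m + 1) ^ D)" by (intro mult_left_mono sumb) auto
      finally show ?thesis by (simp add: algebra_simps)
    qed
    show ?thesis
      unfolding Let_def I_def[symmetric] D_def[symmetric] N_def[symmetric]
      using \<tau> LK w x ineq[unfolded sums] energy
      by (intro exI[of _ \<tau>] exI[of _ "N / \<tau>"] exI[of _ d] exI[of _ x]) (auto simp: d_def)
  qed
  have pos: "0 < 2 * Ka + 2 * Kb" using Ka Kb by simp
  show ?thesis
    by (rule exI[of _ K1], rule conjI[OF K1], rule exI[of _ "2 * Ka + 2 * Kb"], rule conjI[OF pos])
      (intro allI impI main)
qed

text \<open>What the finite frequency set misses is treated as noise in the samples. The factor 1/(4
  \<tau>) times 32 N samples is 8 L, so noise of size \<epsilon> adds only a multiple of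
  \<epsilon>^2 to the squared error. Points and real reconstruction functions are fixed before
  \<open>l\<close>, \<open>p\<close>, \<open>f\<close> and the coordinate \<open>b\<close>, so one
  linear rule serves all coordinates.\<close>

lemma sampling_recovery:
  fixes r :: real
  assumes r: "1 / 2 < r"
  shows "\<exists>C>0. \<forall>m. \<exists>(x :: nat \<Rightarrow> real ^ 'n) (\<psi> :: nat \<Rightarrow> real ^ 'n \<Rightarrow> real).
    (\<forall>j. x j \<in> cbox 0 1) \<and> (\<forall>j. continuous_on UNIV (\<psi> j) \<and> periodic (\<psi> j)) \<and>
    (\<forall>l p b. \<forall>f :: real ^ 'n \<Rightarrow> 'a::{real_normed_field, euclidean_space}. f \<in> HN_ball l r p \<longrightarrow> 2 \<le> p \<longrightarrow> b \<in> Basis \<longrightarrow>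
      (\<integral>y. (f y \<bullet> b - (\<Sum>j<32 * (2 ^ (m + 1) * (m + 1) ^ (CARD('n) - 1)). (f (x j) \<bullet> b) * \<psi> j y))\<^sup>2 \<partial>cube)
        \<le> C * 2 powr (- 2 * r * real m) * (real m + 1) ^ (CARD('n) - 1))"
proof -
  define D where "D = CARD('n) - 1"
  obtain K1 K2 :: real where K: "0 < K1" "0 < K2" and points: "\<And>m \<Lambda>. m \<le> \<Lambda> \<Longrightarrow>
    (\<exists>(\<tau>::real) L d (x :: nat \<Rightarrow> real ^ 'n). let I = {k :: 'n \<Rightarrow> int. total_lev k \<le> \<Lambda>};
        N = 2 ^ (m + 1) * (m + 1) ^ (CARD('n) - 1) in
      0 < \<tau> \<and> L = real N / \<tau> \<and> L * K1 = 2 * 2 powr (2 * r * real m) \<and> (\<forall>k. 0 < d k) \<and> (\<forall>j. x j \<in> cbox 0 1) \<and>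
      (\<forall>a. L * inner_on I a a \<le> (\<Sum>k\<in>I. d k * (a k)\<^sup>2) + 1 / (4 * \<tau>) * (\<Sum>j<32 * N. (inner_on I a (\<lambda>k. cas k (x j)))\<^sup>2)) \<and>
      (\<forall>a. (\<forall>s. (\<Sum>k\<in>{k \<in> I. levs k = s}. (a k)\<^sup>2) \<le> 2 * 2 powr (- 2 * r * real (\<Sum>i\<in>UNIV. s i))) \<longrightarrow>
        (\<Sum>k\<in>I. d k * (a k)\<^sup>2) \<le> K2 * (real m + 1) ^ (CARD('n) - 1)))"
    using weighted_points[OF r, where 'n = 'n] by blast
  \<comment> \<open>144 and 18 are twice 72 and twice 9: noise of modulus at most 3 \<epsilon>
    enters once through the samples, where 72 is 8 times 9, and once directly.\<close>
  define C where "C = K1 * K2 + 144 + 18"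
  have C: "0 < C" unfolding C_def using K by (intro add_pos_pos mult_pos_pos) auto
  have main: "\<exists>(x :: nat \<Rightarrow> real ^ 'n) (\<psi> :: nat \<Rightarrow> real ^ 'n \<Rightarrow> real).
    (\<forall>j. x j \<in> cbox 0 1) \<and> (\<forall>j. continuous_on UNIV (\<psi> j) \<and> periodic (\<psi> j)) \<and>
    (\<forall>l p b. \<forall>f :: real ^ 'n \<Rightarrow> 'a. f \<in> HN_ball l r p \<longrightarrow> 2 \<le> p \<longrightarrow> b \<in> Basis \<longrightarrow>
      (\<integral>y. (f y \<bullet> b - (\<Sum>j<32 * (2 ^ (m + 1) * (m + 1) ^ (CARD('n) - 1)). (f (x j) \<bullet> b) * \<psi> j y))\<^sup>2 \<partial>cube)
        \<le> C * 2 powr (- 2 * r * real m) * (real m + 1) ^ (CARD('n) - 1))" for m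
  proof -
    define \<epsilon> where "\<epsilon> = 2 powr (- r * real m)"
    have \<epsilon>: "0 < \<epsilon>" and \<epsilon>2: "\<epsilon>\<^sup>2 = 2 powr (- 2 * r * real m)"
      by (simp_all add: \<epsilon>_def power2_eq_square powr_add[symmetric] algebra_simps)
    obtain \<Lambda> where \<Lambda>: "m \<le> \<Lambda>" and small: "\<And>S (a :: ('n \<Rightarrow> int) \<Rightarrow> real). finite S \<Longrightarrow>
      (\<And>s. (\<Sum>k\<in>{k \<in> S. levs k = s}. (a k)\<^sup>2) \<le> 2 * 2 powr (- 2 * r * real (\<Sum>i\<in>UNIV. s i))) \<Longrightarrow>
      (\<Sum>k\<in>{k \<in> S. \<Lambda> < total_lev k}. \<bar>a k\<bar>) \<le> \<epsilon>"
      using high_frequencies_small[OF r \<epsilon>, of m, where 'n = 'n] by blast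
    define I where "I = {k :: 'n \<Rightarrow> int. total_lev k \<le> \<Lambda>}"
    define N :: nat where "N = 2 ^ (m + 1) * (m + 1) ^ D"
    have finI: "finite I" unfolding I_def by (rule finite_total_lev)
    obtain \<tau> L d and x :: "nat \<Rightarrow> real ^ 'n" where \<tau>: "0 < \<tau>" and L: "L = real N / \<tau>" and LK: "L * K1 = 2 * 2 powr (2 * r * real m)"
      and d: "\<And>k. 0 < d k" and x: "\<And>j. x j \<in> cbox 0 1"
      and ineq: "\<And>a. L * inner_on I a a \<le> (\<Sum>k\<in>I. d k * (a k)\<^sup>2) + 1 / (4 * \<tau>) * (\<Sum>j<32 * N. (inner_on I a (\<lambda>k. cas k (x j)))\<^sup>2)"
      and energy: "\<And>a. (\<And>s. (\<Sum>k\<in>{k \<in> I. levs k = s}. (a k)\<^sup>2) \<le> 2 * 2 powr (- 2 * r * real (\<Sum>i\<in>UNIV. s i))) \<Longrightarrow>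
        (\<Sum>k\<in>I. d k * (a k)\<^sup>2) \<le> K2 * (real m + 1) ^ D"
      using points[OF \<Lambda>] unfolding Let_def I_def[symmetric] D_def[symmetric] N_def[symmetric] by blast
    have N0: "0 < N" by (simp add: N_def)
    have L0: "0 < L" using \<tau> N0 by (simp add: L)
    have s0: "0 < 1 / (4 * \<tau>)" using \<tau> by simp
    obtain \<phi> where \<phi>: "\<And>a y. L * (\<Sum>k\<in>I. (a k - (\<Sum>j<32 * N. y j * \<phi> j k))\<^sup>2)
        \<le> (\<Sum>k\<in>I. d k * (a k)\<^sup>2) + 1 / (4 * \<tau>) * (\<Sum>j<32 * N. (y j - inner_on I a (\<lambda>k. cas k (x j)))\<^sup>2)"
      using stable_recovery[OF finI d s0 L0 ineq] by blast
    define \<psi> where "\<psi> = (\<lambda>j y. \<Sum>k\<in>I. \<phi> j k * cas k y)"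
    have cont\<psi>: "continuous_on UNIV (\<psi> j)" for j unfolding \<psi>_def by (intro continuous_intros)
    have per\<psi>: "periodic (\<psi> j)" for j 
      by (simp add: periodic_def \<psi>_def periodic_cas[unfolded periodic_def, rule_format])
    have "(\<integral>y. (f y \<bullet> b - (\<Sum>j<32 * N. (f (x j) \<bullet> b) * \<psi> j y))\<^sup>2 \<partial>cube) \<le> C * 2 powr (- 2 * r * real m) * (real m + 1) ^ D"
      if f: "f \<in> HN_ball l r p" and p: "2 \<le> p" and b: "b \<in> Basis" for l p b and f :: "real ^ 'n \<Rightarrow> 'a"
    proof -
      obtain S a where S: "finite S"
        and blk: "\<And>s. (\<Sum>k\<in>{k \<in> S. levs k = s}. (a k)\<^sup>2) \<le> 2 * 2 powr (- 2 * r * real (\<Sum>i\<in>UNIV. s i))"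
        and approx: "\<And>y. y \<in> cbox 0 1 \<Longrightarrow> \<bar>f y \<bullet> b - (\<Sum>k\<in>S. a k * cas k y)\<bar> \<le> \<epsilon>"
        using hartley_approx[OF f p b \<epsilon>] by blast
      have contf: "continuous_on UNIV f" using f by (simp add: HN_ball_def)
      \<comment> \<open>\<open>S\<close> need not be contained in \<open>I\<close>, nor
        \<open>I\<close> in \<open>S\<close>; continuing by 0 gives coefficients on
        \<open>I\<close>.\<close>
      define a' where "a' = (\<lambda>k. if k \<in> S then a k else 0)"
      define \<eta> where "\<eta> = (\<lambda>y. f y \<bullet> b - (\<Sum>k\<in>I. a' k * cas k y))"
      have cont\<eta>: "continuous_on UNIV \<eta>" unfolding \<eta>_def by (intro continuous_intros contf)
      \<comment> \<open>One \<epsilon> comes from the uniform approximation and two from the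
        discarded frequencies, as \<bar>cas\<bar> is at most 2.\<close>
      have \<eta>: "\<bar>\<eta> y\<bar> \<le> 3 * \<epsilon>" if y: "y \<in> cbox 0 1" for y
      proof -
        let ?T = "{k \<in> S. \<Lambda> < total_lev k}"
        have "(\<Sum>k\<in>I. a' k * cas k y) = (\<Sum>k\<in>S - ?T. a k * cas k y)"
          using finI by (intro sum.mono_neutral_cong_right) (auto simp: a'_def I_def not_less)
        also have "\<dots> = (\<Sum>k\<in>S. a k * cas k y) - (\<Sum>k\<in>?T. a k * cas k y)"
          using S by (intro sum_diff) auto
        finally have "\<eta> y = (f y \<bullet> b - (\<Sum>k\<in>S. a k * cas k y)) + (\<Sum>k\<in>?T. a k * cas k y)"
          by (simp add: \<eta>_def)
        moreover have "\<bar>\<Sum>k\<in>?T. a k * cas k y\<bar> \<le> (\<Sum>k\<in>?T. \<bar>a k\<bar> * 2)"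
          by (intro order_trans[OF sum_abs] sum_mono) (simp add: abs_mult abs_cas_le mult_left_mono)
        moreover have "(\<Sum>k\<in>?T. \<bar>a k\<bar> * 2) \<le> \<epsilon> * 2"
          unfolding sum_distrib_right[symmetric] using small[OF S blk] by simp
        ultimately show ?thesis using approx[OF y] by linarith
      qed
      have inner_on_cas: "inner_on I a' (\<lambda>k. cas k y) = f y \<bullet> b - \<eta> y" for y by (simp add: inner_on_def \<eta>_def)
      have blk': "(\<Sum>k\<in>{k \<in> I. levs k = s}. (a' k)\<^sup>2) \<le> 2 * 2 powr (- 2 * r * real (\<Sum>i\<in>UNIV. s i))" for s
      proof -
        have "(\<Sum>k\<in>{k \<in> I. levs k = s}. (a' k)\<^sup>2) = (\<Sum>k\<in>{k \<in> I. levs k = s} \<inter> S. (a k)\<^sup>2)"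
          using finI by (intro sum.mono_neutral_cong_right) (auto simp: a'_def)
        also have "\<dots> \<le> (\<Sum>k\<in>{k \<in> S. levs k = s}. (a k)\<^sup>2)"
          using S by (intro sum_mono2) auto
        finally show ?thesis using blk[of s] by linarith
      qed
      define e where "e = (\<lambda>k. a' k - (\<Sum>j<32 * N. (f (x j) \<bullet> b) * \<phi> j k))"
      have "L * (\<Sum>k\<in>I. (e k)\<^sup>2) \<le> (\<Sum>k\<in>I. d k * (a' k)\<^sup>2) + 1 / (4 * \<tau>) * (\<Sum>j<32 * N. (f (x j) \<bullet> b - inner_on I a' (\<lambda>k. cas k (x j)))\<^sup>2)"
        unfolding e_def by (rule \<phi>)
      also have "\<dots> = (\<Sum>k\<in>I. d k * (a' k)\<^sup>2) + 1 / (4 * \<tau>) * (\<Sum>j<32 * N. (\<eta> (x j))\<^sup>2)"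
        by (simp add: inner_on_cas)
      also have "\<dots> \<le> K2 * (real m + 1) ^ D + 1 / (4 * \<tau>) * (\<Sum>j<32 * N. (3 * \<epsilon>)\<^sup>2)"
      proof (intro add_mono energy blk' mult_left_mono sum_mono)
        fix j
        have "\<bar>\<eta> (x j)\<bar>\<^sup>2 \<le> (3 * \<epsilon>)\<^sup>2" by (intro power_mono \<eta> x) simp
        then show "(\<eta> (x j))\<^sup>2 \<le> (3 * \<epsilon>)\<^sup>2" by simp
      qed (use \<tau> in simp)
      also have "1 / (4 * \<tau>) * (\<Sum>j<32 * N. (3 * \<epsilon>)\<^sup>2) = 72 * (L * \<epsilon>\<^sup>2)"
        using \<tau> by (simp add: L power_mult_distrib)
      finally have "L * (\<Sum>k\<in>I. (e k)\<^sup>2) \<le> K2 * (real m + 1) ^ D + 72 * (L * \<epsilon>\<^sup>2)" .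
      then have e1: "L * ((\<Sum>k\<in>I. (e k)\<^sup>2) - 72 * \<epsilon>\<^sup>2) \<le> K2 * (real m + 1) ^ D" by (simp add: algebra_simps)
      \<comment> \<open>The exact relation between L and \<open>K1\<close> allows L to be cancelled
        from the estimate.\<close>
      have "L * K1 * \<epsilon>\<^sup>2 = 2"
        unfolding LK \<epsilon>2 by (simp add: powr_add[symmetric])
      then have eq: "L * (K1 / 2 * \<epsilon>\<^sup>2 * (K2 * (real m + 1) ^ D)) = K2 * (real m + 1) ^ D"
        by (simp add: mult_ac)
      from e1 have "L * ((\<Sum>k\<in>I. (e k)\<^sup>2) - 72 * \<epsilon>\<^sup>2) \<le> L * (K1 / 2 * \<epsilon>\<^sup>2 * (K2 * (real m + 1) ^ D))"
        unfolding eq .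
      then have "(\<Sum>k\<in>I. (e k)\<^sup>2) - 72 * \<epsilon>\<^sup>2 \<le> K1 / 2 * \<epsilon>\<^sup>2 * (K2 * (real m + 1) ^ D)" using L0 by simp
      then have e2: "(\<Sum>k\<in>I. (e k)\<^sup>2) \<le> 72 * \<epsilon>\<^sup>2 + K1 * K2 / 2 * \<epsilon>\<^sup>2 * (real m + 1) ^ D" by (simp add: mult_ac)
      have split: "f y \<bullet> b - (\<Sum>j<32 * N. (f (x j) \<bullet> b) * \<psi> j y) = (\<Sum>k\<in>I. e k * cas k y) + \<eta> y" for y
      proof -
        have "(\<Sum>j<32 * N. (f (x j) \<bullet> b) * \<psi> j y) = (\<Sum>k\<in>I. (\<Sum>j<32 * N. (f (x j) \<bullet> b) * \<phi> j k) * cas k y)"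
          unfolding \<psi>_def sum_distrib_left sum_distrib_right by (subst sum.swap) (simp add: mult_ac)
        then show ?thesis by (simp add: e_def \<eta>_def left_diff_distrib sum_subtractf)
      qed
      have "(\<integral>y. (f y \<bullet> b - (\<Sum>j<32 * N. (f (x j) \<bullet> b) * \<psi> j y))\<^sup>2 \<partial>cube)
          \<le> (\<integral>y. 2 * (\<Sum>k\<in>I. e k * cas k y)\<^sup>2 + 18 * \<epsilon>\<^sup>2 \<partial>cube)"
        unfolding split
      proof (rule integral_mono)
        show "integrable cube (\<lambda>y. ((\<Sum>k\<in>I. e k * cas k y) + \<eta> y)\<^sup>2)"
          by (intro integrable_cube_continuous continuous_intros cont\<eta>)
        show "integrable cube (\<lambda>y. 2 * (\<Sum>k\<in>I. e k * cas k (y :: real ^ 'n))\<^sup>2 + 18 * \<epsilon>\<^sup>2)"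
          by (intro integrable_cube_continuous continuous_intros)
        fix y :: "real ^ 'n" assume "y \<in> space cube"
        then have "\<bar>\<eta> y\<bar>\<^sup>2 \<le> (3 * \<epsilon>)\<^sup>2" by (intro power_mono \<eta>) auto
        moreover have "(u + v)\<^sup>2 \<le> 2 * u\<^sup>2 + 2 * v\<^sup>2" for u v :: real
          using sum_squares_bound[of u v] by (simp add: power2_eq_square algebra_simps)
        ultimately show "((\<Sum>k\<in>I. e k * cas k y) + \<eta> y)\<^sup>2 \<le> 2 * (\<Sum>k\<in>I. e k * cas k y)\<^sup>2 + 18 * \<epsilon>\<^sup>2"
          by (simp add: power_mult_distrib) (smt (verit))
      qed
      also have "\<dots> = 2 * (\<Sum>k\<in>I. (e k)\<^sup>2) + 18 * \<epsilon>\<^sup>2"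
      proof -
        have i1: "integrable cube (\<lambda>y. 2 * (\<Sum>k\<in>I. e k * cas k (y :: real ^ 'n))\<^sup>2)"
          by (intro integrable_cube_continuous continuous_intros)
        have i2: "integrable (cube :: (real ^ 'n) measure) (\<lambda>y. 18 * \<epsilon>\<^sup>2)"
          by (intro integrable_cube_continuous continuous_intros)
        show ?thesis
          unfolding Bochner_Integration.integral_add[OF i1 i2] integral_mult_right_zero
            integral_cas_sum_square[OF finI] integral_cube_const ..
      qed
      also have "\<dots> \<le> (144 + 18) * \<epsilon>\<^sup>2 * 1 + K1 * K2 * \<epsilon>\<^sup>2 * (real m + 1) ^ D" using e2 by simp
      also have "\<dots> \<le> (144 + 18) * \<epsilon>\<^sup>2 * (real m + 1) ^ D + K1 * K2 * \<epsilon>\<^sup>2 * (real m + 1) ^ D"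
        by (intro add_right_mono mult_left_mono one_le_power) auto
      also have "\<dots> = C * \<epsilon>\<^sup>2 * (real m + 1) ^ D" by (simp add: C_def algebra_simps)
      finally show ?thesis unfolding \<epsilon>2 .
    qed
    then show ?thesis
      unfolding D_def[symmetric] N_def[symmetric] using x cont\<psi> per\<psi>
      by (intro exI[of _ x] exI[of _ \<psi>]) blast
  qed
  show ?thesis by (rule exI[of _ C], rule conjI[OF C]) (intro allI main)
qed

section \<open>From recovery in L_2 to the upper bound for the width\<close>

lemma HN_ball_Lp_norm_le:
  fixes f :: "real ^ 'n \<Rightarrow> 'a::{real_normed_field, euclidean_space}"
  assumes f: "f \<in> HN_ball l r p" and q: "0 < q" "q \<le> p"
  shows "Lp_norm q f \<le> 1"
proof -
  have cont: "continuous_on UNIV f" using f by (simp add: HN_ball_def)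
  have "Lp_norm p (mixed_difference l {} 0 f) \<le> ennreal (\<Prod>i\<in>{}. (1 :: real ^ 'n) $ i powr r)"
    by (rule HN_ball_difference_bound[OF f]) auto
  then have "Lp_norm p f \<le> ennreal 1" by (simp add: mixed_difference_empty)
  then have "(\<integral>x. norm (f x) powr p \<partial>cube) \<le> 1 powr p"
    using Lp_norm_le_iff[of p 1 f] q integrable_norm_powr[OF cont] by simp
  then have "(\<integral>x. norm (f x) powr q \<partial>cube) \<le> 1 powr q"
    using q by (intro integral_powr_mono[of q p] integrable_norm_powr[OF cont]) auto
  then have "Lp_norm q f \<le> ennreal 1"
    using Lp_norm_le_iff[of q 1 f] q integrable_norm_powr[OF cont] by simp
  then show ?thesis by simp
qed

text \<open>The rule without samples, k = 0; it settles small n in the final theorem.\<close>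

lemma linear_sampling_width_le_one:
  assumes "0 < q" "q \<le> p"
  shows "linear_sampling_width n (HN_ball l r p :: (real ^ 'n \<Rightarrow> 'a::{real_normed_field, euclidean_space}) set)
    (cbox 0 1) (Lp_space q) (Lp_norm q) \<le> 1"
  unfolding linear_sampling_width_def
  by (rule INF_lower2[of 0], simp, rule INF_lower2[of "\<lambda>_. 0"], simp, rule INF_lower2[of "\<lambda>_ _. 0"], simp)
    (auto intro!: SUP_least HN_ball_Lp_norm_le assms)

lemma Lp_space_continuous:
  fixes f :: "real ^ 'n \<Rightarrow> 'a::{real_normed_field, euclidean_space}"
  assumes cont: "continuous_on UNIV f" and per: "periodic f" and q: "0 < q"
  shows "f \<in> Lp_space q"
proof -
  have "(\<integral>\<^sup>+ x. ennreal (norm (f x) powr q) \<partial>cube) = ennreal (\<integral>x. norm (f x) powr q \<partial>cube)"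
    by (intro nn_integral_eq_integral integrable_norm_powr cont q) auto
  then have "Lp_norm q f < \<infinity>" by (simp add: Lp_norm_def)
  moreover have "f \<in> borel_measurable lebesgue"
    using borel_measurable_continuous_onI[OF cont] by (intro measurable_completion) simp
  ultimately show ?thesis using per by (simp add: Lp_space_def)
qed

lemma linear_sampling_width_upper:
  fixes r q :: real
  assumes r: "1 / 2 < r" and q: "0 < q" "q \<le> 2" 
  shows "\<exists>C>0. \<forall>m n l p. 2 \<le> p \<longrightarrow> 32 * (2 ^ (m + 1) * (m + 1) ^ (CARD('n) - 1)) \<le> n \<longrightarrow>
    linear_sampling_width n (HN_ball l r p :: (real ^ 'n \<Rightarrow> 'a::{real_normed_field, euclidean_space}) set)
      (cbox 0 1) (Lp_space q) (Lp_norm q) \<le> ennreal (C * (2 powr (- r * real m) * (real m + 1) powr (real (CARD('n) - 1) / 2)))"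
proof -
  define D where "D = CARD('n) - 1"
  obtain C0 where C0: "0 < C0" and rec: "\<And>m. \<exists>(x :: nat \<Rightarrow> real ^ 'n) (\<psi> :: nat \<Rightarrow> real ^ 'n \<Rightarrow> real).
    (\<forall>j. x j \<in> cbox 0 1) \<and> (\<forall>j. continuous_on UNIV (\<psi> j) \<and> periodic (\<psi> j)) \<and>
    (\<forall>l p b. \<forall>f :: real ^ 'n \<Rightarrow> 'a. f \<in> HN_ball l r p \<longrightarrow> 2 \<le> p \<longrightarrow> b \<in> Basis \<longrightarrow>
      (\<integral>y. (f y \<bullet> b - (\<Sum>j<32 * (2 ^ (m + 1) * (m + 1) ^ (CARD('n) - 1)). (f (x j) \<bullet> b) * \<psi> j y))\<^sup>2 \<partial>cube)
        \<le> C0 * 2 powr (- 2 * r * real m) * (real m + 1) ^ (CARD('n) - 1))"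
    using sampling_recovery[OF r, where 'n = 'n and 'a = 'a] by blast
  \<comment> \<open>All coordinates contribute the same bound to the square of the Euclidean
    norm.\<close>
  define C where "C = sqrt (DIM('a) * C0)"
  have C: "0 < C" using C0 by (simp add: C_def)
  have main: "linear_sampling_width n (HN_ball l r p :: (real ^ 'n \<Rightarrow> 'a) set)
      (cbox 0 1) (Lp_space q) (Lp_norm q) \<le> ennreal (C * (2 powr (- r * real m) * (real m + 1) powr (real D / 2)))"
    if p: "2 \<le> p" and n: "32 * (2 ^ (m + 1) * (m + 1) ^ D) \<le> n" for m n l p
  proof -
    define k where "k = 32 * (2 ^ (m + 1) * (m + 1) ^ D)"
    obtain x :: "nat \<Rightarrow> real ^ 'n" and \<psi> :: "nat \<Rightarrow> real ^ 'n \<Rightarrow> real"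
      where x: "\<And>j. x j \<in> cbox 0 1" and \<psi>: "\<And>j. continuous_on UNIV (\<psi> j)" "\<And>j. periodic (\<psi> j)"
        and err: "\<And>f b. f \<in> HN_ball l r p \<Longrightarrow> b \<in> Basis \<Longrightarrow>
          (\<integral>y. (f y \<bullet> (b :: 'a) - (\<Sum>j<k. (f (x j) \<bullet> b) * \<psi> j y))\<^sup>2 \<partial>cube) \<le> C0 * 2 powr (- 2 * r * real m) * (real m + 1) ^ D"
      using rec[of m] p unfolding D_def[symmetric] k_def[symmetric] by blast
    define B where "B = C * (2 powr (- r * real m) * (real m + 1) powr (real D / 2))"
    have B: "0 < B" using C by (simp add: B_def)
    have B2: "B\<^sup>2 = DIM('a) * (C0 * 2 powr (- 2 * r * real m) * (real m + 1) ^ D)"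
    proof -
      have "(2 powr (- r * real m))\<^sup>2 = 2 powr (- 2 * r * real m)"
        by (simp add: power2_eq_square powr_add[symmetric] algebra_simps)
      moreover have "((real m + 1) powr (real D / 2))\<^sup>2 = (real m + 1) ^ D"
        by (simp add: power2_eq_square powr_add[symmetric] powr_realpow)
      moreover have "C\<^sup>2 = DIM('a) * C0" using C0 by (simp add: C_def)
      ultimately show ?thesis by (simp add: B_def power_mult_distrib)
    qed
    \<comment> \<open>The width counts samples from 1 and the recovery from 0. A real factor
      embedded by \<open>of_real\<close> acts on all coordinates of a value of f alike.\<close>
    define \<Phi> :: "nat \<Rightarrow> real ^ 'n \<Rightarrow> 'a" where "\<Phi> = (\<lambda>i y. of_real (\<psi> (i - 1) y))"
    have cont\<Phi>: "continuous_on UNIV (\<Phi> i)" for i unfolding \<Phi>_def by (intro continuous_intros \<psi>)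
    have \<Phi>: "\<Phi> i \<in> Lp_space q" for i
      using \<psi>(2)[of "i - 1"] by (intro Lp_space_continuous cont\<Phi> q) (simp add: \<Phi>_def periodic_def)
    have bound: "Lp_norm q (\<lambda>y. f y - (\<Sum>i=1..k. f (x (i - 1)) * \<Phi> i y)) \<le> ennreal B" if f: "f \<in> HN_ball l r p" for f
    proof -
      define F where "F = (\<lambda>y. f y - (\<Sum>i=1..k. f (x (i - 1)) * \<Phi> i y))"
      have contf: "continuous_on UNIV f" using f by (simp add: HN_ball_def)
      have contF: "continuous_on UNIV F" unfolding F_def by (intro continuous_intros contf cont\<Phi>)
      have Fb: "F y \<bullet> b = f y \<bullet> b - (\<Sum>j<k. (f (x j) \<bullet> b) * \<psi> j y)" for y b
      proof -
        have "(\<Sum>i=1..k. f (x (i - 1)) * \<Phi> i y) = (\<Sum>j<k. \<psi> j y *\<^sub>R f (x j))"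
          by (rule sum.reindex_bij_witness[of _ Suc "\<lambda>i. i - 1"]) (auto simp: \<Phi>_def scaleR_conv_of_real mult.commute)
        then show ?thesis by (simp add: F_def inner_diff_left inner_sum_left mult.commute)
      qed
      have "(\<integral>y. (norm (F y))\<^sup>2 \<partial>cube) = (\<integral>y. (\<Sum>b\<in>Basis. (F y \<bullet> b)\<^sup>2) \<partial>cube)"
        by (simp add: power2_norm_eq_inner euclidean_inner[of "F _" "F _"] power2_eq_square[of "_ \<bullet> _"])
      also have "\<dots> = (\<Sum>b\<in>Basis. (\<integral>y. (F y \<bullet> b)\<^sup>2 \<partial>cube))"
        by (intro Bochner_Integration.integral_sum integrable_cube_continuous continuous_intros contF)
      also have "\<dots> \<le> (\<Sum>b\<in>(Basis :: 'a set). C0 * 2 powr (- 2 * r * real m) * (real m + 1) ^ D)"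
        unfolding Fb by (intro sum_mono err f)
      also have "\<dots> = B\<^sup>2" by (simp add: B2)
      finally have "(\<integral>y. norm (F y) powr 2 \<partial>cube) \<le> B powr 2"
        using B by (simp add: powr_numeral)
      then have "(\<integral>y. norm (F y) powr q \<partial>cube) \<le> B powr q"
        using q B by (intro integral_powr_mono[of q 2] integrable_norm_powr[OF contF]) auto
      then show ?thesis
        using Lp_norm_le_iff[of q B F] q B integrable_norm_powr[OF contF] by (simp add: F_def)
    qed
    show ?thesis
      unfolding linear_sampling_width_def B_def[symmetric]
    proof (rule INF_lower2[of k], use n in \<open>simp add: k_def\<close>, rule INF_lower2[of "\<lambda>i. x (i - 1)"], use x in \<open>simp\<close>,
        rule INF_lower2[of \<Phi>], use \<Phi> in \<open>simp\<close>)
      show "(SUP f\<in>HN_ball l r p. Lp_norm q (\<lambda>y. f y - (\<Sum>i=1..k. f (x (i - 1)) * \<Phi> i y))) \<le> ennreal B"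
        by (intro SUP_least bound)
    qed
  qed
  show ?thesis
    unfolding D_def[symmetric] by (rule exI[of _ C], rule conjI[OF C]) (intro allI impI main)
qed

section \<open>Bumps and Haar functions\<close>

definition fin_diff :: "nat \<Rightarrow> real \<Rightarrow> (real \<Rightarrow> real) \<Rightarrow> real \<Rightarrow> real" where
  "fin_diff l h g y = (\<Sum>j\<le>l. (-1) ^ (l - j) * of_nat (l choose j) * g (y + real j * h))"

lemma fin_diff_0: "fin_diff 0 h g y = g y"
  by (simp add: fin_diff_def)

text \<open>Pascal's rule. It makes a difference of order l + 1 an increment of one of order l,
  ready for the mean value inequality.\<close>

lemma fin_diff_Suc: "fin_diff (Suc l) h g y = fin_diff l h g (y + h) - fin_diff l h g y"
proof -
  define G where "G = (\<lambda>j. g (y + real j * h))"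
  define a where "a = (\<lambda>j. (-1) ^ (l - j) * of_nat (l choose j) * G j :: real)"
  define f where "f = (\<lambda>j. (-1) ^ (Suc l - j) * of_nat (Suc l choose j) * G j :: real)"
  have "fin_diff (Suc l) h g y = f 0 + (\<Sum>j\<le>l. f (Suc j))"
    by (simp only: fin_diff_def f_def G_def sum.atMost_Suc_shift)
  also have "(\<Sum>j\<le>l. f (Suc j)) = (\<Sum>j\<le>l. (-1) ^ (l - j) * of_nat (l choose j) * G (Suc j))
      + (\<Sum>j\<le>l. (-1) ^ (l - j) * of_nat (l choose Suc j) * G (Suc j))"
    by (simp add: f_def sum.distrib[symmetric] algebra_simps)
  also have "(\<Sum>j\<le>l. (-1) ^ (l - j) * of_nat (l choose Suc j) * G (Suc j)) = (\<Sum>j<l. - a (Suc j))"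
  proof -
    have "(\<Sum>j\<le>l. (-1) ^ (l - j) * of_nat (l choose Suc j) * G (Suc j))
        = (\<Sum>j<l. (-1) ^ (l - j) * of_nat (l choose Suc j) * G (Suc j))"
      by (simp add: lessThan_Suc_atMost[symmetric])
    also have "\<dots> = (\<Sum>j<l. - a (Suc j))"
    proof (intro sum.cong refl)
      fix j assume "j \<in> {..<l}"
      then have "l - j = Suc (l - Suc j)" by auto
      then show "(-1) ^ (l - j) * of_nat (l choose Suc j) * G (Suc j) = - a (Suc j)" by (simp add: a_def)
    qed
    finally show ?thesis .
  qed
  also have "f 0 + ((\<Sum>j\<le>l. (-1) ^ (l - j) * of_nat (l choose j) * G (Suc j)) + (\<Sum>j<l. - a (Suc j)))
      = (\<Sum>j\<le>l. (-1) ^ (l - j) * of_nat (l choose j) * G (Suc j)) - (a 0 + (\<Sum>j<l. a (Suc j)))"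
    by (simp add: f_def a_def sum_negf)
  also have "a 0 + (\<Sum>j<l. a (Suc j)) = (\<Sum>j\<le>l. a j)"
    by (simp add: sum.lessThan_Suc_shift[symmetric] lessThan_Suc_atMost)
  also have "(\<Sum>j\<le>l. (-1) ^ (l - j) * of_nat (l choose j) * G (Suc j)) = fin_diff l h g (y + h)"
    by (simp add: fin_diff_def G_def algebra_simps)
  finally show ?thesis by (simp add: fin_diff_def a_def G_def)
qed

lemma fin_diff_sum:
  "fin_diff l h (\<lambda>y. \<Sum>k\<in>K. c k * g k y) y = (\<Sum>k\<in>K. c k * fin_diff l h (g k) y)"
  unfolding fin_diff_def sum_distrib_left by (subst sum.swap) (simp add: mult_ac)

lemma fin_diff_rescale: "fin_diff l h (\<lambda>y. g (c * y)) y = fin_diff l (c * h) g (c * y)"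
  by (simp add: fin_diff_def algebra_simps)

lemma fin_diff_bound:
  assumes "\<And>y. \<bar>g y\<bar> \<le> B"
  shows "\<bar>fin_diff l h g y\<bar> \<le> 2 ^ l * B"
proof -
  have "\<bar>fin_diff l h g y\<bar> \<le> (\<Sum>j\<le>l. of_nat (l choose j) * B)"
    unfolding fin_diff_def
    by (intro order_trans[OF sum_abs] sum_mono) (simp add: abs_mult mult_left_mono assms)
  also have "\<dots> = 2 ^ l * B"
    using choose_row_sum[of l] by (simp add: sum_distrib_right[symmetric] flip: of_nat_sum)
  finally show ?thesis .
qed

text \<open>A monomial in sine and cosine with an independent coefficient on every unit interval.
  Differentiation stays within combinations of such functions, and the zeros of the sine at integers
  join the pieces.\<close>

definition pulse :: "(int \<Rightarrow> real) \<Rightarrow> nat \<Rightarrow> nat \<Rightarrow> real \<Rightarrow> real" where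
  "pulse c a b y = c \<lfloor>y\<rfloor> * sin (2 * pi * y) ^ a * cos (2 * pi * y) ^ b"

lemma abs_pulse_le:
  assumes "\<And>j. \<bar>c j\<bar> \<le> 1"
  shows "\<bar>pulse c a b y\<bar> \<le> \<bar>sin (2 * pi * y)\<bar> ^ a" "\<bar>pulse c a b y\<bar> \<le> 1"
proof -
  have "\<bar>pulse c a b y\<bar> = \<bar>c \<lfloor>y\<rfloor>\<bar> * \<bar>sin (2 * pi * y)\<bar> ^ a * \<bar>cos (2 * pi * y)\<bar> ^ b"
    by (simp add: pulse_def abs_mult power_abs)
  also have "\<dots> \<le> 1 * \<bar>sin (2 * pi * y)\<bar> ^ a * 1"
    by (intro mult_mono assms power_le_one) auto
  finally show *: "\<bar>pulse c a b y\<bar> \<le> \<bar>sin (2 * pi * y)\<bar> ^ a" by simp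
  have "\<bar>sin (2 * pi * y)\<bar> ^ a \<le> 1" by (intro power_le_one) auto
  with * show "\<bar>pulse c a b y\<bar> \<le> 1" by linarith
qed

lemma sin_2pi_int: "sin (2 * pi * of_int j) = 0"
  using sin_int_2pin by (simp add: mult.commute)

text \<open>Away from integers the coefficient is locally constant. At an integer it may jump, but
  the zero of the sine power of order at least two makes the derivative 0. For b = 0 the truncated b
  - 1 carries the factor 0.\<close>

lemma DERIV_pulse:
  assumes c: "\<And>j. \<bar>c j\<bar> \<le> 1" and a: "2 \<le> a"
  shows "(pulse c a b has_real_derivative
    2 * pi * (real a * pulse c (a - 1) (b + 1) y - real b * pulse c (a + 1) (b - 1) y)) (at y)"
proof (cases "y \<in> \<int>")
  case True
  then obtain j where j: "y = of_int j" by (auto elim: Ints_cases)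
  have s0: "sin (2 * pi * y) = 0" unfolding j by (rule sin_2pi_int)
  then have z: "pulse c a b y = 0" "pulse c (a - 1) (b + 1) y = 0" "pulse c (a + 1) (b - 1) y = 0"
    using a by (auto simp: pulse_def)
  have quad: "\<bar>pulse c a b x\<bar> \<le> (2 * pi)\<^sup>2 * (x - y)\<^sup>2" for x
  proof -
    have "sin (2 * pi * x) = sin (2 * pi * (x - y))"
      using s0 by (simp add: right_diff_distrib sin_diff j)
    then have "\<bar>sin (2 * pi * x)\<bar> \<le> \<bar>2 * pi * (x - y)\<bar>" by (simp only: abs_sin_x_le_abs_x)
    then have "\<bar>sin (2 * pi * x)\<bar>\<^sup>2 \<le> \<bar>2 * pi * (x - y)\<bar>\<^sup>2" by (intro power_mono) auto
    moreover have "\<bar>sin (2 * pi * x)\<bar> ^ a \<le> \<bar>sin (2 * pi * x)\<bar>\<^sup>2"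
      using a by (intro power_decreasing) auto
    ultimately show ?thesis using abs_pulse_le(1)[where c = c and a = a and b = b and y = x] c by (simp add: power_mult_distrib)
  qed
  have "((\<lambda>x. (pulse c a b x - pulse c a b y) / (x - y)) \<longlongrightarrow> 0) (at y)"
  proof (rule Lim_null_comparison)
    show "\<forall>\<^sub>F x in at y. norm ((pulse c a b x - pulse c a b y) / (x - y)) \<le> (2 * pi)\<^sup>2 * \<bar>x - y\<bar>"
      unfolding eventually_at
    proof (intro exI[of _ 1] conjI ballI impI)
      fix x assume "x \<noteq> y \<and> dist x y < 1"
      then have "\<bar>pulse c a b x\<bar> / \<bar>x - y\<bar> \<le> (2 * pi)\<^sup>2 * (x - y)\<^sup>2 / \<bar>x - y\<bar>"
        using quad[of x] by (intro divide_right_mono) auto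
      also have "(2 * pi)\<^sup>2 * (x - y)\<^sup>2 / \<bar>x - y\<bar> = (2 * pi)\<^sup>2 * \<bar>x - y\<bar>"
      proof -
        have "u\<^sup>2 / \<bar>u\<bar> = \<bar>u\<bar>" for u :: real
          by (cases "u \<ge> 0") (auto simp: power2_eq_square)
        then show ?thesis by (simp only: times_divide_eq_right[symmetric])
      qed
      finally show "norm ((pulse c a b x - pulse c a b y) / (x - y)) \<le> (2 * pi)\<^sup>2 * \<bar>x - y\<bar>"
        by (simp add: z)
    qed simp
    have "((\<lambda>x. (2 * pi)\<^sup>2 * \<bar>x - y\<bar>) \<longlongrightarrow> (2 * pi)\<^sup>2 * \<bar>y - y\<bar>) (at y)" by (intro tendsto_intros)
    then show "((\<lambda>x. (2 * pi)\<^sup>2 * \<bar>x - y\<bar>) \<longlongrightarrow> 0) (at y)" by simp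
  qed
  then show ?thesis unfolding has_field_derivative_iff z(2,3) by simp
next
  case False
  define d where "d = c \<lfloor>y\<rfloor>"
  have "((\<lambda>x. d * sin (2 * pi * x) ^ a * cos (2 * pi * x) ^ b) has_real_derivative
      2 * pi * (real a * pulse c (a - 1) (b + 1) y - real b * pulse c (a + 1) (b - 1) y)) (at y)"
    unfolding pulse_def d_def[symmetric]
    by (auto intro!: derivative_eq_intros simp: algebra_simps)
  moreover have "\<forall>\<^sub>F x in nhds y. \<lfloor>x\<rfloor> = \<lfloor>y\<rfloor>"
  proof -
    have "of_int \<lfloor>y\<rfloor> < y"
      using False Ints_of_int[of "\<lfloor>y\<rfloor>"] by (auto simp: less_le)
    moreover have "y < of_int \<lfloor>y\<rfloor> + 1" by linarith
    ultimately have "\<forall>\<^sub>F x in nhds y. x \<in> {of_int \<lfloor>y\<rfloor><..<of_int \<lfloor>y\<rfloor> + 1}"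
      by (intro eventually_nhds_in_open) auto
    then show ?thesis by eventually_elim (auto simp: floor_unique)
  qed
  then have "\<forall>\<^sub>F x in nhds y. pulse c a b x = d * sin (2 * pi * x) ^ a * cos (2 * pi * x) ^ b"
    by eventually_elim (simp add: pulse_def d_def)
  ultimately show ?thesis using DERIV_cong_ev[OF refl _ refl] by fastforce
qed

text \<open>Induction on the order by the mean value inequality: differentiation lowers the sine
  exponent by at most one, so an exponent above l lasts for l steps. The constant is independent of
  \<open>c\<close>, which later permits arbitrary signs.\<close>

lemma fin_diff_pulse:
  "l < a \<Longrightarrow> \<exists>C\<ge>0. \<forall>c h y. (\<forall>j. \<bar>c j\<bar> \<le> 1) \<longrightarrow> \<bar>fin_diff l h (pulse c a b) y\<bar> \<le> C * \<bar>h\<bar> ^ l"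
proof (induction l arbitrary: a b)
  case 0
  show ?case by (intro exI[of _ 1]) (auto simp: fin_diff_0 abs_pulse_le)
next
  case (Suc l)
  have la: "l < a - 1" "l < a + 1" using Suc.prems by auto
  obtain C1 where C1: "0 \<le> C1" "\<And>c h y. (\<And>j. \<bar>c j\<bar> \<le> 1) \<Longrightarrow> \<bar>fin_diff l h (pulse c (a - 1) (b + 1)) y\<bar> \<le> C1 * \<bar>h\<bar> ^ l"
    using Suc.IH[of "a - 1" "b + 1"] la by meson
  obtain C2 where C2: "0 \<le> C2" "\<And>c h y. (\<And>j. \<bar>c j\<bar> \<le> 1) \<Longrightarrow> \<bar>fin_diff l h (pulse c (a + 1) (b - 1)) y\<bar> \<le> C2 * \<bar>h\<bar> ^ l"
    using Suc.IH[of "a + 1" "b - 1"] la by meson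
  define C where "C = 2 * pi * (real a * C1 + real b * C2)"
  have "\<bar>fin_diff (Suc l) h (pulse c a b) y\<bar> \<le> C * \<bar>h\<bar> ^ Suc l" if c: "\<And>j. \<bar>c j\<bar> \<le> 1" for c h y
  proof -
    define P1 P2 where "P1 = pulse c (a - 1) (b + 1)" and "P2 = pulse c (a + 1) (b - 1)"
    define \<Phi>' where "\<Phi>' = (\<lambda>y. 2 * pi * (real a * fin_diff l h P1 y - real b * fin_diff l h P2 y))"
    have deriv: "(fin_diff l h (pulse c a b) has_real_derivative \<Phi>' y) (at y)" for y
    proof -
      have "((\<lambda>y. pulse c a b (y + t)) has_real_derivative 2 * pi * (real a * P1 (y + t) - real b * P2 (y + t))) (at y)" for t
        unfolding P1_def P2_def using DERIV_pulse[OF c, where a = a and b = b and y = "y + t"] Suc.prems by (simp add: DERIV_shift[symmetric] add.commute)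
      then have "(fin_diff l h (pulse c a b) has_real_derivative
          (\<Sum>j\<le>l. (-1) ^ (l - j) * of_nat (l choose j) * (2 * pi * (real a * P1 (y + real j * h) - real b * P2 (y + real j * h))))) (at y)"
        unfolding fin_diff_def by (intro DERIV_sum DERIV_cmult)
      also have "(\<Sum>j\<le>l. (-1) ^ (l - j) * of_nat (l choose j) * (2 * pi * (real a * P1 (y + real j * h) - real b * P2 (y + real j * h)))) = \<Phi>' y"
        unfolding \<Phi>'_def fin_diff_def sum_distrib_left sum_subtractf[symmetric]
        by (intro sum.cong refl) (simp add: algebra_simps)
      finally show ?thesis .
    qed
    have bound: "norm (\<Phi>' y) \<le> C * \<bar>h\<bar> ^ l" for y
    proof -
      have "norm (\<Phi>' y) \<le> 2 * pi * (real a * \<bar>fin_diff l h P1 y\<bar> + real b * \<bar>fin_diff l h P2 y\<bar>)"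
        unfolding \<Phi>'_def by (simp add: abs_mult) (intro order_trans[OF abs_triangle_ineq4] add_mono; simp add: abs_mult)
      also have "\<dots> \<le> 2 * pi * (real a * (C1 * \<bar>h\<bar> ^ l) + real b * (C2 * \<bar>h\<bar> ^ l))"
        unfolding P1_def P2_def by (intro mult_left_mono add_mono C1(2) C2(2) c) auto
      also have "\<dots> = C * \<bar>h\<bar> ^ l" by (simp add: C_def algebra_simps)
      finally show ?thesis .
    qed
    have "norm (fin_diff l h (pulse c a b) (y + h) - fin_diff l h (pulse c a b) y) \<le> (C * \<bar>h\<bar> ^ l) * norm (y + h - y)"
      by (rule field_differentiable_bound[of UNIV _ \<Phi>', OF convex_UNIV _ bound]) (auto intro: deriv)
    then show ?thesis by (simp add: fin_diff_Suc mult_ac)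
  qed
  moreover have "0 \<le> C" using C1 C2 by (simp add: C_def)
  ultimately show ?case by blast
qed

text \<open>A full period of the sine, raised to a power, on the k-th dyadic interval of length
  2^(-s), continued with period 1 by the reduction mod 2^s. For odd L it is antisymmetric about the
  midpoint of the interval.\<close>

definition bump :: "nat \<Rightarrow> nat \<Rightarrow> int \<Rightarrow> real \<Rightarrow> real" where
  "bump L s k t = of_bool (\<lfloor>2 ^ s * t\<rfloor> mod 2 ^ s = k) * sin (2 * pi * (2 ^ s * t)) ^ L"

lemma bump_eq_pulse: "bump L s k t = pulse (\<lambda>j. of_bool (j mod 2 ^ s = k)) L 0 (2 ^ s * t)"
  by (simp add: bump_def pulse_def)

lemma continuous_bump:
  assumes "2 \<le> L"
  shows "continuous_on S (bump L s k)"
proof -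
  have "continuous_on UNIV (pulse (\<lambda>j. of_bool (j mod 2 ^ s = k)) L 0)"
    by (rule DERIV_continuous_on, rule DERIV_pulse[THEN DERIV_subset[OF _ subset_UNIV], rotated 2]) (use assms in auto)
  then have "continuous_on S (\<lambda>t. pulse (\<lambda>j. of_bool (j mod 2 ^ s = k)) L 0 (2 ^ s * t))"
    by (rule continuous_on_compose2) (auto intro!: continuous_intros)
  then show ?thesis unfolding bump_eq_pulse .
qed

lemma periodic_bump: "bump L s k (t + 1) = bump L s k t"
proof -
  have "2 ^ s * (t + 1) = 2 ^ s * t + real_of_int (2 ^ s)" by (simp add: algebra_simps)
  then have "\<lfloor>2 ^ s * (t + 1)\<rfloor> mod 2 ^ s = \<lfloor>2 ^ s * t\<rfloor> mod 2 ^ s" by (simp only: floor_add_int[symmetric]) simp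
  moreover have "sin (2 * pi * (2 ^ s * (t + 1))) = sin (2 * pi * (2 ^ s * t))"
  proof -
    have "2 * pi * (2 ^ s * (t + 1)) = 2 * pi * (2 ^ s * t) + 2 * pi * of_int (2 ^ s)" by (simp add: algebra_simps)
    then show ?thesis by (simp only: sin_add sin_2pi_int cos_int_2pin mult.commute[of _ "2 * pi"])
  qed
  ultimately show ?thesis by (simp add: bump_def)
qed

text \<open>Choosing the signs of the bumps according to the signs of their differences turns the sum of
  absolute values into the difference of a single pulse train.\<close>

lemma sum_abs_fin_diff_bump:
  assumes L: "l < L"
  shows "\<exists>C\<ge>1. \<forall>s h t. (\<Sum>k\<in>{0..<2 ^ s}. \<bar>fin_diff l h (bump L s k) t\<bar>) \<le> C * min 1 ((2 ^ s * \<bar>h\<bar>) ^ l)"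
proof -
  obtain C where C: "0 \<le> C" "\<And>c h y. (\<And>j. \<bar>c j\<bar> \<le> 1) \<Longrightarrow> \<bar>fin_diff l h (pulse c L 0) y\<bar> \<le> C * \<bar>h\<bar> ^ l"
    using fin_diff_pulse[OF L, of 0] by blast
  have "(\<Sum>k\<in>{0..<2 ^ s}. \<bar>fin_diff l h (bump L s k) t\<bar>) \<le> max C (2 ^ l) * min 1 ((2 ^ s * \<bar>h\<bar>) ^ l)" for s h t
  proof -
    define \<sigma> where "\<sigma> = (\<lambda>k. sgn (fin_diff l h (bump L s k) t))"
    define c where "c = (\<lambda>j. \<sigma> (j mod 2 ^ s))"
    have c: "\<bar>c j\<bar> \<le> 1" for j by (simp add: c_def \<sigma>_def abs_sgn_eq)
    have eq: "(\<Sum>k\<in>{0..<2 ^ s}. \<sigma> k * bump L s k y) = pulse c L 0 (2 ^ s * y)" for y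
    proof -
      have "(\<Sum>k\<in>{0..<2 ^ s}. \<sigma> k * bump L s k y)
          = (\<Sum>k\<in>{0..<2 ^ s}. if \<lfloor>2 ^ s * y\<rfloor> mod 2 ^ s = k then \<sigma> k * sin (2 * pi * (2 ^ s * y)) ^ L else 0)"
        by (intro sum.cong refl) (simp add: bump_def)
      then show ?thesis by (simp add: pulse_def c_def)
    qed
    have "(\<Sum>k\<in>{0..<2 ^ s}. \<bar>fin_diff l h (bump L s k) t\<bar>) = (\<Sum>k\<in>{0..<2 ^ s}. \<sigma> k * fin_diff l h (bump L s k) t)"
      by (simp add: \<sigma>_def abs_sgn mult.commute)
    also have "\<dots> = fin_diff l h (\<lambda>y. \<Sum>k\<in>{0..<2 ^ s}. \<sigma> k * bump L s k y) t"
      by (rule fin_diff_sum[symmetric])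
    also have "\<dots> = fin_diff l (2 ^ s * h) (pulse c L 0) (2 ^ s * t)"
      unfolding eq by (rule fin_diff_rescale)
    finally have *: "(\<Sum>k\<in>{0..<2 ^ s}. \<bar>fin_diff l h (bump L s k) t\<bar>) \<le> \<bar>fin_diff l (2 ^ s * h) (pulse c L 0) (2 ^ s * t)\<bar>"
      by simp
    have "\<bar>fin_diff l (2 ^ s * h) (pulse c L 0) (2 ^ s * t)\<bar> \<le> C * \<bar>2 ^ s * h\<bar> ^ l" by (rule C(2)[OF c])
    also have "\<dots> \<le> max C (2 ^ l) * (2 ^ s * \<bar>h\<bar>) ^ l" by (intro mult_mono) (auto simp: abs_mult le_max_iff_disj)
    finally have 1: "\<bar>fin_diff l (2 ^ s * h) (pulse c L 0) (2 ^ s * t)\<bar> \<le> max C (2 ^ l) * (2 ^ s * \<bar>h\<bar>) ^ l" .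
    have "\<bar>fin_diff l (2 ^ s * h) (pulse c L 0) (2 ^ s * t)\<bar> \<le> 2 ^ l * 1" by (intro fin_diff_bound abs_pulse_le c)
    also have "\<dots> \<le> max C (2 ^ l) * 1" by simp
    finally have "\<bar>fin_diff l (2 ^ s * h) (pulse c L 0) (2 ^ s * t)\<bar> \<le> max C (2 ^ l) * min 1 ((2 ^ s * \<bar>h\<bar>) ^ l)"
      using 1 by (simp add: min_def)
    with * show ?thesis by linarith
  qed
  moreover have "1 \<le> max C (2 ^ l)" by (simp add: le_max_iff_disj)
  ultimately show ?thesis by blast
qed

section \<open>Dyadic sums behind the smoothness condition\<close>

lemma two_sided_geometric_sum:
  fixes \<beta> :: real
  assumes \<beta>: "0 < \<beta>"
  shows "\<exists>K>0. \<forall>(x::real)\<ge>0. \<forall>J. finite J \<longrightarrow> (\<Sum>s\<in>J. 2 powr (- \<beta> * \<bar>real s - x\<bar>)) \<le> K"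
proof -
  obtain K where K: "0 < K" and sumK: "\<And>m J. finite J \<Longrightarrow> \<forall>j\<in>J. m \<le> j \<Longrightarrow>
      (\<Sum>j\<in>J. (real j + 1) ^ 0 * 2 powr (- \<beta> * (real j - real m))) \<le> K * (real m + 1) ^ 0"
    using poly_geometric_sum[OF \<beta>, of 0] by blast
  have "(\<Sum>s\<in>J. 2 powr (- \<beta> * \<bar>real s - x\<bar>)) \<le> 2 powr \<beta> * (K + K)" if x: "0 \<le> x" and J: "finite J" for x J
  proof -
    define n where "n = nat \<lfloor>x\<rfloor>"
    have n: "real n \<le> x" "x < real n + 1" using x by (auto simp: n_def)
    have "(\<Sum>s\<in>J. 2 powr (- \<beta> * \<bar>real s - x\<bar>)) \<le> (\<Sum>s\<in>J. 2 powr \<beta> * 2 powr (- \<beta> * \<bar>real s - real n\<bar>))"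
    proof (rule sum_mono)
      fix s
      have "\<bar>real s - real n\<bar> \<le> \<bar>real s - x\<bar> + 1" using n by linarith
      then have "\<beta> * \<bar>real s - real n\<bar> \<le> \<beta> * (\<bar>real s - x\<bar> + 1)" using \<beta> by (intro mult_left_mono) auto
      then have "2 powr (- \<beta> * \<bar>real s - x\<bar>) \<le> 2 powr (\<beta> + - \<beta> * \<bar>real s - real n\<bar>)" by (simp add: algebra_simps)
      then show "2 powr (- \<beta> * \<bar>real s - x\<bar>) \<le> 2 powr \<beta> * 2 powr (- \<beta> * \<bar>real s - real n\<bar>)" by (simp only: powr_add)
    qed
    also have "\<dots> = 2 powr \<beta> * (\<Sum>s\<in>J. 2 powr (- \<beta> * \<bar>real s - real n\<bar>))" by (simp add: sum_distrib_left)
    also have "(\<Sum>s\<in>J. 2 powr (- \<beta> * \<bar>real s - real n\<bar>)) = (\<Sum>s\<in>{s \<in> J. n \<le> s}. 2 powr (- \<beta> * \<bar>real s - real n\<bar>))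
        + (\<Sum>s\<in>{s \<in> J. s < n}. 2 powr (- \<beta> * \<bar>real s - real n\<bar>))"
      using J by (subst sum.union_disjoint[symmetric]) (auto intro!: sum.cong)
    also have "(\<Sum>s\<in>{s \<in> J. n \<le> s}. 2 powr (- \<beta> * \<bar>real s - real n\<bar>)) \<le> K"
    proof -
      have "(\<Sum>s\<in>{s \<in> J. n \<le> s}. 2 powr (- \<beta> * \<bar>real s - real n\<bar>))
          = (\<Sum>s\<in>{s \<in> J. n \<le> s}. (real s + 1) ^ 0 * 2 powr (- \<beta> * (real s - real n)))"
        by (intro sum.cong refl) (auto simp: abs_if)
      also have "\<dots> \<le> K * (real n + 1) ^ 0" using J by (intro sumK) auto
      finally show ?thesis by simp
    qed
    also have "(\<Sum>s\<in>{s \<in> J. s < n}. 2 powr (- \<beta> * \<bar>real s - real n\<bar>)) = (\<Sum>i\<in>(\<lambda>s. n - s) ` {s \<in> J. s < n}. 2 powr (- \<beta> * real i))"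
      by (subst sum.reindex) (auto intro!: inj_onI sum.cong simp: of_nat_diff abs_if)
    also have "\<dots> \<le> K"
      using sumK[of "(\<lambda>s. n - s) ` {s \<in> J. s < n}" 0] J by simp
    finally show ?thesis by simp
  qed
  moreover have "0 < 2 powr \<beta> * (K + K)" using K by simp
  ultimately show ?thesis by blast
qed

text \<open>The terms peak at 2^(-s) near t and decay geometrically on both sides, with exponent l -
  r at coarser and r at finer scales; this is where r < l enters.\<close>

lemma dyadic_smoothness_sum:
  fixes r :: real
  assumes r: "0 < r" "r < real l"
  shows "\<exists>K\<ge>1. \<forall>t J. 0 < t \<longrightarrow> t \<le> 1 \<longrightarrow> finite J \<longrightarrow>
    (\<Sum>s\<in>J. 2 powr (- r * real s) * min 1 ((2 ^ s * t) ^ l)) \<le> K * t powr r"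
proof -
  define \<beta> where "\<beta> = min r (real l - r)"
  have \<beta>: "0 < \<beta>" using r by (simp add: \<beta>_def)
  obtain K where K: "0 < K" and sumK: "\<And>x J. 0 \<le> x \<Longrightarrow> finite J \<Longrightarrow> (\<Sum>s\<in>J. 2 powr (- \<beta> * \<bar>real s - x\<bar>)) \<le> K"
    using two_sided_geometric_sum[OF \<beta>] by blast
  have "(\<Sum>s\<in>J. 2 powr (- r * real s) * min 1 ((2 ^ s * t) ^ l)) \<le> max 1 K * t powr r"
    if t: "0 < t" "t \<le> 1" and J: "finite J" for t J
  proof -
    define x where "x = - log 2 t"
    have x: "0 \<le> x" using t by (simp add: x_def)
    have tx: "t = 2 powr (- x)" using t by (simp add: x_def)
    have "2 powr (- r * real s) * min 1 ((2 ^ s * t) ^ l) \<le> t powr r * 2 powr (- \<beta> * \<bar>real s - x\<bar>)" for s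
    proof -
      have "(2 ^ s * t) ^ l = (2 powr (real s - x)) powr real l"
        by (simp add: tx powr_realpow[symmetric] powr_add[symmetric])
      then have pow: "(2 ^ s * t) ^ l = 2 powr ((real s - x) * real l)" by (simp add: powr_powr)
      have trace_on: "t powr r = 2 powr (- x * r)" by (simp add: tx powr_powr)
      show ?thesis
      proof (cases "real s \<le> x")
        case True
        have "2 powr (- r * real s) * min 1 ((2 ^ s * t) ^ l) \<le> 2 powr (- r * real s) * 2 powr ((real s - x) * real l)"
          unfolding pow by (intro mult_left_mono) auto
        also have "\<dots> = 2 powr (- x * r) * 2 powr (- (real l - r) * (x - real s))"
          unfolding powr_add[symmetric] by (simp add: algebra_simps)
        also have "\<dots> \<le> t powr r * 2 powr (- \<beta> * \<bar>real s - x\<bar>)"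
        proof -
          have "\<beta> * (x - real s) \<le> (real l - r) * (x - real s)"
            using True by (intro mult_right_mono) (auto simp: \<beta>_def)
          then show ?thesis unfolding trace_on using True by (intro mult_left_mono) (auto simp: abs_if algebra_simps)
        qed
        finally show ?thesis .
      next
        case False
        have "2 powr (- r * real s) * min 1 ((2 ^ s * t) ^ l) \<le> 2 powr (- r * real s) * 1"
          by (intro mult_left_mono) auto
        also have "\<dots> = 2 powr (- x * r) * 2 powr (- r * (real s - x))"
          unfolding powr_add[symmetric] by (simp add: algebra_simps)
        also have "\<dots> \<le> t powr r * 2 powr (- \<beta> * \<bar>real s - x\<bar>)"
        proof -
          have "\<beta> * (real s - x) \<le> r * (real s - x)"
            using False by (intro mult_right_mono) (auto simp: \<beta>_def)
          then show ?thesis unfolding trace_on using False by (intro mult_left_mono) (auto simp: abs_if algebra_simps)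
        qed
        finally show ?thesis .
      qed
    qed
    then have "(\<Sum>s\<in>J. 2 powr (- r * real s) * min 1 ((2 ^ s * t) ^ l)) \<le> (\<Sum>s\<in>J. t powr r * 2 powr (- \<beta> * \<bar>real s - x\<bar>))"
      by (rule sum_mono)
    also have "\<dots> = t powr r * (\<Sum>s\<in>J. 2 powr (- \<beta> * \<bar>real s - x\<bar>))" by (simp add: sum_distrib_left)
    also have "\<dots> \<le> t powr r * max 1 K" using sumK[OF x J] by (intro mult_left_mono) auto
    finally show ?thesis by (simp add: mult.commute)
  qed
  then show ?thesis by (intro exI[of _ "max 1 K"]) auto
qed

section \<open>Haar functions and their pairing with bumps\<close>

definition haar :: "nat \<Rightarrow> int \<Rightarrow> real \<Rightarrow> real" where
  "haar s k t = (if \<lfloor>2 ^ Suc s * t\<rfloor> = 2 * k then 1 else if \<lfloor>2 ^ Suc s * t\<rfloor> = 2 * k + 1 then -1 else 0)"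

lemma floor_dyadic: "\<lfloor>2 ^ s * t\<rfloor> = \<lfloor>2 ^ (s + e) * t\<rfloor> div 2 ^ e" for t :: real
proof -
  have "2 ^ s * t = (2 ^ (s + e) * t) / real_of_int (2 ^ e)" by (simp add: power_add)
  then show ?thesis by (simp only: floor_divide_real_eq_div zero_le_power zero_le_numeral)
qed

lemma haar_support: "haar s k t \<noteq> 0 \<Longrightarrow> \<lfloor>2 ^ s * t\<rfloor> = k"
  using floor_dyadic[of s t 1] by (auto simp: haar_def split: if_splits)

lemma abs_haar_le: "\<bar>haar s k t\<bar> \<le> 1"
  by (simp add: haar_def)

lemma borel_measurable_haar [measurable]: "haar s k \<in> borel_measurable borel"
  unfolding haar_def by measurable

lemma sum_haar_square: "(\<Sum>k\<in>{0..<2 ^ s}. (haar s k t)\<^sup>2) \<le> 1"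
proof -
  have "(\<Sum>k\<in>{0..<2 ^ s}. (haar s k t)\<^sup>2) \<le> (\<Sum>k\<in>{0..<2 ^ s}. if k = \<lfloor>2 ^ s * t\<rfloor> then 1 else 0)"
  proof (rule sum_mono)
    fix k
    show "(haar s k t)\<^sup>2 \<le> (if k = \<lfloor>2 ^ s * t\<rfloor> then 1 else 0)"
      using haar_support[of s k t] abs_haar_le[of s k t] by (cases "haar s k t = 0") (auto simp: abs_square_le_1)
  qed
  also have "\<dots> \<le> 1" by (subst sum.delta) auto
  finally show ?thesis .
qed

lemma bump_localized:
  assumes L: "0 < L" and k: "0 \<le> k" "k < 2 ^ s"
  shows "bump L s k t * indicator {0..1} t = (if of_int k < 2 ^ s * t \<and> 2 ^ s * t < of_int k + 1 then sin (2 * pi * (2 ^ s * t)) ^ L else 0)"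
proof -
  let ?u = "2 ^ s * t"
  have k': "real_of_int k + 1 \<le> 2 ^ s"
  proof -
    have "real_of_int (k + 1) \<le> real_of_int (2 ^ s)" using k by (intro of_int_le_iff[THEN iffD2]) simp
    then show ?thesis by simp
  qed
  show ?thesis
  proof (cases "0 \<le> t \<and> t < 1")
    case True
    then have "0 \<le> ?u" "?u < 2 ^ s" by auto
    then have "0 \<le> \<lfloor>?u\<rfloor>" "\<lfloor>?u\<rfloor> < 2 ^ s" by (simp_all add: floor_less_iff)
    then have m: "\<lfloor>?u\<rfloor> mod 2 ^ s = \<lfloor>?u\<rfloor>" by simp
    show ?thesis
    proof (cases "\<lfloor>?u\<rfloor> = k")
      case eq: True
      then have b: "of_int k \<le> ?u" "?u < of_int k + 1" by (auto simp: floor_eq_iff)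
      show ?thesis
      proof (cases "?u = of_int k")
        case uk: True
        then have "sin (2 * pi * ?u) = 0" by (simp only: sin_2pi_int)
        then show ?thesis using L uk by (simp add: bump_def)
      next
        case False
        then show ?thesis using b True m eq by (simp add: bump_def)
      qed
    next
      case False
      then have "\<not> (of_int k < ?u \<and> ?u < of_int k + 1)" by (auto simp: floor_eq_iff)
      then show ?thesis using False m by (auto simp: bump_def)
    qed
  next
    case False
    have zero: "bump L s k t * indicator {0..1} t = 0"
    \<comment> \<open>At t = 1 the interval index wraps around to 0, but the sine vanishes
      there.\<close>
    proof (cases "t = 1")
      case True
      then have "sin (2 * pi * ?u) = 0" using sin_2pi_int[of "2 ^ s"] by simp
      then show ?thesis using L by (simp add: bump_def)
    qed (use False in \<open>auto simp: indicator_def\<close>)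
    have nb: "\<not> (of_int k < ?u \<and> ?u < of_int k + 1)"
    proof
      assume u: "of_int k < ?u \<and> ?u < of_int k + 1"
      then have "0 < ?u" using k by (meson le_less_trans of_int_0_le_iff)
      moreover have "?u < 2 ^ s * 1" using u k' by linarith
      ultimately have "0 < t" "t < 1" by (simp_all add: zero_less_mult_iff)
      then show False using False by simp
    qed
    show ?thesis unfolding if_not_P[OF nb] by (rule zero)
  qed
qed

definition bump_mass :: "nat \<Rightarrow> real" where
  "bump_mass L = (\<integral>y. (if 0 < y \<and> y < 1 then \<bar>sin (2 * pi * y)\<bar> ^ L else 0) \<partial>lborel)"

lemma integrable_unit_interval:
  fixes g :: "real \<Rightarrow> real"
  assumes "g \<in> borel_measurable borel" "\<And>y. \<bar>g y\<bar> \<le> 1"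
  shows "integrable lborel (\<lambda>y. if 0 < y \<and> y < 1 then g y else 0)"
proof (rule Bochner_Integration.integrable_bound)
  show "integrable lborel (indicator {0..1} :: real \<Rightarrow> real)" by simp
  show "(\<lambda>y. if 0 < y \<and> y < 1 then g y else 0) \<in> borel_measurable lborel" using assms(1) by measurable
qed (use assms(2) in \<open>auto simp: indicator_def\<close>)

lemma bump_mass_pos: "0 < bump_mass L"
proof -
  let ?f = "\<lambda>y :: real. (if 0 < y \<and> y < 1 then \<bar>sin (2 * pi * y)\<bar> ^ L else 0)"
  \<comment> \<open>On [1/12, 1/4] the angle runs from pi/6 to pi/2, so the sine is at least 1/2;
    the interval has length 1/6.\<close>
  have "(\<integral>y. (1 / 2) ^ L * indicator {1 / 12..1 / 4 :: real} y \<partial>lborel) \<le> bump_mass L"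
    unfolding bump_mass_def
  proof (rule integral_mono)
    show "integrable lborel (\<lambda>y :: real. (1 / 2) ^ L * indicator {1 / 12..1 / 4} y :: real)" by simp
    show "integrable lborel ?f" by (intro integrable_unit_interval) (auto simp: power_abs power_le_one)
    fix y :: real
    show "(1 / 2) ^ L * indicator {1 / 12..1 / 4} y \<le> ?f y"
    proof (cases "y \<in> {1 / 12..1 / 4}")
      case True
      have "sin (pi / 6) \<le> sin (2 * pi * y)"
        using True by (intro sin_monotone_2pi_le) (auto simp: field_simps)
      then have "1 / 2 \<le> \<bar>sin (2 * pi * y)\<bar>" by (simp add: sin_30)
      then have "(1 / 2) ^ L \<le> \<bar>sin (2 * pi * y)\<bar> ^ L" by (intro power_mono) auto
      then show ?thesis using True by auto
    qed auto
  qed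
  then have "(1 / 2) ^ L * (1 / 6) \<le> bump_mass L" by simp
  moreover have "(0 :: real) < (1 / 2) ^ L * (1 / 6)" by simp
  ultimately show ?thesis by linarith
qed

lemma bump_haar_substitution:
  assumes L: "0 < L" and k: "0 \<le> k" "k < 2 ^ s"
  shows "(\<integral>t. bump L s k t * haar s' k' t * indicator {0..1} t \<partial>lborel)
    = (1 / 2) ^ s * (\<integral>y. (if 0 < y \<and> y < 1 then sin (2 * pi * y) ^ L else 0) * haar s' k' ((of_int k + y) / 2 ^ s) \<partial>lborel)"
proof -
  let ?f = "\<lambda>t. bump L s k t * haar s' k' t * indicator {0..1} t"
  have "(\<integral>t. ?f t \<partial>lborel) = \<bar>(1 / 2) ^ s\<bar> *\<^sub>R (\<integral>y. ?f (of_int k / 2 ^ s + (1 / 2) ^ s * y) \<partial>lborel)"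
    by (rule lborel_integral_real_affine) simp
  also have "(\<lambda>y. ?f (of_int k / 2 ^ s + (1 / 2) ^ s * y)) =
      (\<lambda>y. (if 0 < y \<and> y < 1 then sin (2 * pi * y) ^ L else 0) * haar s' k' ((of_int k + y) / 2 ^ s))"
  proof
    fix y :: real
    let ?t = "of_int k / 2 ^ s + (1 / 2) ^ s * y"
    have t: "?t = (of_int k + y) / 2 ^ s" by (simp add: add_divide_distrib power_one_over)
    have u: "2 ^ s * ?t = of_int k + y" unfolding t by simp
    have "sin (2 * pi * (of_int k + y)) = sin (2 * pi * of_int k + 2 * pi * y)" by (simp only: distrib_left)
    also have "\<dots> = sin (2 * pi * y)"
      unfolding sin_add sin_2pi_int cos_int_2pin by simp
    finally have "sin (2 * pi * (of_int k + y)) = sin (2 * pi * y)" .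
    then have loc: "bump L s k ?t * indicator {0..1} ?t = (if 0 < y \<and> y < 1 then sin (2 * pi * y) ^ L else 0)"
      unfolding bump_localized[OF L k] u by simp
    have "?f ?t = (bump L s k ?t * indicator {0..1} ?t) * haar s' k' ?t" by (simp only: mult.assoc mult.commute mult.left_commute)
    then show "?f ?t = (if 0 < y \<and> y < 1 then sin (2 * pi * y) ^ L else 0) * haar s' k' ((of_int k + y) / 2 ^ s)"
      unfolding loc unfolding t .
  qed
  finally show ?thesis by simp
qed

text \<open>On each half of the interval the Haar function has the sign of the odd power of the
  sine, so the product is an absolute value.\<close>

lemma bump_haar_same:
  assumes L: "odd L" and k: "0 \<le> k" "k < 2 ^ s"
  shows "(\<integral>t. bump L s k t * haar s k t * indicator {0..1} t \<partial>lborel) = (1 / 2) ^ s * bump_mass L"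
proof -
  have "(\<lambda>y. (if 0 < y \<and> y < 1 then sin (2 * pi * y) ^ L else 0) * haar s k ((of_int k + y) / 2 ^ s))
      = (\<lambda>y. if 0 < y \<and> y < 1 then \<bar>sin (2 * pi * y)\<bar> ^ L else 0)"
  proof
    fix y :: real
    have fl: "\<lfloor>2 ^ Suc s * ((of_int k + y) / 2 ^ s)\<rfloor> = 2 * k + \<lfloor>2 * y\<rfloor>"
    proof -
      have "2 ^ Suc s * ((of_int k + y) / 2 ^ s) = of_int (2 * k) + 2 * y" by (simp add: field_simps)
      then show ?thesis by (simp only: floor_add_int[symmetric] int_add_floor)
    qed
    show "(if 0 < y \<and> y < 1 then sin (2 * pi * y) ^ L else 0) * haar s k ((of_int k + y) / 2 ^ s)
      = (if 0 < y \<and> y < 1 then \<bar>sin (2 * pi * y)\<bar> ^ L else 0)"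
    proof (cases "0 < y \<and> y < 1")
      case y: True
      show ?thesis
      proof (cases "y < 1 / 2")
        case True
        then have "\<lfloor>2 * y\<rfloor> = 0" using y by (simp add: floor_eq_iff)
        moreover have "0 \<le> sin (2 * pi * y)" using True y by (intro sin_ge_zero) auto
        ultimately show ?thesis using y unfolding haar_def fl by simp
      next
        case False
        then have "\<lfloor>2 * y\<rfloor> = 1" using y by (simp add: floor_eq_iff)
        moreover have "sin (2 * pi * y) \<le> 0" using False y by (intro sin_le_zero) auto
        ultimately show ?thesis using y L odd_pos[OF L] unfolding haar_def fl by (simp add: abs_if)
      qed
    qed auto
  qed
  moreover have "0 < L" using L by (cases L) auto
  ultimately show ?thesis using bump_haar_substitution[OF _ k, of L s k] by (simp add: bump_mass_def)
qed

text \<open>The coarser Haar function is constant on the interval of the bump, and the bump has mean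
  zero by antisymmetry under the reflection of y to 1 - y.\<close>

lemma bump_haar_finer:
  assumes L: "odd L" and k: "0 \<le> k" "k < 2 ^ s" and s: "s' < s"
  shows "(\<integral>t. bump L s k t * haar s' k' t * indicator {0..1} t \<partial>lborel) = 0"
proof -
  let ?g = "\<lambda>y :: real. if 0 < y \<and> y < 1 then sin (2 * pi * y) ^ L else 0"
  \<comment> \<open>A Haar function of level s' is constant on cells of level s' + 1, so this counts
    the halvings from there to level s.\<close>
  define e where "e = s - Suc s'"
  define v where "v = (if k div 2 ^ e = 2 * k' then 1 else if k div 2 ^ e = 2 * k' + 1 then -1 else 0 :: real)"
  have "(\<lambda>y. ?g y * haar s' k' ((of_int k + y) / 2 ^ s)) = (\<lambda>y. ?g y * v)"
  proof
    fix y :: real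
    show "?g y * haar s' k' ((of_int k + y) / 2 ^ s) = ?g y * v"
    proof (cases "0 < y \<and> y < 1")
      case True
      have "\<lfloor>2 ^ Suc s' * ((of_int k + y) / 2 ^ s)\<rfloor> = \<lfloor>2 ^ (Suc s' + e) * ((of_int k + y) / 2 ^ s)\<rfloor> div 2 ^ e"
        by (rule floor_dyadic)
      also have "Suc s' + e = s" using s by (simp add: e_def)
      also have "\<lfloor>2 ^ s * ((of_int k + y) / 2 ^ s)\<rfloor> = k" using True by (simp add: floor_eq_iff)
      finally show ?thesis unfolding haar_def v_def by simp
    qed auto
  qed
  moreover have "(\<integral>y. ?g y \<partial>lborel) = 0"
  proof -
    have "(\<integral>y. ?g y \<partial>lborel) = \<bar>-1\<bar> *\<^sub>R (\<integral>y. ?g (1 + (-1) * y) \<partial>lborel)"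
      by (rule lborel_integral_real_affine) simp
    also have "(\<lambda>y. ?g (1 + (-1) * y)) = (\<lambda>y. - ?g y)"
    proof
      fix y :: real
      have "sin (2 * pi * (1 + (-1) * y)) = - sin (2 * pi * y)"
        by (simp add: right_diff_distrib sin_diff)
      then show "?g (1 + (-1) * y) = - ?g y" using L by (simp add: power_minus_odd)
    qed
    finally show ?thesis by simp
  qed
  moreover have "0 < L" using L by (cases L) auto
  ultimately show ?thesis using bump_haar_substitution[OF _ k, of L s' k'] by simp
qed

lemma bump_haar_disjoint:
  assumes L: "0 < L" and k: "0 \<le> k" "k < 2 ^ s" and kk': "k \<noteq> k'"
  shows "(\<integral>t. bump L s k t * haar s k' t * indicator {0..1} t \<partial>lborel) = 0"
proof -
  have eq: "bump L s k t * haar s k' t * indicator {0..1} t = 0" for t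
  proof (rule ccontr)
    assume nz: "bump L s k t * haar s k' t * indicator {0..1} t \<noteq> 0"
    then have "\<lfloor>2 ^ s * t\<rfloor> = k'" by (intro haar_support) auto
    moreover have "bump L s k t * indicator {0..1} t \<noteq> 0" using nz by auto
    then have "of_int k < 2 ^ s * t \<and> 2 ^ s * t < of_int k + 1"
      unfolding bump_localized[OF L k] by (auto split: if_splits)
    then have "\<lfloor>2 ^ s * t\<rfloor> = k" by (simp add: floor_eq_iff)
    ultimately show False using kk' by simp
  qed
  show ?thesis unfolding eq by simp
qed

text \<open>Fubini for tensor products. Lebesgue measure on vectors is a product measure indexed by
  basis vectors, so the coordinate index has to be recovered from the basis vector.\<close>

lemma integral_cube_prod:
  fixes g :: "'n::finite \<Rightarrow> real \<Rightarrow> real"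
  assumes meas: "\<And>i. g i \<in> borel_measurable borel" and bdd: "\<And>i t. \<bar>g i t\<bar> \<le> 1"
  shows "(\<integral>x. (\<Prod>i\<in>UNIV. g i (x $ i)) \<partial>(cube :: (real ^ 'n) measure)) = (\<Prod>i\<in>UNIV. \<integral>t. g i t * indicator {0..1} t \<partial>lborel)"
proof -
  note [measurable] = meas
  define G where "G = (\<lambda>i t. g i t * indicator {0..1} t :: real)"
  have G [measurable]: "G i \<in> borel_measurable borel" for i unfolding G_def by measurable
  have nth [measurable]: "(\<lambda>x :: real ^ 'n. x $ i) \<in> borel_measurable borel" for i
    by (intro borel_measurable_continuous_onI continuous_intros)
  have ind: "indicator (cbox 0 1) x = (\<Prod>i\<in>UNIV. indicator {0..1} (x $ i) :: real)" for x :: "real ^ 'n"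
  proof (cases "x \<in> cbox 0 1")
    case True
    then show ?thesis by (simp add: mem_box_cart indicator_def)
  next
    case False
    then obtain i where "\<not> (0 \<le> x $ i \<and> x $ i \<le> 1)" by (auto simp: mem_box_cart)
    then have "(\<Prod>i\<in>UNIV. indicator {0..1} (x $ i) :: real) = 0"
      by (intro prod_zero) (auto simp: indicator_def)
    then show ?thesis using False by simp
  qed
  have "(\<integral>x. (\<Prod>i\<in>UNIV. g i (x $ i)) \<partial>(cube :: (real ^ 'n) measure)) = (\<integral>x. indicator (cbox 0 1) x *\<^sub>R (\<Prod>i\<in>UNIV. g i (x $ i)) \<partial>(lebesgue :: (real ^ 'n) measure))"
    by (rule integral_restrict_space) simp
  also have "\<dots> = (\<integral>x. (\<Prod>i\<in>UNIV. G i (x $ i)) \<partial>(lebesgue :: (real ^ 'n) measure))"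
    by (simp add: ind G_def prod.distrib mult.commute)
  also have "\<dots> = (\<integral>x. (\<Prod>i\<in>UNIV. G i (x $ i)) \<partial>(lborel :: (real ^ 'n) measure))"
    by (rule integral_completion) measurable
  also have "\<dots> = (\<integral>f. (\<Prod>i\<in>UNIV. G i ((\<Sum>b\<in>Basis. f b *\<^sub>R b) $ i)) \<partial>(\<Pi>\<^sub>M b\<in>(Basis :: (real ^ 'n) set). lborel))"
    by (subst lborel_eq, subst integral_distr) measurable
  also have "\<dots> = (\<integral>f. (\<Prod>b\<in>Basis. G (THE i. b = axis i 1) (f b)) \<partial>(\<Pi>\<^sub>M b\<in>(Basis :: (real ^ 'n) set). lborel))"
  proof (intro Bochner_Integration.integral_cong refl)
    fix f :: "real ^ 'n \<Rightarrow> real"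
    have Basis: "(Basis :: (real ^ 'n) set) = (\<lambda>i. axis i 1) ` UNIV"
      by (auto simp: Basis_vec_def)
    have inj: "inj (\<lambda>i. axis i 1 :: real ^ 'n)" by (auto simp: inj_on_def axis_eq_axis)
    have "(\<Sum>b\<in>Basis. f b *\<^sub>R b) $ i = f (axis i 1)" for i
    proof -
      have "(\<Sum>b\<in>Basis. f b *\<^sub>R b) $ i = (\<Sum>b\<in>Basis. f b *\<^sub>R b) \<bullet> axis i 1" by (simp add: cart_eq_inner_axis)
      also have "\<dots> = f (axis i 1)" by (rule inner_sum_left_Basis) (auto simp: Basis)
      finally show ?thesis .
    qed
    then have "(\<Prod>i\<in>UNIV. G i ((\<Sum>b\<in>Basis. f b *\<^sub>R b) $ i)) = (\<Prod>i\<in>UNIV. G i (f (axis i 1)))" by simp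
    also have "\<dots> = (\<Prod>b\<in>Basis. G (THE i. b = axis i 1) (f b))"
      unfolding Basis by (subst prod.reindex[OF inj]) (simp add: axis_eq_axis)
    finally show "(\<Prod>i\<in>UNIV. G i ((\<Sum>b\<in>Basis. f b *\<^sub>R b) $ i)) = (\<Prod>b\<in>Basis. G (THE i. b = axis i 1) (f b))" .
  qed
  also have "\<dots> = (\<Prod>b\<in>(Basis :: (real ^ 'n) set). \<integral>t. G (THE i. b = axis i 1) t \<partial>lborel)"
  proof -
    interpret product_sigma_finite "\<lambda>_ :: real ^ 'n. lborel :: real measure" by standard
    show ?thesis
    proof (rule product_integral_prod)
      fix b :: "real ^ 'n"
      show "integrable lborel (G (THE i. b = axis i 1))"
      proof (rule Bochner_Integration.integrable_bound)
        show "integrable lborel (indicator {0..1} :: real \<Rightarrow> real)" by simp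
      qed (use bdd in \<open>auto simp: G_def abs_mult indicator_def\<close>)
    qed simp
  qed
  also have "\<dots> = (\<Prod>i\<in>UNIV. \<integral>t. G i t \<partial>lborel)"
  proof -
    have Basis: "(Basis :: (real ^ 'n) set) = (\<lambda>i. axis i 1) ` UNIV"
      by (auto simp: Basis_vec_def)
    have inj: "inj (\<lambda>i. axis i 1 :: real ^ 'n)" by (auto simp: inj_on_def axis_eq_axis)
    show ?thesis unfolding Basis by (subst prod.reindex[OF inj]) (simp add: axis_eq_axis)
  qed
  finally show ?thesis by (simp add: G_def)
qed

section \<open>Tensor products and the lower bound\<close>

lemma partial_difference_tensor:
  fixes g :: "'b \<Rightarrow> 'n::finite \<Rightarrow> real \<Rightarrow> real"
  shows "partial_difference l i s (\<lambda>x. of_real (\<Sum>\<iota>\<in>I. c \<iota> * (\<Prod>j\<in>UNIV. g \<iota> j (x $ j))) :: 'a::{real_normed_field, euclidean_space})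
    = (\<lambda>x. of_real (\<Sum>\<iota>\<in>I. c \<iota> * (\<Prod>j\<in>UNIV. ((g \<iota>)(i := fin_diff l s (g \<iota> i))) j (x $ j))))"
proof
  fix x :: "real ^ 'n"
  have split: "(\<Prod>j\<in>UNIV. f j) = f i * (\<Prod>j\<in>UNIV - {i}. f j)" for f :: "'n \<Rightarrow> real"
    by (rule prod.remove) auto
  define R where "R = (\<lambda>\<iota>. \<Prod>j\<in>UNIV - {i}. g \<iota> j (x $ j))"
  have shifted: "(\<Prod>j\<in>UNIV. g \<iota> j ((x + axis i t) $ j)) = g \<iota> i (x $ i + t) * R \<iota>" for \<iota> t
    unfolding split R_def by (intro arg_cong2[of _ _ _ _ times] prod.cong) (auto simp: axis_def)
  have "partial_difference l i s (\<lambda>x. of_real (\<Sum>\<iota>\<in>I. c \<iota> * (\<Prod>j\<in>UNIV. g \<iota> j (x $ j))) :: 'a) x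
      = of_real (\<Sum>a\<le>l. (-1) ^ (l - a) * of_nat (l choose a) * (\<Sum>\<iota>\<in>I. c \<iota> * (g \<iota> i (x $ i + real a * s) * R \<iota>)))"
    unfolding partial_difference_def shifted by simp
  also have "(\<Sum>a\<le>l. (-1) ^ (l - a) * of_nat (l choose a) * (\<Sum>\<iota>\<in>I. c \<iota> * (g \<iota> i (x $ i + real a * s) * R \<iota>)))
      = (\<Sum>\<iota>\<in>I. c \<iota> * (fin_diff l s (g \<iota> i) (x $ i) * R \<iota>))"
    unfolding fin_diff_def sum_distrib_left sum_distrib_right by (subst sum.swap) (simp add: mult_ac)
  also have "\<dots> = (\<Sum>\<iota>\<in>I. c \<iota> * (\<Prod>j\<in>UNIV. ((g \<iota>)(i := fin_diff l s (g \<iota> i))) j (x $ j)))"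
  proof (intro sum.cong refl arg_cong2[of _ _ _ _ times])
    fix \<iota>
    show "fin_diff l s (g \<iota> i) (x $ i) * R \<iota> = (\<Prod>j\<in>UNIV. ((g \<iota>)(i := fin_diff l s (g \<iota> i))) j (x $ j))"
      unfolding split R_def by (intro arg_cong2[of _ _ _ _ times] prod.cong) auto
  qed
  finally show "partial_difference l i s (\<lambda>x. of_real (\<Sum>\<iota>\<in>I. c \<iota> * (\<Prod>j\<in>UNIV. g \<iota> j (x $ j))) :: 'a) x
    = of_real (\<Sum>\<iota>\<in>I. c \<iota> * (\<Prod>j\<in>UNIV. ((g \<iota>)(i := fin_diff l s (g \<iota> i))) j (x $ j)))" .
qed

lemma mixed_difference_tensor:
  fixes g :: "'b \<Rightarrow> 'n::finite \<Rightarrow> real \<Rightarrow> real"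
  shows "mixed_difference l u h (\<lambda>x. of_real (\<Sum>\<iota>\<in>I. c \<iota> * (\<Prod>j\<in>UNIV. g \<iota> j (x $ j))) :: 'a::{real_normed_field, euclidean_space})
    = (\<lambda>x. of_real (\<Sum>\<iota>\<in>I. c \<iota> * (\<Prod>j\<in>UNIV. (if j \<in> u then fin_diff l (h $ j) (g \<iota> j) else g \<iota> j) (x $ j))))"
  using finite[of u]
proof (induction u)
  case empty
  then show ?case by (simp add: mixed_difference_empty)
next
  case (insert i u)
  have eq: "(\<lambda>j. if j \<in> u then fin_diff l (h $ j) (g \<iota> j) else g \<iota> j)(i := fin_diff l (h $ i) (if i \<in> u then fin_diff l (h $ i) (g \<iota> i) else g \<iota> i))
      = (\<lambda>j. if j \<in> insert i u then fin_diff l (h $ j) (g \<iota> j) else g \<iota> j)" for \<iota>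
    using insert(2) by (auto simp: fun_eq_iff)
  show ?case
    unfolding mixed_difference_insert[OF insert(2)] insert(3)
      partial_difference_tensor[where g = "\<lambda>\<iota> j. if j \<in> u then fin_diff l (h $ j) (g \<iota> j) else g \<iota> j"] eq ..
qed

section \<open>Dyadic boxes of volume 2^(-m), given by their levels and positions\<close>

definition idx :: "nat \<Rightarrow> (('n::finite \<Rightarrow> nat) \<times> ('n \<Rightarrow> int)) set" where
  "idx m = (SIGMA s:{s. (\<Sum>i\<in>UNIV. s i) = m}. PiE UNIV (\<lambda>i. {0..<2 ^ s i}))"

lemma finite_idx: "finite (idx m)"
  unfolding idx_def by (intro finite_SigmaI finite_level finite_PiE) auto

lemma idx_pos:
  assumes "\<iota> \<in> idx m"
  shows "0 \<le> snd \<iota> i" "snd \<iota> i < 2 ^ fst \<iota> i" "(\<Sum>i\<in>UNIV. fst \<iota> i) = m"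
  using assms by (auto simp: idx_def PiE_iff split: prod.splits)

lemma card_idx: "card (idx m :: (('n::finite \<Rightarrow> nat) \<times> ('n \<Rightarrow> int)) set) = level_count TYPE('n) m * 2 ^ m"
proof -
  have "card (idx m :: (('n \<Rightarrow> nat) \<times> ('n \<Rightarrow> int)) set)
      = (\<Sum>s\<in>{s :: 'n \<Rightarrow> nat. (\<Sum>i\<in>UNIV. s i) = m}. card (PiE UNIV (\<lambda>i. {0..<2 ^ s i :: int})))"
    unfolding idx_def by (intro card_SigmaI finite_level ballI finite_PiE) auto
  also have "\<dots> = (\<Sum>s\<in>{s :: 'n \<Rightarrow> nat. (\<Sum>i\<in>UNIV. s i) = m}. 2 ^ m)"
  proof (intro sum.cong refl)
    fix s :: "'n \<Rightarrow> nat" assume "s \<in> {s. (\<Sum>i\<in>UNIV. s i) = m}"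
    then show "card (PiE UNIV (\<lambda>i. {0..<2 ^ s i :: int})) = 2 ^ m"
      by (simp add: card_PiE nat_power_eq power_sum[symmetric])
  qed
  finally show ?thesis by (simp add: level_count_def)
qed

text \<open>Relaxing the constraint on the total level to a bound on each level makes the sum
  factor. In the application the factors are bounded uniformly in m, so nothing essential is
  lost.\<close>

lemma sum_idx_prod_le:
  fixes \<phi> :: "'n::finite \<Rightarrow> nat \<Rightarrow> int \<Rightarrow> real"
  assumes \<phi>: "\<And>i a k. 0 \<le> \<phi> i a k"
  shows "(\<Sum>\<iota>\<in>idx m. \<Prod>i\<in>UNIV. \<phi> i (fst \<iota> i) (snd \<iota> i)) \<le> (\<Prod>i\<in>UNIV. \<Sum>a\<le>m. \<Sum>k\<in>{0..<2 ^ a}. \<phi> i a k)"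
proof -
  have "(\<Sum>\<iota>\<in>idx m. \<Prod>i\<in>UNIV. \<phi> i (fst \<iota> i) (snd \<iota> i))
      = (\<Sum>s\<in>{s. (\<Sum>i\<in>UNIV. s i) = m}. \<Sum>k\<in>PiE UNIV (\<lambda>i. {0..<2 ^ s i}). \<Prod>i\<in>UNIV. \<phi> i (s i) (k i))"
    unfolding idx_def by (subst sum.Sigma) (auto intro!: finite_level finite_PiE sum.cong)
  also have "\<dots> = (\<Sum>s\<in>{s. (\<Sum>i\<in>UNIV. s i) = m}. \<Prod>i\<in>UNIV. \<Sum>k\<in>{0..<2 ^ s i}. \<phi> i (s i) k)"
    by (intro sum.cong refl prod_sum_PiE[symmetric]) auto
  also have "\<dots> \<le> (\<Sum>s\<in>PiE UNIV (\<lambda>_. {..m}). \<Prod>i\<in>UNIV. \<Sum>k\<in>{0..<2 ^ s i}. \<phi> i (s i) k)"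
  proof (rule sum_mono2)
    show "{s :: 'n \<Rightarrow> nat. (\<Sum>i\<in>UNIV. s i) = m} \<subseteq> PiE UNIV (\<lambda>_. {..m})"
    proof
      fix s :: "'n \<Rightarrow> nat" assume "s \<in> {s. (\<Sum>i\<in>UNIV. s i) = m}"
      then have "s i \<le> m" for i using member_le_sum[of i UNIV s] by auto
      then show "s \<in> PiE UNIV (\<lambda>_. {..m})" by (auto simp: PiE_def extensional_def)
    qed
  qed (auto intro!: finite_PiE prod_nonneg sum_nonneg \<phi>)
  also have "\<dots> = (\<Prod>i\<in>UNIV. \<Sum>a\<le>m. \<Sum>k\<in>{0..<2 ^ a}. \<phi> i a k)"
    by (intro prod_sum_PiE[symmetric]) auto
  finally show ?thesis .
qed

definition tensor_haar :: "('n::finite \<Rightarrow> nat) \<times> ('n \<Rightarrow> int) \<Rightarrow> real ^ 'n \<Rightarrow> real" where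
  "tensor_haar \<iota> x = (\<Prod>i\<in>UNIV. haar (fst \<iota> i) (snd \<iota> i) (x $ i))"

definition tensor_bump :: "nat \<Rightarrow> ('n::finite \<Rightarrow> nat) \<times> ('n \<Rightarrow> int) \<Rightarrow> real ^ 'n \<Rightarrow> real" where
  "tensor_bump L \<iota> x = (\<Prod>i\<in>UNIV. bump L (fst \<iota> i) (snd \<iota> i) (x $ i))"

text \<open>Boxes of the same shape do not overlap, so each shape contributes at most 1 at the point
  x.\<close>

lemma sum_tensor_haar_square:
  "(\<Sum>\<iota>\<in>idx m. (tensor_haar \<iota> (x :: real ^ 'n))\<^sup>2) \<le> level_count TYPE('n) m"
proof -
  have "(\<Sum>\<iota>\<in>idx m. (tensor_haar \<iota> x)\<^sup>2)
      = (\<Sum>s\<in>{s. (\<Sum>i\<in>UNIV. s i) = m}. \<Sum>k\<in>PiE UNIV (\<lambda>i. {0..<2 ^ s i}). \<Prod>i\<in>UNIV. (haar (s i) (k i) (x $ i))\<^sup>2)"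
    unfolding idx_def tensor_haar_def prod_power_distrib
    by (subst sum.Sigma) (auto intro!: finite_level finite_PiE sum.cong)
  also have "\<dots> = (\<Sum>s\<in>{s. (\<Sum>i\<in>UNIV. s i) = m}. \<Prod>i\<in>UNIV. \<Sum>k\<in>{0..<2 ^ s i}. (haar (s i) k (x $ i))\<^sup>2)"
    by (intro sum.cong refl prod_sum_PiE[symmetric]) auto
  also have "\<dots> \<le> (\<Sum>s\<in>{s :: 'n \<Rightarrow> nat. (\<Sum>i\<in>UNIV. s i) = m}. 1)"
    by (intro sum_mono prod_le_1 conjI sum_nonneg sum_haar_square) auto
  also have "\<dots> = level_count TYPE('n) m" by (simp add: level_count_def)
  finally show ?thesis .
qed

lemma abs_tensor_haar_le: "\<bar>tensor_haar \<iota> x\<bar> \<le> 1"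
  unfolding tensor_haar_def abs_prod by (intro prod_le_1 conjI abs_haar_le) auto

lemma borel_measurable_tensor_haar: "tensor_haar \<iota> \<in> borel_measurable cube"
proof -
  have [measurable]: "(\<lambda>x :: real ^ 'a. x $ i) \<in> borel_measurable borel" for i
    by (intro borel_measurable_continuous_onI continuous_intros)
  have "tensor_haar \<iota> \<in> borel_measurable borel" unfolding tensor_haar_def by measurable
  then have "tensor_haar \<iota> \<in> borel_measurable lebesgue" by (intro measurable_completion) simp
  then show ?thesis by (rule measurable_restrict_space1)
qed

lemma continuous_tensor_bump: "2 \<le> L \<Longrightarrow> continuous_on S (tensor_bump L \<iota>)"
  unfolding tensor_bump_def
  by (intro continuous_on_prod continuous_on_compose2[OF continuous_bump[of L UNIV]] continuous_intros) auto

lemma abs_bump_le: "\<bar>bump L s k t\<bar> \<le> 1"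
  unfolding bump_eq_pulse by (rule abs_pulse_le) simp

text \<open>If two different level vectors have the same sum, the bump is strictly finer in some
  coordinate, where its integral against the Haar function vanishes. For equal levels some position
  differs, and the one-dimensional supports are disjoint there.\<close>

lemma tensor_bump_haar:
  assumes L: "odd L" "2 \<le> L" and \<iota>: "\<iota> \<in> idx m" "\<iota>' \<in> idx m"
  shows "(\<integral>x. tensor_bump L \<iota> x * tensor_haar \<iota>' x \<partial>(cube :: (real ^ 'n) measure))
    = (if \<iota> = \<iota>' then bump_mass L ^ CARD('n) * (1 / 2) ^ m else 0)"
proof -
  have L0: "0 < L" using L by simp
  let ?J = "\<lambda>i. \<integral>t. bump L (fst \<iota> i) (snd \<iota> i) t * haar (fst \<iota>' i) (snd \<iota>' i) t * indicator {0..1} t \<partial>lborel"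
  have "(\<integral>x. tensor_bump L \<iota> x * tensor_haar \<iota>' x \<partial>(cube :: (real ^ 'n) measure))
      = (\<integral>x. (\<Prod>i\<in>UNIV. bump L (fst \<iota> i) (snd \<iota> i) (x $ i) * haar (fst \<iota>' i) (snd \<iota>' i) (x $ i)) \<partial>(cube :: (real ^ 'n) measure))"
    by (simp add: tensor_bump_def tensor_haar_def prod.distrib)
  also have "\<dots> = (\<Prod>i\<in>UNIV. ?J i)"
  proof (rule integral_cube_prod)
    fix i
    show "(\<lambda>t. bump L (fst \<iota> i) (snd \<iota> i) t * haar (fst \<iota>' i) (snd \<iota>' i) t) \<in> borel_measurable borel"
      by (intro borel_measurable_times borel_measurable_continuous_onI continuous_bump L borel_measurable_haar)
    show "\<bar>bump L (fst \<iota> i) (snd \<iota> i) t * haar (fst \<iota>' i) (snd \<iota>' i) t\<bar> \<le> 1" for t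
      unfolding abs_mult by (intro mult_le_one abs_bump_le abs_haar_le) auto
  qed
  also have "\<dots> = (if \<iota> = \<iota>' then bump_mass L ^ CARD('n) * (1 / 2) ^ m else 0)"
  proof (cases "\<iota> = \<iota>'")
    case True
    have "?J i = (1 / 2) ^ fst \<iota> i * bump_mass L" for i
      using True bump_haar_same[OF L(1) idx_pos(1,2)[OF \<iota>(1), of i]] by simp
    then have "(\<Prod>i\<in>UNIV. ?J i) = (1 / 2) ^ (\<Sum>i\<in>UNIV. fst \<iota> i) * bump_mass L ^ CARD('n)"
      by (simp add: prod.distrib power_sum)
    then show ?thesis using True idx_pos(3)[OF \<iota>(1)] by simp
  next
    case False
    have "\<exists>i. ?J i = 0"
    proof (cases "fst \<iota> = fst \<iota>'")
      case eq: True
      then obtain i where "snd \<iota> i \<noteq> snd \<iota>' i" using False by (metis ext prod.expand)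
      then show ?thesis using eq bump_haar_disjoint[OF L0 idx_pos(1,2)[OF \<iota>(1), of i]] by metis
    next
      case ne: False
      have "\<exists>i. fst \<iota>' i < fst \<iota> i"
      proof (rule ccontr)
        assume "\<nexists>i. fst \<iota>' i < fst \<iota> i"
        then have le: "fst \<iota> i \<le> fst \<iota>' i" for i by (meson not_less)
        obtain i where "fst \<iota> i \<noteq> fst \<iota>' i" using ne by auto
        then have "fst \<iota> i < fst \<iota>' i" using le[of i] by simp
        then have "(\<Sum>i\<in>UNIV. fst \<iota> i) < (\<Sum>i\<in>UNIV. fst \<iota>' i)"
          using le by (intro sum_strict_mono_ex1) auto
        then show False using idx_pos(3)[OF \<iota>(1)] idx_pos(3)[OF \<iota>(2)] by simp
      qed
      then obtain i where "fst \<iota>' i < fst \<iota> i" by blast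
      then show ?thesis using bump_haar_finer[OF L(1) idx_pos(1,2)[OF \<iota>(1), of i]] by blast
    qed
    then have "(\<Prod>i\<in>UNIV. ?J i) = 0" by (auto intro: prod_zero)
    then show ?thesis using False by simp
  qed
  finally show ?thesis .
qed

section \<open>Test functions in the unit ball\<close>

definition wave :: "nat \<Rightarrow> real \<Rightarrow> nat \<Rightarrow> (('n::finite \<Rightarrow> nat) \<times> ('n \<Rightarrow> int) \<Rightarrow> real) \<Rightarrow> real ^ 'n \<Rightarrow> real" where
  "wave L \<theta> m \<epsilon> x = (\<Sum>\<iota>\<in>idx m. (\<theta> * \<epsilon> \<iota>) * tensor_bump L \<iota> x)"

text \<open>The bound on differences is pointwise, hence valid for every p and all coefficients of
  modulus at most 1. The amplitude 2^(-r m) splits into factors 2^(-r s_i), after which the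
  coordinates decouple and each gives a sum as in \<open>dyadic_smoothness_sum\<close>.\<close>

lemma wave_in_HN_ball:
  fixes r :: real
  assumes r: "0 < r" "r < real l" and L: "l < L" "2 \<le> L"
  shows "\<exists>A>0. \<forall>m p \<epsilon>. 0 < p \<longrightarrow> (\<forall>\<iota>\<in>idx m. \<bar>\<epsilon> \<iota>\<bar> \<le> 1) \<longrightarrow>
    (\<lambda>x. of_real (wave L (2 powr (- r * real m) / A) m \<epsilon> x)) \<in> (HN_ball l r p :: (real ^ 'n \<Rightarrow> 'a::{real_normed_field, euclidean_space}) set)"
proof -
  obtain C where C: "1 \<le> C" and sumC: "\<And>s h t. (\<Sum>k\<in>{0..<2 ^ s}. \<bar>fin_diff l h (bump L s k) t\<bar>) \<le> C * min 1 ((2 ^ s * \<bar>h\<bar>) ^ l)"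
    using sum_abs_fin_diff_bump[OF L(1)] by blast
  \<comment> \<open>Order 0 of the same estimate bounds the bumps themselves.\<close>
  obtain C0 where C0: "1 \<le> C0" and sumC0: "\<And>s t. (\<Sum>k\<in>{0..<2 ^ s}. \<bar>bump L s k t\<bar>) \<le> C0"
    using sum_abs_fin_diff_bump[of 0 L] L unfolding fin_diff_0 by auto
  obtain K where K: "1 \<le> K" and sumK: "\<And>t J. 0 < t \<Longrightarrow> t \<le> 1 \<Longrightarrow> finite J \<Longrightarrow>
    (\<Sum>s\<in>J. 2 powr (- r * real s) * min 1 ((2 ^ s * t) ^ l)) \<le> K * t powr r"
    using dyadic_smoothness_sum[OF r] by blast
  define A1 where "A1 = max C C0 * K"
  have A1: "0 < A1" using C K by (simp add: A1_def less_max_iff_disj)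
  \<comment> \<open>The norm sums over all 2^d subsets u, and the factor 2^d leaves each of them a
    share 2^(-d). \<open>A1\<close> bounds the sum in one coordinate.\<close>
  define A where "A = 2 ^ CARD('n) * A1 ^ CARD('n)"
  have A: "0 < A" using A1 by (simp add: A_def)
  have "(\<lambda>x. of_real (wave L (2 powr (- r * real m) / A) m \<epsilon> x)) \<in> (HN_ball l r p :: (real ^ 'n \<Rightarrow> 'a) set)"
    if p: "0 < p" and \<epsilon>: "\<And>\<iota>. \<iota> \<in> idx m \<Longrightarrow> \<bar>\<epsilon> \<iota>\<bar> \<le> 1" for m p and \<epsilon> :: "('n \<Rightarrow> nat) \<times> ('n \<Rightarrow> int) \<Rightarrow> real"
  proof -
    define \<theta> where "\<theta> = 2 powr (- r * real m) / A"
    define f :: "real ^ 'n \<Rightarrow> 'a" where "f = (\<lambda>x. of_real (wave L \<theta> m \<epsilon> x))"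
    have cont: "continuous_on UNIV f"
      unfolding f_def wave_def by (intro continuous_intros continuous_tensor_bump L)
    have per: "periodic f"
    proof -
      have "tensor_bump L \<iota> (x + axis i 1) = tensor_bump L \<iota> x" for \<iota> and x :: "real ^ 'n" and i
        unfolding tensor_bump_def by (intro prod.cong refl) (auto simp: axis_def periodic_bump)
      then show ?thesis by (simp add: periodic_def f_def wave_def)
    qed
    have diff: "norm (mixed_difference l u h f x) \<le> (1 / 2) ^ CARD('n) * (\<Prod>i\<in>u. t $ i powr r)"
      if t: "\<And>i. 0 < t $ i \<and> t $ i \<le> 1" and h: "\<And>i. i \<in> u \<Longrightarrow> \<bar>h $ i\<bar> < t $ i" for u t h x
    proof -
      define G where "G = (\<lambda>i a k y. (if i \<in> u then fin_diff l (h $ i) (bump L a k) else bump L a k) y)"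
      have "mixed_difference l u h f x = of_real (\<Sum>\<iota>\<in>idx m. (\<theta> * \<epsilon> \<iota>) * (\<Prod>i\<in>UNIV. G i (fst \<iota> i) (snd \<iota> i) (x $ i)))"
        unfolding f_def wave_def tensor_bump_def G_def
          mixed_difference_tensor[where g = "\<lambda>\<iota> i. bump L (fst \<iota> i) (snd \<iota> i)"] ..
      then have "norm (mixed_difference l u h f x) = \<bar>\<Sum>\<iota>\<in>idx m. (\<theta> * \<epsilon> \<iota>) * (\<Prod>i\<in>UNIV. G i (fst \<iota> i) (snd \<iota> i) (x $ i))\<bar>"
        by (simp only: norm_of_real)
      also have "\<dots> \<le> (\<Sum>\<iota>\<in>idx m. 1 / A * (\<Prod>i\<in>UNIV. 2 powr (- r * real (fst \<iota> i)) * \<bar>G i (fst \<iota> i) (snd \<iota> i) (x $ i)\<bar>))"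
      proof (intro order_trans[OF sum_abs] sum_mono)
        fix \<iota> :: "('n \<Rightarrow> nat) \<times> ('n \<Rightarrow> int)" assume \<iota>: "\<iota> \<in> idx m"
        have "(\<Prod>i\<in>UNIV. 2 powr (- r * real (fst \<iota> i))) = 2 powr (- r * real m)"
          using idx_pos(3)[OF \<iota>] by (simp add: powr_sum[symmetric] sum_negf sum_distrib_left[symmetric] flip: of_nat_sum)
        then have eq: "1 / A * (\<Prod>i\<in>UNIV. 2 powr (- r * real (fst \<iota> i)) * \<bar>G i (fst \<iota> i) (snd \<iota> i) (x $ i)\<bar>)
            = \<theta> * 1 * (\<Prod>i\<in>UNIV. \<bar>G i (fst \<iota> i) (snd \<iota> i) (x $ i)\<bar>)"
          by (simp only: prod.distrib) (simp add: \<theta>_def)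
        have \<theta>: "0 \<le> \<theta>" using A by (simp add: \<theta>_def)
        show "\<bar>(\<theta> * \<epsilon> \<iota>) * (\<Prod>i\<in>UNIV. G i (fst \<iota> i) (snd \<iota> i) (x $ i))\<bar>
            \<le> 1 / A * (\<Prod>i\<in>UNIV. 2 powr (- r * real (fst \<iota> i)) * \<bar>G i (fst \<iota> i) (snd \<iota> i) (x $ i)\<bar>)"
          unfolding eq abs_mult abs_prod using \<theta> \<epsilon>[OF \<iota>]
          by (intro mult_right_mono mult_mono prod_nonneg) auto
      qed
      also have "\<dots> = 1 / A * (\<Sum>\<iota>\<in>idx m. (\<Prod>i\<in>UNIV. 2 powr (- r * real (fst \<iota> i)) * \<bar>G i (fst \<iota> i) (snd \<iota> i) (x $ i)\<bar>))"
        by (simp only: sum_distrib_left)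
      also have "\<dots> \<le> 1 / A * (\<Prod>i\<in>UNIV. \<Sum>a\<le>m. \<Sum>k\<in>{0..<2 ^ a}. 2 powr (- r * real a) * \<bar>G i a k (x $ i)\<bar>)"
        using A by (intro mult_left_mono sum_idx_prod_le) auto
      also have "\<dots> \<le> 1 / A * (\<Prod>i\<in>UNIV. A1 * (if i \<in> u then t $ i powr r else 1))"
      proof (intro mult_left_mono prod_mono conjI sum_nonneg)
        fix i
        show "(\<Sum>a\<le>m. \<Sum>k\<in>{0..<2 ^ a}. 2 powr (- r * real a) * \<bar>G i a k (x $ i)\<bar>) \<le> A1 * (if i \<in> u then t $ i powr r else 1)"
        proof (cases "i \<in> u")
          case True
          have "(\<Sum>a\<le>m. \<Sum>k\<in>{0..<2 ^ a}. 2 powr (- r * real a) * \<bar>G i a k (x $ i)\<bar>)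
              \<le> (\<Sum>a\<le>m. C * (2 powr (- r * real a) * min 1 ((2 ^ a * t $ i) ^ l)))"
          proof (rule sum_mono)
            fix a
            have "min 1 ((2 ^ a * \<bar>h $ i\<bar>) ^ l) \<le> min 1 ((2 ^ a * t $ i) ^ l)"
              using h[OF True] by (intro min.mono power_mono mult_left_mono) auto
            then have "C * min 1 ((2 ^ a * \<bar>h $ i\<bar>) ^ l) \<le> C * min 1 ((2 ^ a * t $ i) ^ l)"
              using C by (intro mult_left_mono) auto
            moreover have "(\<Sum>k\<in>{0..<2 ^ a}. \<bar>G i a k (x $ i)\<bar>) \<le> C * min 1 ((2 ^ a * \<bar>h $ i\<bar>) ^ l)"
              using sumC[where s = a and h = "h $ i" and t = "x $ i"] True by (simp only: G_def if_True)
            ultimately have "(\<Sum>k\<in>{0..<2 ^ a}. \<bar>G i a k (x $ i)\<bar>) \<le> C * min 1 ((2 ^ a * t $ i) ^ l)"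
              by linarith
            then have "2 powr (- r * real a) * (\<Sum>k\<in>{0..<2 ^ a}. \<bar>G i a k (x $ i)\<bar>)
                \<le> 2 powr (- r * real a) * (C * min 1 ((2 ^ a * t $ i) ^ l))" by (intro mult_left_mono) auto
            then show "(\<Sum>k\<in>{0..<2 ^ a}. 2 powr (- r * real a) * \<bar>G i a k (x $ i)\<bar>)
                \<le> C * (2 powr (- r * real a) * min 1 ((2 ^ a * t $ i) ^ l))"
              by (simp only: sum_distrib_left mult.left_commute)
          qed
          also have "\<dots> \<le> C * (K * t $ i powr r)"
            unfolding sum_distrib_left[symmetric] using t[of i] C by (intro mult_left_mono sumK) auto
          also have "\<dots> \<le> max C C0 * (K * t $ i powr r)" using K by (intro mult_right_mono) auto
          finally show ?thesis using True by (simp add: A1_def mult_ac)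
        next
          \<comment> \<open>For coordinates outside \<open>u\<close> the plain sum fits the same
            scheme with t = 1, where the minimum equals 1.\<close>
          case False
          have "(\<Sum>a\<le>m. \<Sum>k\<in>{0..<2 ^ a}. 2 powr (- r * real a) * \<bar>G i a k (x $ i)\<bar>)
              \<le> (\<Sum>a\<le>m. C0 * (2 powr (- r * real a) * min 1 ((2 ^ a * 1) ^ l)))"
          proof (rule sum_mono)
            fix a
            have "2 powr (- r * real a) * (\<Sum>k\<in>{0..<2 ^ a}. \<bar>G i a k (x $ i)\<bar>) \<le> 2 powr (- r * real a) * C0"
              using sumC0 False by (intro mult_left_mono) (auto simp: G_def)
            moreover have "min 1 ((2 ^ a * 1) ^ l) = (1 :: real)"
              by (simp add: min_absorb1 power_mult[symmetric])
            ultimately show "(\<Sum>k\<in>{0..<2 ^ a}. 2 powr (- r * real a) * \<bar>G i a k (x $ i)\<bar>)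
                \<le> C0 * (2 powr (- r * real a) * min 1 ((2 ^ a * 1) ^ l))"
              by (simp only: sum_distrib_left[symmetric]) (simp add: mult.commute)
          qed
          also have "\<dots> \<le> C0 * (K * 1 powr r)"
            unfolding sum_distrib_left[symmetric] using C0 by (intro mult_left_mono sumK) auto
          also have "\<dots> \<le> max C C0 * (K * 1)" using K by simp
          finally show ?thesis using False by (simp add: A1_def)
        qed
      qed (use A in auto)
      also have "\<dots> = (1 / 2) ^ CARD('n) * (\<Prod>i\<in>u. t $ i powr r)"
        using A1 by (simp add: prod.distrib A_def prod.If_cases power_one_over)
      finally show ?thesis .
    qed
    have Lp: "Lp_norm p (mixed_difference l u h f) \<le> ennreal ((1 / 2) ^ CARD('n) * (\<Prod>i\<in>u. t $ i powr r))"
      if t: "\<And>i. 0 < t $ i \<and> t $ i \<le> 1" and h: "\<And>i. i \<in> u \<Longrightarrow> \<bar>h $ i\<bar> < t $ i" for u t h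
    proof -
      define B where "B = (1 / 2) ^ CARD('n) * (\<Prod>i\<in>u. t $ i powr r)"
      have B: "0 < B" unfolding B_def using t by (intro mult_pos_pos prod_pos) (auto simp: less_imp_neq[symmetric])
      have d: "norm (mixed_difference l u h f x) \<le> B" for x
        unfolding B_def by (rule diff) (use t h in auto)
      have int: "integrable cube (\<lambda>x. norm (mixed_difference l u h f x) powr p)"
        by (intro integrable_norm_powr continuous_mixed_difference cont p)
      have "(\<integral>x. norm (mixed_difference l u h f x) powr p \<partial>cube) \<le> (\<integral>x. B powr p \<partial>(cube :: (real ^ 'n) measure))"
        using d p by (intro integral_mono int integrable_cube_continuous continuous_intros powr_mono2) auto
      then show ?thesis using Lp_norm_le_iff[OF p B int] by (simp only: integral_cube_const B_def)
    qed
    have "HN_norm l r p f \<le> (\<Sum>u\<in>Pow (UNIV :: 'n set). ennreal ((1 / 2) ^ CARD('n)))"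
      unfolding HN_norm_def
    proof (intro sum_mono SUP_least)
      fix u and t :: "real ^ 'n" assume "t \<in> {t. \<forall>i. 0 < t $ i \<and> t $ i \<le> 1}"
      then have t: "\<And>i. 0 < t $ i \<and> t $ i \<le> 1" by auto
      define a where "a = (\<Prod>i\<in>u. t $ i powr r)"
      have a: "0 < a" unfolding a_def using t by (intro prod_pos) (auto simp: less_imp_neq[symmetric])
      have a': "(\<Prod>i\<in>u. t $ i powr (- r)) = 1 / a"
        by (simp add: a_def powr_minus prod_inversef inverse_eq_divide prod_dividef)
      have "mixed_modulus l u p f t \<le> ennreal ((1 / 2) ^ CARD('n) * a)"
        unfolding mixed_modulus_def a_def by (intro SUP_least Lp t) auto
      then have "ennreal (\<Prod>i\<in>u. t $ i powr (- r)) * mixed_modulus l u p f t \<le> ennreal (1 / a) * ennreal ((1 / 2) ^ CARD('n) * a)"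
        unfolding a' by (intro mult_left_mono) auto
      also have "\<dots> = ennreal ((1 / 2) ^ CARD('n))" using a by (simp add: ennreal_mult[symmetric])
      finally show "ennreal (\<Prod>i\<in>u. t $ i powr (- r)) * mixed_modulus l u p f t \<le> ennreal ((1 / 2) ^ CARD('n))" .
    qed
    also have "\<dots> = of_nat (card (Pow (UNIV :: 'n set))) * ennreal ((1 / 2) ^ CARD('n))" by simp
    also have "\<dots> = ennreal (2 ^ CARD('n) * (1 / 2) ^ CARD('n))"
      by (simp add: card_Pow ennreal_mult ennreal_power[symmetric])
    also have "\<dots> = 1" by (simp add: power_one_over)
    finally have "HN_norm l r p f \<le> 1" .
    moreover have "f \<in> Lp_space p" by (intro Lp_space_continuous cont per p)
    ultimately have "f \<in> HN_ball l r p"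
      using cont by (auto simp: HN_ball_def HN_space_def intro: le_less_trans[OF _ ennreal_one_less_top])
    then show ?thesis unfolding f_def \<theta>_def .
  qed
  then show ?thesis using A by blast
qed

section \<open>The duality argument for the lower bound\<close>

lemma Lp_norm_integrable:
  fixes g :: "real ^ 'n \<Rightarrow> 'a::{real_normed_field, euclidean_space}"
  assumes g: "g \<in> borel_measurable lebesgue" and fin: "Lp_norm q g < \<infinity>"
  shows "integrable cube (\<lambda>x. norm (g x) powr q)"
proof -
  have [measurable]: "g \<in> borel_measurable cube" using g by (rule measurable_restrict_space1)
  have "(\<integral>\<^sup>+ x. ennreal (norm (g x) powr q) \<partial>cube) \<noteq> \<infinity>"
    using fin by (auto simp: Lp_norm_def Let_def)
  then show ?thesis by (intro integrableI_nonneg) (auto simp: top.not_eq_extremum)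
qed

lemma integrable_from_powr:
  fixes g :: "'x \<Rightarrow> real"
  assumes N: "finite_measure N" and g: "g \<in> borel_measurable N" and q: "1 \<le> q" and int: "integrable N (\<lambda>x. \<bar>g x\<bar> powr q)"
    and h: "h \<in> borel_measurable N" "\<And>x. \<bar>h x\<bar> \<le> 1"
  shows "integrable N (\<lambda>x. g x * h x)"
proof -
  interpret finite_measure N by (rule N)
  show ?thesis
  proof (rule Bochner_Integration.integrable_bound)
    show "integrable N (\<lambda>x. 1 + \<bar>g x\<bar> powr q)" using int by simp
    show "(\<lambda>x. g x * h x) \<in> borel_measurable N" using g h(1) by measurable
    show "AE x in N. norm (g x * h x) \<le> norm (1 + \<bar>g x\<bar> powr q)"
    proof (rule AE_I2)
      fix x
      have "\<bar>g x\<bar> \<le> 1 + \<bar>g x\<bar> powr q"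
      proof (cases "\<bar>g x\<bar> \<le> 1")
        case False
        then have "\<bar>g x\<bar> powr 1 \<le> \<bar>g x\<bar> powr q" using q by (intro powr_mono) auto
        then show ?thesis by simp
      qed (simp add: add_increasing2)
      moreover have "\<bar>g x\<bar> * \<bar>h x\<bar> \<le> \<bar>g x\<bar> * 1" by (intro mult_left_mono h) auto
      ultimately show "norm (g x * h x) \<le> norm (1 + \<bar>g x\<bar> powr q)" by (simp add: abs_mult)
    qed
  qed
qed

text \<open>The Haar moments of the k reconstruction functions span at most k dimensions. The signs
  are projected orthogonally to them, so the approximation drops out of the pairing and only the
  test function remains; since 2 n is at most the number of boxes, at least half of the trace
  survives.\<close>

lemma linear_sampling_width_lower:
  fixes r q :: real
  assumes r: "0 < r" "r < real l" and q: "1 < q"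
  shows "\<exists>c>0. \<forall>m n p. 0 < p \<longrightarrow> 2 * n \<le> level_count TYPE('n::finite) m * 2 ^ m \<longrightarrow>
    ennreal (c * (2 powr (- r * real m) * sqrt (level_count TYPE('n) m))) \<le>
    linear_sampling_width n (HN_ball l r p :: (real ^ 'n \<Rightarrow> 'a::{real_normed_field, euclidean_space}) set)
      (cbox 0 1) (Lp_space q) (Lp_norm q)"
proof -
  \<comment> \<open>Odd, so that bumps are antisymmetric, and larger than l, so that differences of
    order l are controlled.\<close>
  define L where "L = 2 * l + 1"
  have L: "l < L" "2 \<le> L" "odd L" using r by (auto simp: L_def)
  obtain A where A: "0 < A" and ball: "\<And>m p \<epsilon>. 0 < p \<Longrightarrow> (\<And>\<iota>. \<iota> \<in> idx m \<Longrightarrow> \<bar>\<epsilon> \<iota>\<bar> \<le> 1) \<Longrightarrow>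
    (\<lambda>x. of_real (wave L (2 powr (- r * real m) / A) m \<epsilon> x)) \<in> (HN_ball l r p :: (real ^ 'n \<Rightarrow> 'a) set)"
    using wave_in_HN_ball[OF r L(1,2), where 'n = 'n and 'a = 'a] by blast
  define s where "s = q / (q - 1)"
  have s: "1 < s" "1 / q + 1 / s = 1" using q by (auto simp: s_def field_simps)
  define \<kappa> where "\<kappa> = bump_mass L ^ CARD('n)"
  have \<kappa>: "0 < \<kappa>" using bump_mass_pos by (simp add: \<kappa>_def)
  define K where "K = 1 + 6 * s powr s"
  have K: "0 < K" unfolding K_def by (intro add_pos_nonneg) auto
  \<comment> \<open>One factor 2 comes from the trace, which is at least half the number of boxes;
    the other leaves room for the contradiction.\<close>
  define c where "c = \<kappa> / (4 * A * K)"
  have c: "0 < c" using \<kappa> A K by (simp add: c_def)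
  have main: "ennreal (c * (2 powr (- r * real m) * sqrt (level_count TYPE('n) m))) \<le>
      linear_sampling_width n (HN_ball l r p :: (real ^ 'n \<Rightarrow> 'a) set) (cbox 0 1) (Lp_space q) (Lp_norm q)"
    if p: "0 < p" and n: "2 * n \<le> level_count TYPE('n) m * 2 ^ m" for m n p
  proof (rule ccontr)
    define M where "M = real (level_count TYPE('n) m)"
    define I where "I = (idx m :: (('n \<Rightarrow> nat) \<times> ('n \<Rightarrow> int)) set)"
    have fin: "finite I" unfolding I_def by (rule finite_idx)
    have cardI: "real (card I) = M * 2 ^ m" unfolding I_def card_idx M_def by simp
    have M: "0 < M"
    proof -
      have "0 < ((real m + 1) / CARD('n)) ^ (CARD('n) - 1)" by simp
      then show ?thesis using level_count_lower[of m, where 'n = 'n] unfolding M_def by linarith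
    qed
    define \<theta> where "\<theta> = 2 powr (- r * real m) / A"
    have \<theta>: "0 < \<theta>" using A by (simp add: \<theta>_def)
    define E where "E = c * (2 powr (- r * real m) * sqrt M)"
    have E: "0 < E" using c M by (simp add: E_def)
    assume "\<not> ?thesis"
    then have "linear_sampling_width n (HN_ball l r p :: (real ^ 'n \<Rightarrow> 'a) set) (cbox 0 1) (Lp_space q) (Lp_norm q) < ennreal E"
      unfolding E_def M_def by simp
    then have "\<exists>k\<in>{..n}. \<exists>x\<in>{1..k} \<rightarrow> cbox 0 1. \<exists>\<phi>\<in>{1..k} \<rightarrow> Lp_space q.
        (SUP f\<in>(HN_ball l r p :: (real ^ 'n \<Rightarrow> 'a) set). Lp_norm q (\<lambda>y. f y - (\<Sum>i=1..k. f (x i) * \<phi> i y))) < ennreal E"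
      unfolding linear_sampling_width_def INF_less_iff .
    then obtain k where k: "k \<in> {..n}" and ex: "\<exists>x\<in>{1..k} \<rightarrow> cbox 0 1. \<exists>\<phi>\<in>{1..k} \<rightarrow> Lp_space q.
        (SUP f\<in>(HN_ball l r p :: (real ^ 'n \<Rightarrow> 'a) set). Lp_norm q (\<lambda>y. f y - (\<Sum>i=1..k. f (x i) * \<phi> i y))) < ennreal E"
      by (rule bexE)
    from ex obtain x where "\<exists>\<phi>\<in>{1..k} \<rightarrow> Lp_space q.
        (SUP f\<in>(HN_ball l r p :: (real ^ 'n \<Rightarrow> 'a) set). Lp_norm q (\<lambda>y. f y - (\<Sum>i=1..k. f (x i) * \<phi> i y))) < ennreal E"
      by (rule bexE)
    then obtain \<phi> where \<phi>: "\<phi> \<in> {1..k} \<rightarrow> Lp_space q"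
      and less: "(SUP f\<in>(HN_ball l r p :: (real ^ 'n \<Rightarrow> 'a) set). Lp_norm q (\<lambda>y. f y - (\<Sum>i=1..k. f (x i) * \<phi> i y))) < ennreal E"
      by (rule bexE)
    have err: "Lp_norm q (\<lambda>y. f y - (\<Sum>i=1..k. f (x i) * \<phi> i y)) \<le> ennreal E" if "f \<in> HN_ball l r p" for f :: "real ^ 'n \<Rightarrow> 'a"
      by (rule order_trans[OF SUP_upper[OF that] less_imp_le[OF less]])
    \<comment> \<open>The component along 1. The test functions are real multiples of 1, and passing
      to this component does not increase the error.\<close>
    define \<phi>' where "\<phi>' = (\<lambda>i y. \<phi> i y \<bullet> 1)"
    have \<phi>_meas: "\<phi> i \<in> borel_measurable lebesgue" if "i \<in> {1..k}" for i
      using \<phi> that by (auto simp: Lp_space_def Pi_iff)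
    have \<phi>'_meas: "\<phi>' i \<in> borel_measurable cube" if "i \<in> {1..k}" for i
      unfolding \<phi>'_def using measurable_restrict_space1[OF \<phi>_meas[OF that]] by measurable
    have inner_one: "\<bar>v \<bullet> 1\<bar> \<le> norm v" for v :: 'a
      using Cauchy_Schwarz_ineq2[of v 1] by simp
    have \<phi>'_int: "integrable cube (\<lambda>y. \<phi>' i y * tensor_haar \<iota> y)" if i: "i \<in> {1..k}" for i and \<iota> :: "('n \<Rightarrow> nat) \<times> ('n \<Rightarrow> int)"
    proof (rule integrable_from_powr[OF finite_measure_cube \<phi>'_meas[OF i] less_imp_le[OF q]])
      have "integrable cube (\<lambda>y. norm (\<phi> i y) powr q)"
        using \<phi> i by (intro Lp_norm_integrable) (auto simp: Lp_space_def Pi_iff)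
      then show "integrable cube (\<lambda>y. \<bar>\<phi>' i y\<bar> powr q)"
      proof (rule Bochner_Integration.integrable_bound)
        show "(\<lambda>y. \<bar>\<phi>' i y\<bar> powr q) \<in> borel_measurable cube" using \<phi>'_meas[OF i] by measurable
        show "AE y in cube. norm (\<bar>\<phi>' i y\<bar> powr q) \<le> norm (norm (\<phi> i y) powr q)"
          using q inner_one by (auto simp: \<phi>'_def intro!: AE_I2 powr_mono2)
      qed
    qed (auto simp: abs_tensor_haar_le borel_measurable_tensor_haar)
    define w where "w = (\<lambda>i \<iota>. \<integral>y. \<phi>' i y * tensor_haar \<iota> y \<partial>cube)"
    obtain Q where Q: "\<And>i j. Q i j = Q j i" "\<And>a b. inner_on I (mat_vec I Q a) (mat_vec I Q b) = inner_on I a (mat_vec I Q b)"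
      "\<And>v a. v \<in> set (map w [1..<Suc k]) \<Longrightarrow> inner_on I v (mat_vec I Q a) = 0"
      "real (card I) - length (map w [1..<Suc k]) \<le> trace_on I Q"
      using exists_projection_orthogonal_to[OF fin, of "map w [1..<Suc k]"] by blast
    have wQ: "inner_on I (w i) (mat_vec I Q a) = 0" if "i \<in> {1..k}" for i a
      using that by (intro Q(3)) (auto simp del: upt_Suc)
    have trQ: "M * 2 ^ m / 2 \<le> trace_on I Q"
    proof -
      have "real (2 * k) \<le> real (level_count TYPE('n) m * 2 ^ m)" using n k by (intro of_nat_mono) simp
      then have "2 * real k \<le> M * 2 ^ m" by (simp add: M_def)
      then show ?thesis using Q(4) by (simp add: cardI del: upt_Suc)
    qed
    define F where "F = (\<lambda>\<epsilon> y. wave L \<theta> m \<epsilon> y - (\<Sum>i=1..k. wave L \<theta> m \<epsilon> (x i) * \<phi>' i y))"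
    define f :: "(('n \<Rightarrow> nat) \<times> ('n \<Rightarrow> int) \<Rightarrow> real) \<Rightarrow> real ^ 'n \<Rightarrow> 'a" where "f = (\<lambda>\<epsilon> y. of_real (wave L \<theta> m \<epsilon> y))"
    define err where "err = (\<lambda>\<epsilon> y. f \<epsilon> y - (\<Sum>i=1..k. f \<epsilon> (x i) * \<phi> i y))"
    have F_err: "F \<epsilon> y = err \<epsilon> y \<bullet> 1" for \<epsilon> y
    proof -
      have "(of_real t :: 'a) \<bullet> 1 = t" for t
        using norm_eq_1[of "1 :: 'a"] by (simp add: of_real_def)
      moreover have "(of_real t * v :: 'a) \<bullet> 1 = t * (v \<bullet> 1)" for t v
        by (simp add: scaleR_conv_of_real[symmetric])
      ultimately show ?thesis
        by (simp add: F_def err_def f_def \<phi>'_def inner_diff_left inner_sum_left)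
    qed
    have f_ball: "f \<epsilon> \<in> HN_ball l r p" if "\<epsilon> \<in> sign_vectors I" for \<epsilon>
      unfolding f_def \<theta>_def using that by (intro ball p) (auto simp: sign_vectors_def I_def PiE_iff)
    have wave_cont: "continuous_on UNIV (wave L \<theta> m \<epsilon>)" for \<epsilon> :: "('n \<Rightarrow> nat) \<times> ('n \<Rightarrow> int) \<Rightarrow> real"
      unfolding wave_def by (intro continuous_intros continuous_tensor_bump L)
    have err_meas: "err \<epsilon> \<in> borel_measurable lebesgue" for \<epsilon>
    proof -
      have "continuous_on UNIV (f \<epsilon>)" unfolding f_def by (intro continuous_intros wave_cont)
      then have [measurable]: "f \<epsilon> \<in> borel_measurable lebesgue"
        using borel_measurable_continuous_onI by (intro measurable_completion) simp
      show ?thesis unfolding err_def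
        by (intro borel_measurable_diff borel_measurable_sum borel_measurable_times \<phi>_meas) auto
    qed
    have err_int: "integrable cube (\<lambda>y. norm (err \<epsilon> y) powr q)" "(\<integral>y. norm (err \<epsilon> y) powr q \<partial>cube) \<le> E powr q"
      if \<epsilon>: "\<epsilon> \<in> sign_vectors I" for \<epsilon>
    proof -
      have le: "Lp_norm q (err \<epsilon>) \<le> ennreal E" unfolding err_def by (rule err[OF f_ball[OF \<epsilon>]])
      then have "Lp_norm q (err \<epsilon>) < \<infinity>" by (rule le_less_trans) simp
      then show int: "integrable cube (\<lambda>y. norm (err \<epsilon> y) powr q)" by (intro Lp_norm_integrable err_meas)
      show "(\<integral>y. norm (err \<epsilon> y) powr q \<partial>cube) \<le> E powr q"
        using le Lp_norm_le_iff[of q E "err \<epsilon>"] q E int by simp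
    qed
    have F_meas: "F \<epsilon> \<in> borel_measurable cube" for \<epsilon>
      unfolding F_err using measurable_restrict_space1[OF err_meas[of \<epsilon>]] by measurable
    have F_le: "\<bar>F \<epsilon> y\<bar> powr q \<le> norm (err \<epsilon> y) powr q" for \<epsilon> y
      unfolding F_err using q inner_one by (intro powr_mono2) auto
    have F_int: "integrable cube (\<lambda>y. \<bar>F \<epsilon> y\<bar> powr q)" if \<epsilon>: "\<epsilon> \<in> sign_vectors I" for \<epsilon>
      by (rule Bochner_Integration.integrable_bound[OF err_int(1)[OF \<epsilon>]])
        (use F_meas[of \<epsilon>] F_le in auto)
    have "(\<theta> * (\<kappa> * (1 / 2) ^ m)) * trace_on I Q \<le> E * sqrt M * (1 + 6 * s powr s)"
    proof (rule random_duality[OF finite_measure_cube _ fin Q(1,2), where h = tensor_haar and F = F and q = q])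
      show "measure (cube :: (real ^ 'n) measure) (space cube) = 1" by (simp add: measure_cube)
      show "tensor_haar i \<in> borel_measurable cube" for i :: "('n \<Rightarrow> nat) \<times> ('n \<Rightarrow> int)" by (rule borel_measurable_tensor_haar)
      show "(\<Sum>i\<in>I. (tensor_haar i x)\<^sup>2) \<le> M" for x :: "real ^ 'n" unfolding I_def M_def by (rule sum_tensor_haar_square)
      fix \<epsilon> :: "('n \<Rightarrow> nat) \<times> ('n \<Rightarrow> int) \<Rightarrow> real" assume \<epsilon>: "\<epsilon> \<in> sign_vectors I"
      show "integrable cube (\<lambda>y. \<bar>F \<epsilon> y\<bar> powr q)" by (rule F_int[OF \<epsilon>])
      have "(\<integral>y. \<bar>F \<epsilon> y\<bar> powr q \<partial>cube) \<le> (\<integral>y. norm (err \<epsilon> y) powr q \<partial>cube)"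
        by (intro integral_mono F_int err_int \<epsilon> F_le)
      then show "(\<integral>y. \<bar>F \<epsilon> y\<bar> powr q \<partial>cube) \<le> E powr q" using err_int(2)[OF \<epsilon>] by linarith
      show "F \<epsilon> \<in> borel_measurable cube" by (rule F_meas)
      define b where "b = mat_vec I Q \<epsilon>"
      define G where "G = (\<lambda>y. \<Sum>\<iota>\<in>I. b \<iota> * tensor_haar \<iota> y)"
      have bump_int: "integrable cube (\<lambda>y. tensor_bump L \<iota>' y * tensor_haar \<iota> y)" for \<iota>' \<iota> :: "('n \<Rightarrow> nat) \<times> ('n \<Rightarrow> int)"
        by (rule integrable_from_powr[OF finite_measure_cube _ order_refl])
          (auto intro!: integrable_cube_continuous continuous_intros continuous_tensor_bump L
            borel_measurable_integrable simp: abs_tensor_haar_le borel_measurable_tensor_haar)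
      have wave_haar: "(\<integral>y. wave L \<theta> m \<epsilon> y * tensor_haar \<iota> y \<partial>cube) = \<theta> * \<epsilon> \<iota> * (\<kappa> * (1 / 2) ^ m)" if \<iota>: "\<iota> \<in> I" for \<iota>
      proof -
        have "(\<integral>y. wave L \<theta> m \<epsilon> y * tensor_haar \<iota> y \<partial>cube)
            = (\<integral>y. (\<Sum>\<iota>'\<in>I. (\<theta> * \<epsilon> \<iota>') * (tensor_bump L \<iota>' y * tensor_haar \<iota> y)) \<partial>cube)"
          by (simp only: wave_def I_def sum_distrib_right mult.assoc)
        also have "\<dots> = (\<Sum>\<iota>'\<in>I. (\<theta> * \<epsilon> \<iota>') * (\<integral>y. tensor_bump L \<iota>' y * tensor_haar \<iota> y \<partial>cube))"
          by (subst Bochner_Integration.integral_sum) (auto intro!: bump_int)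
        also have "\<dots> = (\<Sum>\<iota>'\<in>I. if \<iota>' = \<iota> then \<theta> * \<epsilon> \<iota> * (\<kappa> * (1 / 2) ^ m) else 0)"
          using \<iota> by (intro sum.cong refl) (simp add: tensor_bump_haar[OF L(3,2)] I_def \<kappa>_def)
        finally show ?thesis using fin \<iota> by simp
      qed
      have wave_int: "integrable cube (\<lambda>y. wave L \<theta> m \<epsilon> y * tensor_haar \<iota> y)" for \<iota> :: "('n \<Rightarrow> nat) \<times> ('n \<Rightarrow> int)"
      proof -
        have "integrable cube (\<lambda>y. \<Sum>\<iota>'\<in>I. (\<theta> * \<epsilon> \<iota>') * (tensor_bump L \<iota>' y * tensor_haar \<iota> y))"
          by (intro Bochner_Integration.integrable_sum integrable_mult_right bump_int)
        then show ?thesis by (simp only: wave_def I_def sum_distrib_right mult.assoc)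
      qed
      define S where "S = (\<lambda>\<iota> y. \<Sum>i=1..k. wave L \<theta> m \<epsilon> (x i) * (\<phi>' i y * tensor_haar \<iota> y))"
      have S_int: "integrable cube (S \<iota>)" for \<iota>
        unfolding S_def by (intro Bochner_Integration.integrable_sum integrable_mult_right \<phi>'_int)
      have S_eq: "(\<integral>y. S \<iota> y \<partial>cube) = (\<Sum>i=1..k. wave L \<theta> m \<epsilon> (x i) * w i \<iota>)" for \<iota>
        unfolding S_def w_def
        by (subst Bochner_Integration.integral_sum, rule integrable_mult_right, erule \<phi>'_int, simp only: integral_mult_right_zero)
      have FG: "F \<epsilon> y * G y = (\<Sum>\<iota>\<in>I. b \<iota> * (wave L \<theta> m \<epsilon> y * tensor_haar \<iota> y - S \<iota> y))" for y
        unfolding F_def G_def S_def sum_distrib_left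
        by (intro sum.cong refl) (simp add: left_diff_distrib right_diff_distrib sum_distrib_left sum_distrib_right mult_ac)
      have "(\<integral>y. F \<epsilon> y * G y \<partial>cube) = (\<Sum>\<iota>\<in>I. \<integral>y. b \<iota> * (wave L \<theta> m \<epsilon> y * tensor_haar \<iota> y - S \<iota> y) \<partial>cube)"
        unfolding FG
        by (intro Bochner_Integration.integral_sum integrable_mult_right Bochner_Integration.integrable_diff wave_int S_int)
      also have "\<dots> = (\<Sum>\<iota>\<in>I. b \<iota> * ((\<integral>y. wave L \<theta> m \<epsilon> y * tensor_haar \<iota> y \<partial>cube)
          - (\<Sum>i=1..k. wave L \<theta> m \<epsilon> (x i) * w i \<iota>)))"
        unfolding integral_mult_right_zero Bochner_Integration.integral_diff[OF wave_int S_int] S_eq ..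
      also have "\<dots> = (\<Sum>\<iota>\<in>I. b \<iota> * (\<theta> * \<epsilon> \<iota> * (\<kappa> * (1 / 2) ^ m))) - (\<Sum>\<iota>\<in>I. b \<iota> * (\<Sum>i=1..k. wave L \<theta> m \<epsilon> (x i) * w i \<iota>))"
        by (simp add: wave_haar right_diff_distrib sum_subtractf)
      also have "(\<Sum>\<iota>\<in>I. b \<iota> * (\<Sum>i=1..k. wave L \<theta> m \<epsilon> (x i) * w i \<iota>)) = (\<Sum>i=1..k. wave L \<theta> m \<epsilon> (x i) * inner_on I (w i) b)"
        unfolding inner_on_def sum_distrib_left by (subst sum.swap) (simp add: mult_ac)
      also have "\<dots> = 0" unfolding b_def by (intro sum.neutral ballI) (simp add: wQ)
      also have "(\<Sum>\<iota>\<in>I. b \<iota> * (\<theta> * \<epsilon> \<iota> * (\<kappa> * (1 / 2) ^ m))) = (\<theta> * (\<kappa> * (1 / 2) ^ m)) * inner_on I \<epsilon> b"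
        unfolding inner_on_def sum_distrib_left by (intro sum.cong refl) (simp only: mult_ac)
      finally show "(\<theta> * (\<kappa> * (1 / 2) ^ m)) * inner_on I \<epsilon> (mat_vec I Q \<epsilon>) \<le> (\<integral>y. F \<epsilon> y * (\<Sum>\<iota>\<in>I. mat_vec I Q \<epsilon> \<iota> * tensor_haar \<iota> y) \<partial>cube)"
        by (simp add: b_def G_def)
    qed (use M q s E in auto)
    moreover have "(\<theta> * (\<kappa> * (1 / 2) ^ m)) * (M * 2 ^ m / 2) \<le> (\<theta> * (\<kappa> * (1 / 2) ^ m)) * trace_on I Q"
      using \<theta> \<kappa> trQ by (intro mult_left_mono) auto
    ultimately have le: "(\<theta> * (\<kappa> * (1 / 2) ^ m)) * (M * 2 ^ m / 2) \<le> E * sqrt M * K" unfolding K_def by linarith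
    have "(\<theta> * (\<kappa> * (1 / 2) ^ m)) * (M * 2 ^ m / 2) = \<theta> * \<kappa> * M / 2"
      by (simp add: power_one_over)
    moreover have "E * sqrt M * K = \<theta> * \<kappa> * M / 4"
    proof -
      have "E * sqrt M * K = (c * K) * 2 powr (- r * real m) * (sqrt M * sqrt M)"
        by (simp only: E_def mult_ac)
      also have "\<dots> = (c * K) * 2 powr (- r * real m) * M" using M by simp
      also have "\<dots> = \<theta> * \<kappa> * M / 4" using A K by (simp add: c_def \<theta>_def mult_ac)
      finally show ?thesis .
    qed
    ultimately have "\<theta> * \<kappa> * M \<le> 0" using le by linarith
    moreover have "0 < \<theta> * \<kappa> * M" using \<theta> \<kappa> M by simp
    ultimately show False by linarith
  qed
  show ?thesis by (rule exI[of _ c], rule conjI[OF c]) (intro allI impI main)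
qed

section \<open>Translation of levels into the rate in n\<close>

lemma rate_lower:
  fixes r :: real
  assumes r: "0 < r"
  shows "\<exists>c>0. \<forall>n\<ge>2. \<exists>m. 2 * n \<le> level_count TYPE('n::finite) m * 2 ^ m \<and>
    c * ((ln (real n) ^ (CARD('n) - 1) / real n) powr r * ln (real n) powr (real (CARD('n) - 1) / 2))
      \<le> 2 powr (- r * real m) * sqrt (level_count TYPE('n) m)"
proof -
  define d D where "d = real CARD('n)" and "D = CARD('n) - 1"
  have d: "1 \<le> d" by (simp add: d_def Suc_le_eq)
  define c where "c = ((1 / d\<^sup>2) ^ D / 4) powr r * (1 / d\<^sup>2) powr (real D / 2)"
  have c: "0 < c" using d by (simp add: c_def)
  have main: "\<exists>m. 2 * n \<le> level_count TYPE('n) m * 2 ^ m \<and>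
    c * ((ln (real n) ^ D / real n) powr r * ln (real n) powr (real D / 2)) \<le> 2 powr (- r * real m) * sqrt (level_count TYPE('n) m)"
    if n: "2 \<le> n" for n
  proof -
    define P where "P = (\<lambda>m. 2 * n \<le> level_count TYPE('n) m * 2 ^ m)"
    have lc: "((real j + 1) / d) ^ D \<le> real (level_count TYPE('n) j)" for j
      using level_count_lower[of j, where 'n = 'n] by (simp add: d_def D_def add.commute)
    have lc0: "0 < level_count TYPE('n) j" for j
    proof -
      have "0 < ((real j + 1) / d) ^ D" using d by simp
      then show ?thesis using lc[of j] by linarith
    qed
    have "P (2 * n)"
    proof -
      have "2 * n \<le> 2 ^ (2 * n)" using less_exp[of "2 * n"] by simp
      also have "\<dots> \<le> level_count TYPE('n) (2 * n) * 2 ^ (2 * n)" using lc0[of "2 * n"] by simp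
      finally show ?thesis by (simp add: P_def)
    qed
    \<comment> \<open>The least admissible level: failure at the preceding level j bounds 2^m from
      above.\<close>
    define m where "m = (LEAST m. P m)"
    have Pm: "P m" unfolding m_def by (rule LeastI[of P]) fact
    have "level_count TYPE('n) 0 \<le> 1" using level_count_upper[of 0, where 'n = 'n] by simp
    then have "\<not> P 0" using n by (simp add: P_def)
    then obtain j where j: "m = Suc j" using Pm by (cases m) auto
    have "\<not> P j" using not_less_Least[of j P] j unfolding m_def by auto
    then have nP: "level_count TYPE('n) j * 2 ^ j < 2 * n" by (simp add: P_def)
    define a where "a = ln (real n)"
    have a0: "0 < a" using n by (simp add: a_def)
    \<comment> \<open>From n \<le> (m + 1)^D 2^m \<le> 2^(m d) it follows that m is at least ln n /
      d.\<close>
    have a: "a / d \<le> real m"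
    proof -
      have "real n \<le> real (level_count TYPE('n) m * 2 ^ m)" using Pm by (intro of_nat_mono) (simp add: P_def)
      also have "\<dots> = real (level_count TYPE('n) m) * 2 ^ m" by simp
      also have "\<dots> \<le> (real m + 1) ^ D * 2 ^ m"
        using level_count_le[of m, where 'n = 'n] by (intro mult_right_mono) (auto simp: D_def)
      also have "\<dots> \<le> (2 ^ m) ^ D * 2 ^ m"
      proof -
        have "real (m + 1) \<le> real (2 ^ m)" using less_exp[of m] by (intro of_nat_mono) linarith
        then show ?thesis by (intro mult_right_mono power_mono) auto
      qed
      also have "\<dots> = 2 ^ (m * CARD('n))"
      proof -
        have "m * D + m = m * CARD('n)" unfolding D_def by (cases "CARD('n)") auto
        then show ?thesis by (simp add: power_mult[symmetric] power_add[symmetric])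
      qed
      finally have "ln (real n) \<le> ln (2 ^ (m * CARD('n)))" using n by (subst ln_le_cancel_iff) auto
      also have "\<dots> = real m * d * ln 2" by (simp add: ln_realpow d_def)
      also have "\<dots> \<le> real m * d * 1" using d ln_2_less_1 by (intro mult_left_mono) auto
      finally show ?thesis using d by (simp add: a_def field_simps)
    qed
    \<comment> \<open>A lower bound for m/d in terms of ln n; its D-th power bounds the level counts
      at j and m from below.\<close>
    define b where "b = a / d\<^sup>2"
    have b: "0 < b" "b \<le> real m / d"
      using a a0 d by (auto simp: b_def power2_eq_square divide_right_mono field_simps)
    have lower: "b ^ D \<le> real (level_count TYPE('n) i)" if "j \<le> i" for i
    proof -
      have "real m / d \<le> (real i + 1) / d" using that d j by (intro divide_right_mono) auto
      then have "b ^ D \<le> ((real i + 1) / d) ^ D" using b by (intro power_mono) auto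
      then show ?thesis using lc[of i] by linarith
    qed
    have "b ^ D / (4 * real n) \<le> 2 powr (- real m)"
    proof -
      have "b ^ D * 2 ^ j \<le> real (level_count TYPE('n) j) * 2 ^ j" using lower[of j] by (intro mult_right_mono) auto
      also have "\<dots> = real (level_count TYPE('n) j * 2 ^ j)" by simp
      also have "\<dots> \<le> real (2 * n)" using nP by (intro of_nat_mono) simp
      finally have "b ^ D * 2 ^ m \<le> 4 * real n" by (simp add: j)
      then show ?thesis using n by (simp add: powr_minus powr_realpow field_simps)
    qed
    then have "(b ^ D / (4 * real n)) powr r \<le> (2 powr (- real m)) powr r"
      using b r n by (intro powr_mono2) auto
    then have 1: "(b ^ D / (4 * real n)) powr r \<le> 2 powr (- r * real m)" by (simp add: powr_powr mult.commute)
    have "b powr (real D / 2) = sqrt (b ^ D)"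
      using b by (simp add: powr_half_sqrt[symmetric] powr_realpow[symmetric] powr_powr)
    also have "\<dots> \<le> sqrt (level_count TYPE('n) m)" using lower[of m] j by simp
    finally have 2: "b powr (real D / 2) \<le> sqrt (level_count TYPE('n) m)" .
    have "c * ((a ^ D / real n) powr r * a powr (real D / 2)) = (b ^ D / (4 * real n)) powr r * b powr (real D / 2)"
    proof -
      have "(b ^ D / (4 * real n)) = ((1 / d\<^sup>2) ^ D / 4) * (a ^ D / real n)" by (simp add: b_def power_divide)
      then have "(b ^ D / (4 * real n)) powr r = ((1 / d\<^sup>2) ^ D / 4) powr r * (a ^ D / real n) powr r"
        using a0 n by (simp only: powr_mult)
      moreover have "b powr (real D / 2) = (1 / d\<^sup>2) powr (real D / 2) * a powr (real D / 2)"
      proof -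
        have "b = (1 / d\<^sup>2) * a" by (simp add: b_def)
        then show ?thesis using a0 by (simp only: powr_mult)
      qed
      ultimately show ?thesis by (simp add: c_def mult_ac)
    qed
    also have "\<dots> \<le> 2 powr (- r * real m) * sqrt (level_count TYPE('n) m)"
      using 1 2 by (intro mult_mono) auto
    finally show ?thesis using Pm unfolding P_def a_def by blast
  qed
  show ?thesis unfolding D_def[symmetric] by (rule exI[of _ c], rule conjI[OF c]) (intro allI impI main)
qed

text \<open>The largest affordable level is found as the predecessor of the first level whose cost
  exceeds n. Level 0 costs 64 samples, whence the threshold. The factor 128 is 32 times 4, from the
  cost of level m + 1, and 6 comes from m \<le> 2 ln n and 2 \<le> 4 ln n.\<close>

lemma rate_upper:
  fixes r :: real
  assumes r: "0 < r"
  shows "\<exists>C>0. \<forall>n\<ge>64. \<exists>m. 32 * (2 ^ (m + 1) * (m + 1) ^ D) \<le> n \<and>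
    2 powr (- r * real m) * (real m + 1) powr (real D / 2)
      \<le> C * ((ln (real n) ^ D / real n) powr r * ln (real n) powr (real D / 2))"
proof -
  define C :: real where "C = (128 * 6 ^ D) powr r * 6 powr (real D / 2)"
  have C: "0 < C" by (simp add: C_def)
  have main: "\<exists>m. 32 * (2 ^ (m + 1) * (m + 1) ^ D) \<le> n \<and> 2 powr (- r * real m) * (real m + 1) powr (real D / 2)
      \<le> C * ((ln (real n) ^ D / real n) powr r * ln (real n) powr (real D / 2))" if n: "64 \<le> n" for n
  proof -
    define P :: "nat \<Rightarrow> nat" where "P = (\<lambda>m. 32 * (2 ^ (m + 1) * (m + 1) ^ D))"
    have P_ge: "2 ^ m \<le> P m" for m
    proof -
      have "1 * 2 ^ m * 1 \<le> (32 * 2) * 2 ^ m * (m + 1) ^ D" by (intro mult_le_mono) auto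
      then show ?thesis by (simp add: P_def)
    qed
    define k where "k = (LEAST k. n < P k)"
    have "n < P n" using less_exp[of n] P_ge[of n] by linarith
    then have k: "n < P k" unfolding k_def by (rule LeastI)
    have "\<not> n < P 0" using n by (simp add: P_def)
    then obtain m where m: "k = Suc m" using k by (cases k) auto
    have "\<not> n < P m" using not_less_Least[of m "\<lambda>k. n < P k"] m unfolding k_def by auto
    then have Pm: "P m \<le> n" by simp
    define a where "a = ln (real n)"
    have a2: "1 / 2 \<le> a"
    proof -
      have "ln 2 \<le> a" unfolding a_def using n by (subst ln_le_cancel_iff) auto
      then show ?thesis using ln2_ge_two_thirds by linarith
    qed
    have m_le: "real m + 2 \<le> 6 * a"
    proof -
      have "real (2 ^ m) \<le> real n" using P_ge[of m] Pm by (intro of_nat_mono) linarith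
      then have "ln (2 ^ m) \<le> a" unfolding a_def using n by (subst ln_le_cancel_iff) auto
      then have "real m * ln 2 \<le> a" by (simp add: ln_realpow)
      moreover have "real m * (1 / 2) \<le> real m * ln 2" using ln2_ge_two_thirds by (intro mult_left_mono) auto
      ultimately show ?thesis using a2 by linarith
    qed
    have "2 powr (- real m) \<le> 128 * (6 * a) ^ D / real n"
    proof -
      have "real n \<le> real (P k)" using k by (intro of_nat_mono) simp
      also have "\<dots> = 128 * 2 ^ m * (real m + 2) ^ D" by (simp add: P_def m add.commute)
      also have "\<dots> \<le> 128 * 2 ^ m * (6 * a) ^ D" using m_le by (intro mult_left_mono power_mono) auto
      finally have "real n \<le> 2 ^ m * (128 * (6 * a) ^ D)" by (simp add: mult_ac)
      then show ?thesis using n by (simp add: powr_minus powr_realpow field_simps)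
    qed
    then have "(2 powr (- real m)) powr r \<le> (128 * (6 * a) ^ D / real n) powr r"
      using r by (intro powr_mono2) auto
    then have "2 powr (- r * real m) \<le> (128 * (6 * a) ^ D / real n) powr r" by (simp add: powr_powr mult.commute)
    also have "128 * (6 * a) ^ D / real n = (128 * 6 ^ D) * (a ^ D / real n)" by (simp add: power_mult_distrib)
    also have "\<dots> powr r = (128 * 6 ^ D) powr r * (a ^ D / real n) powr r" using a2 by (subst powr_mult) auto
    finally have 1: "2 powr (- r * real m) \<le> (128 * 6 ^ D) powr r * (a ^ D / real n) powr r" .
    have "(real m + 1) powr (real D / 2) \<le> (6 * a) powr (real D / 2)" using m_le by (intro powr_mono2) auto
    also have "\<dots> = 6 powr (real D / 2) * a powr (real D / 2)" using a2 by (subst powr_mult) auto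
    finally have "2 powr (- r * real m) * (real m + 1) powr (real D / 2)
        \<le> ((128 * 6 ^ D) powr r * (a ^ D / real n) powr r) * (6 powr (real D / 2) * a powr (real D / 2))"
      using 1 by (intro mult_mono) auto
    then show ?thesis using Pm unfolding P_def a_def C_def by (intro exI[of _ m]) (simp add: mult_ac)
  qed
  show ?thesis by (rule exI[of _ C], rule conjI[OF C]) (intro allI impI main)
qed

text \<open>For the finitely many n below 64 the rate stays above a positive constant, while the
  width is at most 1.\<close>

lemma rate_small:
  fixes r :: real
  assumes r: "0 < r"
  shows "\<exists>b>0. \<forall>n\<ge>2. n < 64 \<longrightarrow> b \<le> (ln (real n) ^ D / real n) powr r * ln (real n) powr (real D / 2)"
proof -
  define b :: real where "b = (ln 2 ^ D / 64) powr r * ln 2 powr (real D / 2)"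
  have "b \<le> (ln (real n) ^ D / real n) powr r * ln (real n) powr (real D / 2)" if n: "2 \<le> n" "n < 64" for n
  proof -
    have "ln 2 \<le> ln (real n)" using n by (subst ln_le_cancel_iff) auto
    then show ?thesis
      unfolding b_def using n r by (intro mult_mono powr_mono2 frac_le power_mono) auto
  qed
  moreover have "0 < b" by (simp add: b_def)
  ultimately show ?thesis by blast
qed

theorem theorem2p18:
  fixes r p q :: real and l :: nat
  assumes "r > 1/2" and "1 < q" and "q \<le> 2" and "2 \<le> p" and "real l > r"
  shows "\<exists>c C :: real. c > 0 \<and> C > 0 \<and> (\<forall>n\<ge>2.
    (let d = CARD('n);
         w = linear_sampling_width n
               (HN_ball l r p :: (real ^ 'n \<Rightarrow> 'a::{real_normed_field, euclidean_space}) set)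
               (cbox 0 1) (Lp_space q) (Lp_norm q);
         B = (ln (real n) ^ (d - 1) / real n) powr r * ln (real n) powr (real (d - 1) / 2)
     in ennreal (c * B) \<le> w \<and> w \<le> ennreal (C * B)))"
proof -
  define D where "D = CARD('n) - 1"
  define w where "w = (\<lambda>n. linear_sampling_width n (HN_ball l r p :: (real ^ 'n \<Rightarrow> 'a) set) (cbox 0 1) (Lp_space q) (Lp_norm q))"
  define B where "B = (\<lambda>n. (ln (real n) ^ D / real n) powr r * ln (real n) powr (real D / 2))"
  have r0: "0 < r" using assms by simp
  have p0: "0 < p" and q0: "0 < q" using assms by auto
  obtain c1 where c1: "0 < c1" and low: "\<And>m n. 2 * n \<le> level_count TYPE('n) m * 2 ^ m \<Longrightarrow>
      ennreal (c1 * (2 powr (- r * real m) * sqrt (level_count TYPE('n) m))) \<le> w n"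
    using linear_sampling_width_lower[OF r0 assms(5,2), where 'n = 'n and 'a = 'a] p0 unfolding w_def
    by meson
  obtain c2 where c2: "0 < c2" and rl: "\<And>n. 2 \<le> n \<Longrightarrow> \<exists>m. 2 * n \<le> level_count TYPE('n) m * 2 ^ m \<and>
      c2 * B n \<le> 2 powr (- r * real m) * sqrt (level_count TYPE('n) m)"
    using rate_lower[OF r0, where 'n = 'n] unfolding B_def D_def by blast
  obtain C1 where C1: "0 < C1" and up: "\<And>m n. 32 * (2 ^ (m + 1) * (m + 1) ^ D) \<le> n \<Longrightarrow>
      w n \<le> ennreal (C1 * (2 powr (- r * real m) * (real m + 1) powr (real D / 2)))"
    using linear_sampling_width_upper[OF assms(1) q0 assms(3), where 'n = 'n and 'a = 'a] assms(4) unfolding w_def D_def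
    by meson
  obtain C2 where C2: "0 < C2" and ru: "\<And>n. 64 \<le> n \<Longrightarrow> \<exists>m. 32 * (2 ^ (m + 1) * (m + 1) ^ D) \<le> n \<and>
      2 powr (- r * real m) * (real m + 1) powr (real D / 2) \<le> C2 * B n"
    using rate_upper[OF r0, of D] unfolding B_def by blast
  obtain b where b: "0 < b" and small: "\<And>n. 2 \<le> n \<Longrightarrow> n < 64 \<Longrightarrow> b \<le> B n"
    using rate_small[OF r0, of D] unfolding B_def by blast
  \<comment> \<open>The two entries of the maximum serve n \<ge> 64 and n < 64.\<close>
  define C where "C = max (C1 * C2) (1 / b)"
  have C: "0 < C" using b by (simp add: C_def less_max_iff_disj)
  have bounds: "ennreal (c1 * c2 * B n) \<le> w n \<and> w n \<le> ennreal (C * B n)" if n: "2 \<le> n" for n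
  proof
    obtain m where m: "2 * n \<le> level_count TYPE('n) m * 2 ^ m"
      "c2 * B n \<le> 2 powr (- r * real m) * sqrt (level_count TYPE('n) m)" using rl[OF n] by blast
    have "c1 * c2 * B n \<le> c1 * (2 powr (- r * real m) * sqrt (level_count TYPE('n) m))"
      using m(2) c1 by (simp add: mult.assoc)
    then show "ennreal (c1 * c2 * B n) \<le> w n" using low[OF m(1)] by (meson ennreal_leI order_trans)
  next
    have B0: "0 \<le> B n" by (simp add: B_def)
    show "w n \<le> ennreal (C * B n)"
    proof (cases "64 \<le> n")
      case True
      then obtain m where m: "32 * (2 ^ (m + 1) * (m + 1) ^ D) \<le> n"
        "2 powr (- r * real m) * (real m + 1) powr (real D / 2) \<le> C2 * B n" using ru by blast
      have "C1 * (2 powr (- r * real m) * (real m + 1) powr (real D / 2)) \<le> C1 * (C2 * B n)"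
        using m(2) C1 by (intro mult_left_mono) auto
      also have "\<dots> = (C1 * C2) * B n" by simp
      also have "\<dots> \<le> C * B n" using B0 by (intro mult_right_mono) (auto simp: C_def)
      finally show ?thesis using up[OF m(1)] by (meson ennreal_leI order_trans)
    next
      case False
      have "w n \<le> 1" unfolding w_def using assms by (intro linear_sampling_width_le_one) auto
      also have "1 \<le> ennreal (C * B n)"
      proof -
        have "1 \<le> 1 / b * B n" using small[OF n] False b by (simp add: field_simps)
        also have "\<dots> \<le> C * B n" using B0 by (intro mult_right_mono) (auto simp: C_def)
        finally show ?thesis by simp
      qed
      finally show ?thesis .
    qed
  qed
  have "0 < c1 * c2" using c1 c2 by simp
  moreover have "\<forall>n\<ge>2. ennreal (c1 * c2 * B n) \<le> w n \<and> w n \<le> ennreal (C * B n)" using bounds by blast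
  ultimately show ?thesis
    unfolding Let_def D_def[symmetric] w_def B_def using C by blast
qed

end
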